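(* Let $X_1,\dots,X_n\in\mathbb{R}^p$ be independent mean-zero random vectors, in the setting and notation given in the context. For any $m,r_{n,m}\in(0,\infty)$, $$\begin{aligned}\delta_{n,m}\ \le\ &2^{2m^2/3+8m/3+1}\varepsilon_n^{m+1}\Phi_{AC,0}+(2^{2m/3+1}+2)\Phi_{AC,m}\varepsilon_n+2C_0\log(ep)\,r_{n,m}^m\,\varepsilon_n^{-2}M_n(2^{2m/3}\varepsilon_n)\\ &+\frac{r_{n,m}^m\bar L_{n,m}}{L_n2^me^{\mathfrak{C}}}\left(\frac{\log(ep)}{n(2^{2m+1}e^{2\mathfrak{C}}C_0L_n)}\right)^{(m+1)/3}+\sup_{r\ge r_{n,m}}\max_{0\le k\le n}r^m\,\mathbb{P}(\|U_{n,k}\|\ge r),\end{aligned}$$ where $$\varepsilon_n=\frac{\left(2e^{2\mathfrak{C}}C_0\log^2(ep)L_n\right)^{1/3}}{n^{1/6}}.$$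
   Context: Setting. $\|\cdot\|$ is the $l_\infty$-norm on $\mathbb{R}^p$ and $x(j)$ is the $j$-th coordinate of $x$. $X_1,\dots,X_n$ are independent mean-zero random vectors in $\mathbb{R}^p$ with covariance matrices $\Sigma_i=\mathbb{E}[X_iX_i^\top]$; $Y_1,\dots,Y_n$ are independent Gaussian vectors, independent of the $X_i$'s, with $Y_i\sim N_p(0,\Sigma_i)$. For $0\le k\le n$, $U_{n,k}:=n^{-1/2}(X_1+\dots+X_k+Y_{k+1}+\dots+Y_n)$, and $$\delta_{n,m}:=\sup_{r\ge0}\max_{1\le k\le n}r^m|\mathbb{P}(\|U_{n,k}\|\le r)-\mathbb{P}(\|U_{n,0}\|\le r)|.$$ Pseudo-moments. $\zeta_i(A):=\mathbb{P}(X_i\in A)-\mathbb{P}(Y_i\in A)$ is a signed measure and $|\zeta_i|$ is its total variation measure. Let $\mu_i$ be the median of $\|Y_i\|$ and $\sigma_i^2:=\max_{1\le j\le p}\mathrm{Var}(Y_i(j))$. Define $$L_n:=\frac1n\sum_{i=1}^n\max_{1\le j\le p}\int|x(j)|^3|\zeta_i|(dx),$$ $$\bar L_{n,m}:=\frac1n\sum_{i=1}^n\left[\mu_i^{m+1}+\sigma_i^{m+1}((m+1)/e)^{(m+1)/2}\right]\max_{1\le j\le p}\int|x(j)|^3|\zeta_i|(dx)\quad(m>0),$$ $$M_n(\phi):=\frac1n\sum_{i=1}^n\int\|x\|^2\mathbf{1}\{\|x\|\ge n^{1/2}\phi/\log(ep)\}|\zeta_i|(dx),\quad \phi>0.$$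 It is assumed that $0<L_n<\infty$. Anti-concentration constants. Let $\mu$ be the median of $\|U_{n,0}\|$, and $\sigma_{\max}^2,\sigma_{\min}^2$ the maximum and minimum over $1\le j\le p$ of $\mathrm{Var}(U_{n,0}(j))$, with $\sigma_{\min}>0$. For $m\ge0$ put $$\Phi_{AC,m}:=\Theta_m\frac{(\mu+\sigma_{\max})^{m+1}\sigma_{\max}^2+(1+\sigma_{\max})^2\sigma_{\max}^{m+2}}{\sigma_{\min}^4},$$ where $\Theta_m$ is a fixed constant depending only on $m$ such that, for this form of $\Phi_{AC,m}$ (with the corresponding $\mu,\sigma_{\max},\sigma_{\min}$), every centered sample continuous Gaussian process $Y$ on a compact metric space with positive minimal variance satisfies $\sup_{r\ge0}r^m\mathbb{P}(r-\varepsilon\le\|Y\|\le r+\varepsilon)\le\Phi_{AC,m}\varepsilon$ for all $\varepsilon\ge0$. Smoothing constants. $C_0,\mathfrak{C}>0$ are fixed universal constants with the following property: for every $p\ge1$, $r\ge0$, $\varepsilon>0$ there are a three times continuously differentiable $\varphi:\mathbb{R}^p\to[0,1]$ and nonnegative measurable functions $D_j,D_{jk},D_{jkl}$ ($1\le j,k,l\le p$) on $\mathbb{R}^p$ such that (1) $\mathbf{1}\{\|x\|\le r\}\le\varphi(x)\le\mathbf{1}\{\|x\|\le r+\varepsilon\}$; (2) $|\partial_j\varphi|\le D_j$, $|\partial_{jk}\varphi|\le D_{jk}$, $|\partial_{jkl}\varphi|\le D_{jkl}$ pointwise, and for all $x$, $\sum_jD_j(x)\le C_0\varepsilon^{-1}$,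 $\sum_{j,k}D_{jk}(x)\le C_0\log(ep)\varepsilon^{-2}$, $\sum_{j,k,l}D_{jkl}(x)\le C_0\log^2(ep)\varepsilon^{-3}$; (3) for all $x,w$ and each $D\in\{D_j,D_{jk},D_{jkl}\}$, $e^{-\mathfrak{C}\log(ep)\|w\|/\varepsilon}D(x)\le D(x+w)\le e^{\mathfrak{C}\log(ep)\|w\|/\varepsilon}D(x)$.
   Formalization: For m>1 the stated property of Θ_m is contradictory (r=ε→∞ makes the left side of order ε^m, the right side only of order ε); here, for m>1, the anti-concentration bound is required only when 2ε≤r, while for m≤1 it is as stated. *)

theory Defs
  imports "HOL-Probability.Probability"
begin

section \<open>The space R^p with the l-infinity norm\<close>

text \<open>The dimension is quantified inside one of the hypotheses below, so R^p is the carrier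
  \<open>{..<p} \<rightarrow>\<^sub>E UNIV\<close> with its product sigma-algebra; coordinates are numbered from \<open>0\<close>.\<close>

abbreviation Rvec :: "nat \<Rightarrow> (nat \<Rightarrow> real) measure" where
  "Rvec p \<equiv> PiM {..<p} (\<lambda>_. borel)"

definition linfnorm :: "nat \<Rightarrow> (nat \<Rightarrow> real) \<Rightarrow> real" where
  "linfnorm p x = Max ((\<lambda>j. \<bar>x j\<bar>) ` {..<p})"

definition vadd :: "nat \<Rightarrow> (nat \<Rightarrow> real) \<Rightarrow> (nat \<Rightarrow> real) \<Rightarrow> (nat \<Rightarrow> real)" where
  "vadd p x w = (\<lambda>j\<in>{..<p}. x j + w j)"

text \<open>\<open>r ^ m\<close> for real \<open>r, m \<ge> 0\<close> with the convention \<open>0 ^ 0 = 1\<close> (whereas \<open>0 powr 0 = 0\<close>).\<close>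

definition rpow :: "real \<Rightarrow> real \<Rightarrow> real" where
  "rpow r m = (if m = 0 then 1 else r powr m)"

definition log_ep :: "nat \<Rightarrow> real" where
  "log_ep p = ln (exp 1 * real p)"


section \<open>Medians, variances, Gaussian laws\<close>

definition is_median :: "'a measure \<Rightarrow> ('a \<Rightarrow> real) \<Rightarrow> real \<Rightarrow> bool" where
  "is_median M Z q \<longleftrightarrow>
     measure M {\<omega> \<in> space M. Z \<omega> \<le> q} \<ge> 1/2 \<and> measure M {\<omega> \<in> space M. Z \<omega> \<ge> q} \<ge> 1/2"

text \<open>Only used for norms of centered Gaussian vectors and processes, whose median is unique.\<close>

definition median :: "'a measure \<Rightarrow> ('a \<Rightarrow> real) \<Rightarrow> real" where
  "median M Z = (SOME q. is_median M Z q)"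

definition Var :: "'a measure \<Rightarrow> ('a \<Rightarrow> real) \<Rightarrow> real" where
  "Var M Z = (\<integral>\<omega>. (Z \<omega> - (\<integral>\<omega>'. Z \<omega>' \<partial>M))\<^sup>2 \<partial>M)"

text \<open>The law \<open>N(a, v)\<close> with variance \<open>v \<ge> 0\<close>; the degenerate case is a point mass.\<close>

definition normal_law :: "real \<Rightarrow> real \<Rightarrow> real measure" where
  "normal_law a v = (if v = 0 then return borel a
     else density lborel (\<lambda>x. ennreal (normal_density a (sqrt v) x)))"

text \<open>\<open>Y \<sim> N\<^sub>p(0, S)\<close>, with \<open>S\<close> possibly singular: every linear combination \<open>\<langle>a, Y\<rangle>\<close> has
  law \<open>N(0, \<langle>a, S a\<rangle>)\<close>.\<close>

definition gaussian_vector ::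
  "'a measure \<Rightarrow> nat \<Rightarrow> ('a \<Rightarrow> nat \<Rightarrow> real) \<Rightarrow> (nat \<Rightarrow> nat \<Rightarrow> real) \<Rightarrow> bool" where
  "gaussian_vector M p Y S \<longleftrightarrow> Y \<in> measurable M (Rvec p) \<and>
     (\<forall>a :: nat \<Rightarrow> real. distr M borel (\<lambda>\<omega>. \<Sum>j<p. a j * Y \<omega> j)
        = normal_law 0 (\<Sum>j<p. \<Sum>k<p. a j * S j k * a k))"


section \<open>Total variation of a signed measure\<close>

text \<open>\<open>|\<zeta>|(A)\<close> is the supremum of \<open>\<Sum>i. |\<zeta>(B i)|\<close> over all countable measurable partitions
  \<open>B\<close> of \<open>A\<close>.\<close>

definition tv_fun :: "'b measure \<Rightarrow> ('b set \<Rightarrow> real) \<Rightarrow> 'b set \<Rightarrow> ennreal" where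
  "tv_fun N \<zeta> A =
     (SUP B \<in> {B :: nat \<Rightarrow> 'b set. range B \<subseteq> sets N \<and> disjoint_family B \<and> (\<Union>i. B i) = A}.
        (\<Sum>i. ennreal \<bar>\<zeta> (B i)\<bar>))"

definition tv_measure :: "'b measure \<Rightarrow> ('b set \<Rightarrow> real) \<Rightarrow> 'b measure" where
  "tv_measure N \<zeta> = measure_of (space N) (sets N) (tv_fun N \<zeta>)"


text \<open>For a difference of finite measures \<open>tv_fun\<close> is countably additive, so it is the measure
  function of \<open>tv_measure\<close>.\<close>

lemma emeasure_tv_measure:
  assumes P: "finite_measure P" and Q: "finite_measure Q"
    and sP: "sets P = sets N" and sQ: "sets Q = sets N"
    and \<zeta>: "\<And>A. A \<in> sets N \<Longrightarrow> \<zeta> A = measure P A - measure Q A"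
    and A: "A \<in> sets N"
  shows "emeasure (tv_measure N \<zeta>) A = tv_fun N \<zeta> A"
proof -
  interpret P: finite_measure P by fact
  interpret Q: finite_measure Q by fact
  obtain Y where Y: "Y \<in> sets N"
    and pos0: "\<And>X. X \<in> sets N \<Longrightarrow> X \<subseteq> Y \<Longrightarrow> emeasure Q X \<le> emeasure P X"
    and neg0: "\<And>X. X \<in> sets N \<Longrightarrow> X \<inter> Y = {} \<Longrightarrow> emeasure P X \<le> emeasure Q X"
    using finite_unsigned_Hahn_decomposition[OF P Q] sP sQ by auto
  have pos: "0 \<le> \<zeta> X" if "X \<in> sets N" "X \<subseteq> Y" for X
    using pos0[OF that] \<zeta>[OF that(1)] by (simp add: P.emeasure_eq_measure Q.emeasure_eq_measure)
  have neg: "\<zeta> X \<le> 0" if "X \<in> sets N" "X \<inter> Y = {}" for X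
    using neg0[OF that] \<zeta>[OF that(1)] by (simp add: P.emeasure_eq_measure Q.emeasure_eq_measure)
  have sums: "(\<lambda>i. \<zeta> (B i)) sums \<zeta> (\<Union>i. B i)"
    if "range B \<subseteq> sets N" "disjoint_family B" for B :: "nat \<Rightarrow> _"
  proof -
    have "\<zeta> (B i) = measure P (B i) - measure Q (B i)" for i
      using that by (intro \<zeta>) auto
    moreover have "\<zeta> (\<Union>i. B i) = measure P (\<Union>i. B i) - measure Q (\<Union>i. B i)"
      using that by (intro \<zeta>) auto
    ultimately show ?thesis
      using sums_diff[OF P.finite_measure_UNION[of B] Q.finite_measure_UNION[of B]] that sP sQ
      by simp
  qed
  define v where "v X = \<zeta> (X \<inter> Y) - \<zeta> (X - Y)" for X
  have v_nonneg: "0 \<le> v X" if "X \<in> sets N" for X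
  proof -
    have "0 \<le> \<zeta> (X \<inter> Y)" using that Y by (intro pos) auto
    moreover have "\<zeta> (X - Y) \<le> 0" using that Y by (intro neg) auto
    ultimately show ?thesis by (simp add: v_def)
  qed
  have v_sums: "(\<lambda>i. v (B i)) sums v (\<Union>i. B i)"
    if B: "range B \<subseteq> sets N" "disjoint_family B" for B :: "nat \<Rightarrow> _"
  proof -
    have "(\<lambda>i. \<zeta> (B i \<inter> Y)) sums \<zeta> (\<Union>i. B i \<inter> Y)"
      using B Y by (intro sums) (auto simp: disjoint_family_on_def)
    moreover have "(\<lambda>i. \<zeta> (B i - Y)) sums \<zeta> (\<Union>i. B i - Y)"
      using B Y by (intro sums) (auto simp: disjoint_family_on_def)
    moreover have "(\<Union>i. B i \<inter> Y) = (\<Union>i. B i) \<inter> Y" "(\<Union>i. B i - Y) = (\<Union>i. B i) - Y"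
      by auto
    ultimately show ?thesis
      unfolding v_def by (simp add: sums_diff)
  qed
  have split: "\<zeta> X = \<zeta> (X \<inter> Y) + \<zeta> (X - Y)" if X: "X \<in> sets N" for X
  proof -
    have "measure P X = measure P (X \<inter> Y) + measure P (X - Y)"
      using P.finite_measure_Union[of "X \<inter> Y" "X - Y"] X Y sP by (simp add: Int_Diff_disjoint Int_Diff_Un)
    moreover have "measure Q X = measure Q (X \<inter> Y) + measure Q (X - Y)"
      using Q.finite_measure_Union[of "X \<inter> Y" "X - Y"] X Y sQ by (simp add: Int_Diff_disjoint Int_Diff_Un)
    ultimately show ?thesis
      using X Y by (simp add: \<zeta>)
  qed
  have le_v: "\<bar>\<zeta> X\<bar> \<le> v X" if "X \<in> sets N" for X
  proof -
    have "0 \<le> \<zeta> (X \<inter> Y)" using that Y by (intro pos) auto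
    moreover have "\<zeta> (X - Y) \<le> 0" using that Y by (intro neg) auto
    ultimately show ?thesis
      using split[OF that] by (simp add: v_def)
  qed
  have eq: "tv_fun N \<zeta> X = ennreal (v X)" if X: "X \<in> sets N" for X
  proof (rule antisym)
    show "tv_fun N \<zeta> X \<le> ennreal (v X)"
      unfolding tv_fun_def
    proof (rule SUP_least, safe)
      fix B :: "nat \<Rightarrow> _" assume B: "range B \<subseteq> sets N" "disjoint_family B" "X = (\<Union>i. B i)"
      have "(\<lambda>i. ennreal (v (B i))) sums ennreal (v (\<Union>i. B i))"
        using v_sums[OF B(1,2)] v_nonneg B(1) X B(3) by (subst sums_ennreal) auto
      moreover have "(\<Sum>i. ennreal \<bar>\<zeta> (B i)\<bar>) \<le> (\<Sum>i. ennreal (v (B i)))"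
        using le_v B(1) by (intro suminf_le ennreal_leI) auto
      ultimately show "(\<Sum>i. ennreal \<bar>\<zeta> (B i)\<bar>) \<le> ennreal (v (\<Union>i. B i))"
        by (simp add: sums_iff)
    qed
    define B where "B = binaryset (X \<inter> Y) (X - Y)"
    have B: "range B \<subseteq> sets N" "disjoint_family B" "(\<Union>i. B i) = X"
    proof -
      show "range B \<subseteq> sets N" using X Y by (simp add: B_def range_binaryset_eq)
      show "disjoint_family B" unfolding B_def disjoint_family_on_def binaryset_def by simp blast
      show "(\<Union>i. B i) = X" unfolding B_def UN_binaryset_eq by blast
    qed
    have z: "\<zeta> {} = 0" using \<zeta>[of "{}"] by simp
    have "(\<Sum>i. ennreal \<bar>\<zeta> (B i)\<bar>) = (\<Sum>i\<in>{0,1}. ennreal \<bar>\<zeta> (B i)\<bar>)"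
      by (rule suminf_finite) (auto simp: B_def binaryset_def z)
    also have "\<dots> = ennreal \<bar>\<zeta> (X \<inter> Y)\<bar> + ennreal \<bar>\<zeta> (X - Y)\<bar>"
      by (simp add: B_def binaryset_def)
    also have "\<dots> = ennreal (v X)"
    proof -
      have "0 \<le> \<zeta> (X \<inter> Y)" using X Y by (intro pos) auto
      moreover have "\<zeta> (X - Y) \<le> 0" using X Y by (intro neg) auto
      ultimately show ?thesis by (simp add: v_def flip: ennreal_plus)
    qed
    finally show "ennreal (v X) \<le> tv_fun N \<zeta> X"
      unfolding tv_fun_def using B by (intro SUP_upper2[of B]) auto
  qed
  have "countably_additive (sets N) (tv_fun N \<zeta>)"
  proof (rule countably_additiveI)
    fix B :: "nat \<Rightarrow> _"
    assume B: "range B \<subseteq> sets N" "disjoint_family B" "(\<Union>i. B i) \<in> sets N"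
    have "(\<lambda>i. ennreal (v (B i))) sums ennreal (v (\<Union>i. B i))"
      using v_sums[OF B(1,2)] v_nonneg B(1,3) by (subst sums_ennreal) auto
    then show "(\<Sum>i. tv_fun N \<zeta> (B i)) = tv_fun N \<zeta> (\<Union>i. B i)"
      using B(1) eq[OF B(3)] eq[of "B _"] by (simp add: sums_iff image_subset_iff)
  qed
  moreover have "positive (sets N) (tv_fun N \<zeta>)"
    using eq[of "{}"] \<zeta>[of "{}"] by (simp add: positive_def v_def)
  ultimately show ?thesis
    using A by (intro emeasure_measure_of[OF tv_measure_def])
      (auto simp: tv_measure_def sets.space_closed sets.sigma_sets_eq)
qed


section \<open>The interpolation between X and Y\<close>

definition cov :: "'a measure \<Rightarrow> ('a \<Rightarrow> nat \<Rightarrow> real) \<Rightarrow> nat \<Rightarrow> nat \<Rightarrow> real" where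
  "cov M Z j k = (\<integral>\<omega>. Z \<omega> j * Z \<omega> k \<partial>M)"

definition U :: "nat \<Rightarrow> nat \<Rightarrow> (nat \<Rightarrow> 'a \<Rightarrow> nat \<Rightarrow> real) \<Rightarrow> (nat \<Rightarrow> 'a \<Rightarrow> nat \<Rightarrow> real)
    \<Rightarrow> nat \<Rightarrow> 'a \<Rightarrow> nat \<Rightarrow> real" where
  "U p n X Y k \<omega> =
     (\<lambda>j\<in>{..<p}. ((\<Sum>i=1..k. X i \<omega> j) + (\<Sum>i=k+1..n. Y i \<omega> j)) / sqrt (real n))"

text \<open>A supremum in \<^typ>\<open>ennreal\<close>, since it may be infinite.\<close>

definition delta :: "'a measure \<Rightarrow> nat \<Rightarrow> nat \<Rightarrow> (nat \<Rightarrow> 'a \<Rightarrow> nat \<Rightarrow> real)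
    \<Rightarrow> (nat \<Rightarrow> 'a \<Rightarrow> nat \<Rightarrow> real) \<Rightarrow> real \<Rightarrow> ennreal" where
  "delta M p n X Y m =
     (SUP r\<in>{0..}. ennreal (Max ((\<lambda>k. rpow r m *
        \<bar>measure M {\<omega> \<in> space M. linfnorm p (U p n X Y k \<omega>) \<le> r}
         - measure M {\<omega> \<in> space M. linfnorm p (U p n X Y 0 \<omega>) \<le> r}\<bar>) ` {1..n})))"

definition tail_sup :: "'a measure \<Rightarrow> nat \<Rightarrow> nat \<Rightarrow> (nat \<Rightarrow> 'a \<Rightarrow> nat \<Rightarrow> real)
    \<Rightarrow> (nat \<Rightarrow> 'a \<Rightarrow> nat \<Rightarrow> real) \<Rightarrow> real \<Rightarrow> real \<Rightarrow> ennreal" where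
  "tail_sup M p n X Y m s =
     (SUP r\<in>{s..}. ennreal (Max ((\<lambda>k. rpow r m *
        measure M {\<omega> \<in> space M. linfnorm p (U p n X Y k \<omega>) \<ge> r}) ` {0..n})))"


section \<open>Pseudo-moments\<close>

definition zeta :: "'a measure \<Rightarrow> ('a \<Rightarrow> nat \<Rightarrow> real) \<Rightarrow> ('a \<Rightarrow> nat \<Rightarrow> real)
    \<Rightarrow> (nat \<Rightarrow> real) set \<Rightarrow> real" where
  "zeta M X Y A = measure M {\<omega> \<in> space M. X \<omega> \<in> A} - measure M {\<omega> \<in> space M. Y \<omega> \<in> A}"

definition abs_zeta :: "'a measure \<Rightarrow> nat \<Rightarrow> ('a \<Rightarrow> nat \<Rightarrow> real) \<Rightarrow> ('a \<Rightarrow> nat \<Rightarrow> real)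
    \<Rightarrow> (nat \<Rightarrow> real) measure" where
  "abs_zeta M p X Y = tv_measure (Rvec p) (zeta M X Y)"

definition third_pseudo_moment :: "'a measure \<Rightarrow> nat \<Rightarrow> ('a \<Rightarrow> nat \<Rightarrow> real)
    \<Rightarrow> ('a \<Rightarrow> nat \<Rightarrow> real) \<Rightarrow> ennreal" where
  "third_pseudo_moment M p X Y =
     Max ((\<lambda>j. \<integral>\<^sup>+x. ennreal (\<bar>x j\<bar> ^ 3) \<partial>(abs_zeta M p X Y)) ` {..<p})"

definition L_n :: "'a measure \<Rightarrow> nat \<Rightarrow> nat \<Rightarrow> (nat \<Rightarrow> 'a \<Rightarrow> nat \<Rightarrow> real)
    \<Rightarrow> (nat \<Rightarrow> 'a \<Rightarrow> nat \<Rightarrow> real) \<Rightarrow> ennreal" where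
  "L_n M p n X Y = ennreal (1 / real n) * (\<Sum>i=1..n. third_pseudo_moment M p (X i) (Y i))"

definition mu_i :: "'a measure \<Rightarrow> nat \<Rightarrow> ('a \<Rightarrow> nat \<Rightarrow> real) \<Rightarrow> real" where
  "mu_i M p Z = median M (\<lambda>\<omega>. linfnorm p (Z \<omega>))"

definition sigma_max :: "'a measure \<Rightarrow> nat \<Rightarrow> ('a \<Rightarrow> nat \<Rightarrow> real) \<Rightarrow> real" where
  "sigma_max M p Z = sqrt (Max ((\<lambda>j. Var M (\<lambda>\<omega>. Z \<omega> j)) ` {..<p}))"

definition sigma_min :: "'a measure \<Rightarrow> nat \<Rightarrow> ('a \<Rightarrow> nat \<Rightarrow> real) \<Rightarrow> real" where
  "sigma_min M p Z = sqrt (Min ((\<lambda>j. Var M (\<lambda>\<omega>. Z \<omega> j)) ` {..<p}))"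

definition Lbar_n :: "'a measure \<Rightarrow> nat \<Rightarrow> nat \<Rightarrow> (nat \<Rightarrow> 'a \<Rightarrow> nat \<Rightarrow> real)
    \<Rightarrow> (nat \<Rightarrow> 'a \<Rightarrow> nat \<Rightarrow> real) \<Rightarrow> real \<Rightarrow> ennreal" where
  "Lbar_n M p n X Y m = ennreal (1 / real n) *
     (\<Sum>i=1..n. ennreal (mu_i M p (Y i) powr (m + 1)
           + sigma_max M p (Y i) powr (m + 1) * ((m + 1) / exp 1) powr ((m + 1) / 2))
        * third_pseudo_moment M p (X i) (Y i))"

definition M_n :: "'a measure \<Rightarrow> nat \<Rightarrow> nat \<Rightarrow> (nat \<Rightarrow> 'a \<Rightarrow> nat \<Rightarrow> real)
    \<Rightarrow> (nat \<Rightarrow> 'a \<Rightarrow> nat \<Rightarrow> real) \<Rightarrow> real \<Rightarrow> ennreal" where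
  "M_n M p n X Y \<phi> = ennreal (1 / real n) *
     (\<Sum>i=1..n. \<integral>\<^sup>+x. ennreal ((linfnorm p x)\<^sup>2) *
         indicator {x. linfnorm p x \<ge> sqrt (real n) * \<phi> / log_ep p} x \<partial>(abs_zeta M p (X i) (Y i)))"


section \<open>Anti-concentration constants\<close>

text \<open>\<open>\<Phi>\<^bsub>AC,m\<^esub>\<close> as a function of the constant \<open>\<Theta>\<^sub>m\<close>, \<open>m\<close>, the median and the extremal standard
  deviations.\<close>

definition AC_form :: "real \<Rightarrow> real \<Rightarrow> real \<Rightarrow> real \<Rightarrow> real \<Rightarrow> real" where
  "AC_form \<theta> m \<mu> smax smin =
     \<theta> * (((\<mu> + smax) powr (m + 1) * smax\<^sup>2 + (1 + smax)\<^sup>2 * smax powr (m + 2)) / smin ^ 4)"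

definition centered_gaussian_process ::
  "'w measure \<Rightarrow> 't set \<Rightarrow> ('t \<Rightarrow> 'w \<Rightarrow> real) \<Rightarrow> bool" where
  "centered_gaussian_process N S Z \<longleftrightarrow> (\<forall>t\<in>S. Z t \<in> borel_measurable N) \<and>
     (\<forall>F a. finite F \<and> F \<subseteq> S \<longrightarrow>
        (\<exists>v\<ge>0. distr N borel (\<lambda>\<omega>. \<Sum>t\<in>F. a t * Z t \<omega>) = normal_law 0 v))"

definition sample_continuous ::
  "'w measure \<Rightarrow> 't set \<Rightarrow> ('t \<Rightarrow> 't \<Rightarrow> real) \<Rightarrow> ('t \<Rightarrow> 'w \<Rightarrow> real) \<Rightarrow> bool" where
  "sample_continuous N S d Z \<longleftrightarrow>
     (\<forall>\<omega>\<in>space N. continuous_map (Metric_space.mtopology S d) euclideanreal (\<lambda>t. Z t \<omega>))"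

text \<open>\<open>\<theta>\<close> is admissible as \<open>\<Theta>\<^sub>m\<close>. The fixed types lose no generality: a compact metric space has
  at most the cardinality of the continuum, hence an isometric copy with carrier a set of reals,
  and a sample continuous process on it has a copy with the same law on the space of its paths,
  which are functions of type \<^typ>\<open>real \<Rightarrow> real\<close> (with an arbitrary sigma-algebra). Testing
  with any one process shows \<open>\<theta> \<ge> 0\<close>.

  For \<open>m \<le> 1\<close> all \<open>r, \<epsilon> \<ge> 0\<close> are admitted. For \<open>m > 1\<close> no constant can serve all \<open>r, \<epsilon> \<ge> 0\<close>:
  with \<open>r = \<epsilon> \<rightarrow> \<infinity>\<close> the left-hand side is asymptotic to \<open>\<epsilon> ^ m\<close>. So for \<open>m > 1\<close> the bound is
  only required when \<open>2 * \<epsilon> \<le> r\<close>, which is implied by the bound for all \<open>r\<close> and \<open>\<epsilon>\<close>.\<close>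

definition anti_concentration_constant :: "real \<Rightarrow> real \<Rightarrow> bool" where
  "anti_concentration_constant m \<theta> \<longleftrightarrow>
     (\<forall>(N :: (real \<Rightarrow> real) measure) (S :: real set) d (Z :: real \<Rightarrow> (real \<Rightarrow> real) \<Rightarrow> real).
        prob_space N \<and> Metric_space S d \<and> S \<noteq> {} \<and> compact_space (Metric_space.mtopology S d) \<and>
        centered_gaussian_process N S Z \<and> sample_continuous N S d Z \<and>
        (INF t\<in>S. Var N (Z t)) > 0 \<longrightarrow>
        (\<forall>\<epsilon>\<ge>0. \<forall>r\<ge>0. (1 < m \<longrightarrow> 2 * \<epsilon> \<le> r) \<longrightarrow> rpow r m * measure N {\<omega> \<in> space N.
              r - \<epsilon> \<le> (SUP t\<in>S. \<bar>Z t \<omega>\<bar>) \<and> (SUP t\<in>S. \<bar>Z t \<omega>\<bar>) \<le> r + \<epsilon>}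
           \<le> AC_form \<theta> m (median N (\<lambda>\<omega>. SUP t\<in>S. \<bar>Z t \<omega>\<bar>))
                (sqrt (SUP t\<in>S. Var N (Z t))) (sqrt (INF t\<in>S. Var N (Z t))) * \<epsilon>))"

definition Phi_AC :: "'a measure \<Rightarrow> nat \<Rightarrow> nat \<Rightarrow> (nat \<Rightarrow> 'a \<Rightarrow> nat \<Rightarrow> real)
    \<Rightarrow> (nat \<Rightarrow> 'a \<Rightarrow> nat \<Rightarrow> real) \<Rightarrow> (real \<Rightarrow> real) \<Rightarrow> real \<Rightarrow> real" where
  "Phi_AC M p n X Y \<Theta> m = AC_form (\<Theta> m) m
     (median M (\<lambda>\<omega>. linfnorm p (U p n X Y 0 \<omega>)))
     (sigma_max M p (U p n X Y 0)) (sigma_min M p (U p n X Y 0))"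


section \<open>Smoothing constants\<close>

definition has_partial :: "nat \<Rightarrow> nat \<Rightarrow> ((nat \<Rightarrow> real) \<Rightarrow> real) \<Rightarrow> ((nat \<Rightarrow> real) \<Rightarrow> real) \<Rightarrow> bool"
  where "has_partial p j f g \<longleftrightarrow>
    (\<forall>x\<in>space (Rvec p). ((\<lambda>t. f (x(j := t))) has_real_derivative g x) (at (x j)))"

text \<open>\<open>f\<close> is three times continuously differentiable on R^p, with partial derivatives
  \<open>f1 j = \<partial>\<^sub>j f\<close>, \<open>f2 j k = \<partial>\<^sub>j\<^sub>k f\<close>, \<open>f3 j k l = \<partial>\<^sub>j\<^sub>k\<^sub>l f\<close>. On \<open>space (Rvec p)\<close> the product topology
  of \<^typ>\<open>nat \<Rightarrow> real\<close> is the usual topology of R^p.\<close>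

definition C3_with_partials :: "nat \<Rightarrow> ((nat \<Rightarrow> real) \<Rightarrow> real) \<Rightarrow> (nat \<Rightarrow> (nat \<Rightarrow> real) \<Rightarrow> real)
    \<Rightarrow> (nat \<Rightarrow> nat \<Rightarrow> (nat \<Rightarrow> real) \<Rightarrow> real) \<Rightarrow> (nat \<Rightarrow> nat \<Rightarrow> nat \<Rightarrow> (nat \<Rightarrow> real) \<Rightarrow> real) \<Rightarrow> bool" where
  "C3_with_partials p f f1 f2 f3 \<longleftrightarrow>
     continuous_on (space (Rvec p)) f \<and>
     (\<forall>j<p. has_partial p j f (f1 j) \<and> continuous_on (space (Rvec p)) (f1 j)) \<and>
     (\<forall>j<p. \<forall>k<p. has_partial p k (f1 j) (f2 j k) \<and> continuous_on (space (Rvec p)) (f2 j k)) \<and>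
     (\<forall>j<p. \<forall>k<p. \<forall>l<p. has_partial p l (f2 j k) (f3 j k l) \<and>
        continuous_on (space (Rvec p)) (f3 j k l))"

definition stable_dominator ::
  "nat \<Rightarrow> real \<Rightarrow> real \<Rightarrow> ((nat \<Rightarrow> real) \<Rightarrow> real) \<Rightarrow> ((nat \<Rightarrow> real) \<Rightarrow> real) \<Rightarrow> bool" where
  "stable_dominator p C \<epsilon> g D \<longleftrightarrow> D \<in> borel_measurable (Rvec p) \<and>
     (\<forall>x\<in>space (Rvec p). 0 \<le> D x \<and> \<bar>g x\<bar> \<le> D x) \<and>
     (\<forall>x\<in>space (Rvec p). \<forall>w\<in>space (Rvec p).
        exp (- C * log_ep p * linfnorm p w / \<epsilon>) * D x \<le> D (vadd p x w) \<and>
        D (vadd p x w) \<le> exp (C * log_ep p * linfnorm p w / \<epsilon>) * D x)"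

definition smoothing_constants :: "real \<Rightarrow> real \<Rightarrow> bool" where
  "smoothing_constants C0 C \<longleftrightarrow> 0 < C0 \<and> 0 < C \<and>
     (\<forall>p\<ge>1. \<forall>r\<ge>0. \<forall>\<epsilon>>0. \<exists>f f1 f2 f3 D1 D2 D3.
        C3_with_partials p f f1 f2 f3 \<and>
        (\<forall>x\<in>space (Rvec p). f x \<in> {0..1} \<and>
           indicator {x. linfnorm p x \<le> r} x \<le> f x \<and>
           f x \<le> indicator {x. linfnorm p x \<le> r + \<epsilon>} x) \<and>
        (\<forall>j<p. stable_dominator p C \<epsilon> (f1 j) (D1 j)) \<and>
        (\<forall>j<p. \<forall>k<p. stable_dominator p C \<epsilon> (f2 j k) (D2 j k)) \<and>
        (\<forall>j<p. \<forall>k<p. \<forall>l<p. stable_dominator p C \<epsilon> (f3 j k l) (D3 j k l)) \<and>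
        (\<forall>x\<in>space (Rvec p).
           (\<Sum>j<p. D1 j x) \<le> C0 / \<epsilon> \<and>
           (\<Sum>j<p. \<Sum>k<p. D2 j k x) \<le> C0 * log_ep p / \<epsilon> ^ 2 \<and>
           (\<Sum>j<p. \<Sum>k<p. \<Sum>l<p. D3 j k l x) \<le> C0 * (log_ep p)\<^sup>2 / \<epsilon> ^ 3))"

definition eps_n :: "real \<Rightarrow> real \<Rightarrow> nat \<Rightarrow> nat \<Rightarrow> real \<Rightarrow> real" where
  "eps_n C0 C p n L =
     (2 * exp (2 * C) * C0 * (log_ep p)\<^sup>2 * L) powr (1/3) / real n powr (1/6)"

end

theory Submission
  imports Defs
begin

text \<open>The argument is Lindeberg's. The indicator of a ball of radius about \<open>r\<close> is replaced by a smooth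
  function at scale \<open>e = 2 powr (2 * m / 3) * \<epsilon>\<close>, and the \<open>X k\<close> are exchanged for the \<open>Y k\<close> one at a
  time. As \<open>X k\<close> and \<open>Y k\<close> share their mean and covariance, the Taylor terms up to order two cancel in
  each exchange; the remainder is integrated against \<open>|\<zeta>\<^sub>k|\<close>. Where \<open>\<parallel>x\<parallel> \<ge> \<surd>n e / log(ep)\<close> its
  quadratic bound produces \<open>M\<^sub>n\<close>; elsewhere the exponential stability of the dominators gives a cubic
  bound with the third pseudo-moment (\<open>lindeberg_step\<close>, \<open>lindeberg_swap\<close>).

  The dominators do not vanish anywhere, but the third derivatives do vanish off the annulus
  between the two radii of the smoothed indicator. So the cubic term carries the
  probability that \<open>W k\<close>, the sum without its \<open>k\<close>-th summand, lies near the sphere of radius \<open>r\<close>.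
  Adding \<open>Y k / \<surd>n\<close> turns \<open>W k\<close> into \<open>U (k - 1)\<close>; hence this probability is at most that of
  \<open>\<parallel>U (k - 1)\<parallel> \<in> [r - 3e, r + 3e]\<close> plus that of a large \<open>\<parallel>Y k\<parallel>\<close> (\<open>W_annulus_le\<close>). The former is
  compared with the same event for \<open>U 0\<close>, at the price of the very supremum that is to be
  bounded, and anti-concentration controls \<open>U 0\<close>. The scale \<open>e\<close> is such that the weights of all cubic
  terms sum to \<open>1 / (12 * 4 powr m * exp C)\<close>. Hence the supremum \<open>\<delta>\<close> satisfies
  \<open>\<delta> \<le> max t (B + \<delta> / 6)\<close> with \<open>t\<close> the tail supremum, and \<open>\<delta>\<close> is finite when \<open>t\<close> is, so that
  \<open>\<delta> \<le> t + 6/5 B\<close> (\<open>self_improving_bound\<close>). The factor \<open>4 powr m\<close> pays for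
  replacing \<open>r\<close> by \<open>r - 3e\<close> when \<open>r \<ge> 4e\<close>; for \<open>r < 4e\<close> the weight \<open>r powr m\<close> is at most
  \<open>(4e) powr m\<close>, and the unweighted anti-concentration inequality suffices.

  The event that \<open>\<parallel>Y k\<parallel>\<close> is large has to be estimated by the median and the largest coordinate variance
  alone, whatever the dimension. This is Gaussian concentration, proved here in the way of Maurey and
  Pisier: two independent copies are rotated into each other in \<open>N\<close> small steps, and to first order one
  such step changes the norm by a single coordinate of a copy independent of the current position
  (\<open>symmetrized_mgf\<close>, \<open>concentration_above_median\<close>). Rotation invariance follows from the Cramer-Wold
  device, which is reduced to the one-dimensional uniqueness theorem for characteristic functions.\<close>


section \<open>Laws on a finite product are determined by their linear projections\<close>

lemma finite_measure_eqI_char: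
  fixes M1 M2 :: "real measure"
  assumes f1: "finite_measure M1" and f2: "finite_measure M2"
    and s1: "sets M1 = sets borel" and s2: "sets M2 = sets borel"
    and ch: "\<And>t. (CLINT x|M1. iexp (t * x)) = (CLINT x|M2. iexp (t * x))"
  shows "M1 = M2"
proof -
  interpret M1: finite_measure M1 by fact
  interpret M2: finite_measure M2 by fact
  define c where "c = measure M1 (space M1)"
  have sp: "space M1 = UNIV" "space M2 = UNIV"
    using sets_eq_imp_space_eq[OF s1] sets_eq_imp_space_eq[OF s2] by auto
  have c2: "c = measure M2 (space M2)"
    using ch[of 0] by (simp add: c_def flip: of_real_eq_iff)
  show ?thesis
  proof (cases "c = 0")
    case True
    have z1: "emeasure M1 (space M1) = 0" using True by (simp add: c_def M1.emeasure_eq_measure)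
    have z2: "emeasure M2 (space M2) = 0" using True c2 by (simp add: M2.emeasure_eq_measure)
    have "emeasure M1 A = emeasure M2 A" for A
      using emeasure_space[of M1 A] emeasure_space[of M2 A] unfolding z1 z2 by simp
    then show ?thesis using s1 s2 by (intro measure_eqI) auto
  next
    case False
    then have c: "c > 0" by (simp add: c_def less_le)
    define N1 where "N1 = density M1 (\<lambda>_. ennreal (1/c))"
    define N2 where "N2 = density M2 (\<lambda>_. ennreal (1/c))"
    have "prob_space N1"
      using c by (intro prob_spaceI) (simp add: N1_def emeasure_density_const c_def M1.emeasure_eq_measure
          flip: ennreal_mult)
    then have r1: "real_distribution N1"
      using s1 sp by (simp add: real_distribution_def real_distribution_axioms_def N1_def)
    have "prob_space N2"
      using c by (intro prob_spaceI) (simp add: N2_def emeasure_density_const c2 M2.emeasure_eq_measure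
          flip: ennreal_mult)
    then have r2: "real_distribution N2"
      using s2 sp by (simp add: real_distribution_def real_distribution_axioms_def N2_def)
    have meas: "(\<lambda>x. iexp (t * x)) \<in> borel_measurable M1" "(\<lambda>x. iexp (t * x)) \<in> borel_measurable M2" for t
      using s1 s2 by (simp_all cong: measurable_cong_sets)
    have "char N1 = char N2"
      using c meas ch unfolding char_def N1_def N2_def
      by (simp add: integral_density fun_eq_iff)
    then have N: "N1 = N2" by (rule Levy_uniqueness[OF r1 r2])
    show ?thesis
    proof (rule measure_eqI)
      show "sets M1 = sets M2" using s1 s2 by simp
      fix A assume A: "A \<in> sets M1"
      have "emeasure N1 A = emeasure N2 A" using N by simp
      then have "ennreal (measure M1 A / c) = ennreal (measure M2 A / c)"
        using A c s1 s2 by (simp add: N1_def N2_def emeasure_density_const M1.emeasure_eq_measure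
            M2.emeasure_eq_measure flip: ennreal_mult)
      then show "emeasure M1 A = emeasure M2 A"
        using c by (simp add: M1.emeasure_eq_measure M2.emeasure_eq_measure)
    qed
  qed
qed

text \<open>The factors \<open>iexp (a i * X i)\<close> are traded for indicators one coordinate at a time. Weighting
  the law of the coordinate \<open>j\<close> with the other factors gives a complex measure with known characteristic
  function; to stay with positive measures, the weight \<open>1 + cos (S + \<theta>)\<close> is used in place of \<open>iexp S\<close>, and the
  latter is recovered from the phases \<open>\<theta> = 0\<close>, \<open>\<pi>\<close>, \<open>- \<pi>/2\<close>.\<close>

lemma cramer_wold_indicators:
  fixes X :: "'i \<Rightarrow> 'a \<Rightarrow> real" and Y :: "'i \<Rightarrow> 'b \<Rightarrow> real"
  assumes A: "prob_space A" and B: "prob_space B" and I: "finite I"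
    and X: "\<And>i. i \<in> I \<Longrightarrow> X i \<in> borel_measurable A"
    and Y: "\<And>i. i \<in> I \<Longrightarrow> Y i \<in> borel_measurable B"
    and ch: "\<And>a. (CLINT x|A. iexp (\<Sum>i\<in>I. a i * X i x)) = (CLINT x|B. iexp (\<Sum>i\<in>I. a i * Y i x))"
    and J: "finite J" "J \<subseteq> I"
    and E: "\<And>i. i \<in> I \<Longrightarrow> E i \<in> sets borel"
  shows "(CLINT x|A. of_real (\<Prod>i\<in>J. indicator (E i) (X i x)) * iexp (\<Sum>i\<in>I-J. a i * X i x))
       = (CLINT x|B. of_real (\<Prod>i\<in>J. indicator (E i) (Y i x)) * iexp (\<Sum>i\<in>I-J. a i * Y i x))"
  using J
proof (induction J arbitrary: a rule: finite_induct)
  case empty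
  then show ?case using ch by simp
next
  case (insert j J)
  interpret A: prob_space A by fact
  interpret B: prob_space B by fact
  \<comment> \<open>\<open>gA\<close>, \<open>gB\<close> collect the indicators already in place, \<open>SA\<close>, \<open>SB\<close> the phases still to be treated.\<close>
  define K where "K = I - insert j J"
  have jK: "I - J = insert j K" "j \<notin> K" "finite K" "K \<subseteq> I" "j \<in> I" "J \<subseteq> I"
    using insert I by (auto simp: K_def)
  define gA where "gA x = (\<Prod>i\<in>J. indicator (E i) (X i x) :: real)" for x
  define gB where "gB x = (\<Prod>i\<in>J. indicator (E i) (Y i x) :: real)" for x
  define SA where "SA x = (\<Sum>i\<in>K. a i * X i x)" for x
  define SB where "SB x = (\<Sum>i\<in>K. a i * Y i x)" for x
  have [measurable]: "gA \<in> borel_measurable A" "SA \<in> borel_measurable A" "X j \<in> borel_measurable A"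
    using X E jK unfolding gA_def SA_def by (auto intro!: borel_measurable_prod borel_measurable_sum
       measurable_compose[OF X borel_measurable_indicator])
  have [measurable]: "gB \<in> borel_measurable B" "SB \<in> borel_measurable B" "Y j \<in> borel_measurable B"
    using Y E jK unfolding gB_def SB_def by (auto intro!: borel_measurable_prod borel_measurable_sum
       measurable_compose[OF Y borel_measurable_indicator])
  have [measurable]: "E j \<in> sets borel" using E jK by auto
  have g01: "0 \<le> gA x" "gA x \<le> 1" "0 \<le> gB y" "gB y \<le> 1" for x y
    unfolding gA_def gB_def by (auto intro!: prod_nonneg prod_le_1)
  have absg: "\<bar>gA x\<bar> \<le> 1" "\<bar>gB y\<bar> \<le> 1" for x y
    using g01(1,2)[of x] g01(3,4)[of y] by auto
  have IH: "(CLINT x|A. of_real (gA x) * iexp (t * X j x + u * SA x))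
      = (CLINT x|B. of_real (gB x) * iexp (t * Y j x + u * SB x))" for t u
  proof -
    have *: "(\<Sum>i\<in>I-J. (if i = j then t else u * a i) * Z i x) = t * Z j x + u * (\<Sum>i\<in>K. a i * Z i x)"
      for Z :: "'i \<Rightarrow> 'c \<Rightarrow> real" and x
    proof -
      have "(\<Sum>i\<in>K. (if i = j then t else u * a i) * Z i x) = (\<Sum>i\<in>K. u * (a i * Z i x))"
        using jK by (intro sum.cong) auto
      then show ?thesis using jK by (simp add: sum_distrib_left)
    qed
    show ?thesis
      using insert.IH[OF jK(6), of "\<lambda>i. if i = j then t else u * a i"]
      by (simp only: * gA_def gB_def SA_def SB_def)
  qed
  have iA: "integrable A (\<lambda>x. of_real (gA x) * iexp (t * X j x + u * SA x))" for t u
    by (rule A.integrable_const_bound[where B=1]) (auto simp: norm_mult absg)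
  have iB: "integrable B (\<lambda>x. of_real (gB x) * iexp (t * Y j x + u * SB x))" for t u
    by (rule B.integrable_const_bound[where B=1]) (auto simp: norm_mult absg)
  define cA where "cA \<theta> x = gA x * (1 + cos (SA x + \<theta>))" for \<theta> x
  define cB where "cB \<theta> x = gB x * (1 + cos (SB x + \<theta>))" for \<theta> x
  have [measurable]: "cA \<theta> \<in> borel_measurable A" "cB \<theta> \<in> borel_measurable B" for \<theta>
    unfolding cA_def cB_def by measurable
  have cos1: "0 \<le> 1 + cos x" for x :: real using cos_ge_minus_one[of x] by linarith
  have c0: "0 \<le> cA \<theta> x" "0 \<le> cB \<theta> y" for \<theta> x y
    using g01 cos1 by (auto simp: cA_def cB_def)
  have cos2: "\<bar>1 + cos x\<bar> \<le> 2" for x :: real using cos_le_one[of x] cos1[of x] by linarith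
  have c2: "\<bar>cA \<theta> x\<bar> \<le> 2" "\<bar>cB \<theta> y\<bar> \<le> 2" for \<theta> x y
    unfolding cA_def cB_def abs_mult using mult_mono[OF absg(1) cos2] mult_mono[OF absg(2) cos2] by auto
  have intcA: "integrable A (\<lambda>x. f x * cA \<theta> x)" if [measurable]: "f \<in> borel_measurable A" and "\<And>x. \<bar>f x\<bar> \<le> 1" for f \<theta>
    using mult_mono[OF that(2) c2(1)]
    by (intro A.integrable_const_bound[where B=2]) (auto simp: abs_mult)
  have intcB: "integrable B (\<lambda>x. f x * cB \<theta> x)" if [measurable]: "f \<in> borel_measurable B" and "\<And>x. \<bar>f x\<bar> \<le> 1" for f \<theta>
    using mult_mono[OF that(2) c2(2)]
    by (intro B.integrable_const_bound[where B=2]) (auto simp: abs_mult)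
  have weighted: "(LINT x|A. indicator (E j) (X j x) * cA \<theta> x) = (LINT x|B. indicator (E j) (Y j x) * cB \<theta> x)" for \<theta>
  proof -
    define mA where "mA = distr (density A (\<lambda>x. ennreal (cA \<theta> x))) borel (X j)"
    define mB where "mB = distr (density B (\<lambda>x. ennreal (cB \<theta> x))) borel (Y j)"
    have split: "of_real (g * (1 + cos (S + \<theta>))) * iexp z =
        of_real g * iexp (z + 0 * S) + (iexp \<theta> / 2) * (of_real g * iexp (z + 1 * S))
          + (iexp (-\<theta>) / 2) * (of_real g * iexp (z + (-1) * S))" for g S z
    proof -
      have "iexp (S + \<theta>) = iexp S * iexp \<theta>" "iexp (- (S + \<theta>)) = iexp (- S) * iexp (- \<theta>)"
        by (subst exp_add[symmetric], simp add: algebra_simps)+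
      then have "complex_of_real (cos (S + \<theta>)) = (iexp S * iexp \<theta> + iexp (-S) * iexp (-\<theta>)) / 2"
        using cos_exp_eq[of "of_real (S + \<theta>)"]
        by (simp only: cos_of_real of_real_minus mult_minus_right mult_minus_left)
      moreover have "iexp (z + 0 * S) = iexp z" "iexp (z + 1 * S) = iexp z * iexp S"
          "iexp (z + (-1) * S) = iexp z * iexp (- S)"
        by (auto simp: distrib_left exp_add exp_diff exp_minus right_diff_distrib field_simps)
      ultimately show ?thesis
        by (simp only: of_real_mult of_real_add of_real_1) (simp add: ring_distribs add_divide_distrib ac_simps)
    qed
    have "mA = mB"
    proof (rule finite_measure_eqI_char)
      have "(\<integral>\<^sup>+x. ennreal (cA \<theta> x) \<partial>A) < \<infinity>"
        using intcA[of "\<lambda>_. 1" \<theta>] c0 by (simp add: nn_integral_eq_integral)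
      then show "finite_measure mA" unfolding mA_def
        by (intro finite_measure.finite_measure_distr finite_measureI) (auto simp: emeasure_density cong: nn_integral_cong)
      have "(\<integral>\<^sup>+x. ennreal (cB \<theta> x) \<partial>B) < \<infinity>"
        using intcB[of "\<lambda>_. 1" \<theta>] c0 by (simp add: nn_integral_eq_integral)
      then show "finite_measure mB" unfolding mB_def
        by (intro finite_measure.finite_measure_distr finite_measureI) (auto simp: emeasure_density cong: nn_integral_cong)
      fix t :: real
      have "(CLINT x|mA. iexp (t * x)) = (CLINT x|A. of_real (cA \<theta> x) * iexp (t * X j x))"
        unfolding mA_def using c0 by (subst integral_distr, measurable) (subst integral_density, auto simp: scaleR_conv_of_real)
      also have "\<dots> = (CLINT x|B. of_real (cB \<theta> x) * iexp (t * Y j x))"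
        unfolding cA_def cB_def split
        by (subst (1 2) Bochner_Integration.integral_add, (intro iA iB Bochner_Integration.integrable_add integrable_mult_right)+)+
           (simp only: integral_mult_right_zero IH)
      also have "\<dots> = (CLINT x|mB. iexp (t * x))"
        unfolding mB_def using c0 by (subst integral_distr, measurable) (subst integral_density, auto simp: scaleR_conv_of_real)
      finally show "(CLINT x|mA. iexp (t * x)) = (CLINT x|mB. iexp (t * x))" .
    qed (simp_all add: mA_def mB_def)
    have "(LINT x|A. indicator (E j) (X j x) * cA \<theta> x) = (LINT x|mA. indicator (E j) x)"
      unfolding mA_def using c0
      by (subst integral_distr, measurable) (subst integral_density, auto simp: mult.commute)
    also have "\<dots> = (LINT x|mB. indicator (E j) x)" using \<open>mA = mB\<close> by simp
    also have "\<dots> = (LINT x|B. indicator (E j) (Y j x) * cB \<theta> x)"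
      unfolding mB_def using c0
      by (subst integral_distr, measurable) (subst integral_density, auto simp: mult.commute)
    finally show ?thesis .
  qed
  define hA where "hA x = indicator (E j) (X j x) * gA x" for x
  define hB where "hB x = indicator (E j) (Y j x) * gB x" for x
  have [measurable]: "hA \<in> borel_measurable A" "hB \<in> borel_measurable B"
    unfolding hA_def hB_def by measurable
  have absh: "\<bar>hA x\<bar> \<le> 1" "\<bar>hB y\<bar> \<le> 1" for x y
    using absg by (auto simp: hA_def hB_def abs_mult indicator_def)
  have bA: "integrable A (\<lambda>x. hA x * f x)" if [measurable]: "f \<in> borel_measurable A" and "\<And>x. \<bar>f x\<bar> \<le> 1" for f
    using mult_mono[OF absh(1) that(2)] by (intro A.integrable_const_bound[where B=1]) (auto simp: abs_mult)
  have bB: "integrable B (\<lambda>x. hB x * f x)" if [measurable]: "f \<in> borel_measurable B" and "\<And>x. \<bar>f x\<bar> \<le> 1" for f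
    using mult_mono[OF absh(2) that(2)] by (intro B.integrable_const_bound[where B=1]) (auto simp: abs_mult)
  have hA1: "integrable A hA" and hB1: "integrable B hB"
    using bA[of "\<lambda>_. 1"] bB[of "\<lambda>_. 1"] by auto
  have w2: "(LINT x|A. hA x) + (LINT x|A. hA x * cos (SA x + \<theta>)) = (LINT x|B. hB x) + (LINT x|B. hB x * cos (SB x + \<theta>))" for \<theta>
  proof -
    have "(LINT x|A. hA x) + (LINT x|A. hA x * cos (SA x + \<theta>)) = (LINT x|A. indicator (E j) (X j x) * cA \<theta> x)"
      by (subst Bochner_Integration.integral_add[symmetric], fact, intro bA)
        (auto simp: cA_def hA_def algebra_simps)
    also have "\<dots> = (LINT x|B. hB x) + (LINT x|B. hB x * cos (SB x + \<theta>))"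
      unfolding weighted by (subst Bochner_Integration.integral_add[symmetric], fact, intro bB)
        (auto simp: cB_def hB_def algebra_simps)
    finally show ?thesis .
  qed
  \<comment> \<open>The phases \<open>0\<close> and \<open>\<pi>\<close> have opposite cosines, so their sum isolates the integral of \<open>hA\<close>.\<close>
  have e0: "(LINT x|A. hA x) = (LINT x|B. hB x)"
    using w2[of 0] w2[of pi] by (simp add: cos_add)
  have ec: "(LINT x|A. hA x * cos (SA x)) = (LINT x|B. hB x * cos (SB x))"
    using w2[of 0] e0 by simp
  have es: "(LINT x|A. hA x * sin (SA x)) = (LINT x|B. hB x * sin (SB x))"
    using w2[of "- pi/2"] e0 by (simp add: cos_diff)
  have eq: "of_real h * iexp S = complex_of_real (h * cos S) + \<i> * complex_of_real (h * sin S)" for h S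
    by (simp add: exp_Euler flip: cos_of_real sin_of_real) (simp add: algebra_simps cos_of_real sin_of_real)
  have "(CLINT x|A. of_real (hA x) * iexp (SA x)) = (CLINT x|B. of_real (hB x) * iexp (SB x))"
    unfolding eq
    by (subst (1 2) Bochner_Integration.integral_add)
      (auto intro!: bA bB integrable_mult_right integrable_of_real simp del: of_real_mult simp: ec es)
  moreover have "(\<Prod>i\<in>insert j J. indicator (E i) (X i x)) = hA x" "(\<Prod>i\<in>insert j J. indicator (E i) (Y i y)) = hB y" for x y
    using insert by (auto simp: hA_def hB_def gA_def gB_def)
  ultimately show ?case
    unfolding K_def[symmetric] SA_def SB_def by (simp only:)
qed

lemma cramer_wold:
  fixes X :: "'i \<Rightarrow> 'a \<Rightarrow> real" and Y :: "'i \<Rightarrow> 'b \<Rightarrow> real"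
  assumes A: "prob_space A" and B: "prob_space B" and I: "finite I"
    and X: "\<And>i. i \<in> I \<Longrightarrow> X i \<in> borel_measurable A"
    and Y: "\<And>i. i \<in> I \<Longrightarrow> Y i \<in> borel_measurable B"
    and proj: "\<And>a. distr A borel (\<lambda>x. \<Sum>i\<in>I. a i * X i x) = distr B borel (\<lambda>x. \<Sum>i\<in>I. a i * Y i x)"
  shows "distr A (PiM I (\<lambda>_. borel)) (\<lambda>x. \<lambda>i\<in>I. X i x) = distr B (PiM I (\<lambda>_. borel)) (\<lambda>x. \<lambda>i\<in>I. Y i x)"
    (is "?P = ?Q")
proof -
  interpret A: prob_space A by fact
  interpret B: prob_space B by fact
  have mX[measurable]: "(\<lambda>x. \<lambda>i\<in>I. X i x) \<in> measurable A (PiM I (\<lambda>_. borel))"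
    and mY[measurable]: "(\<lambda>x. \<lambda>i\<in>I. Y i x) \<in> measurable B (PiM I (\<lambda>_. borel))"
    using X Y by (auto intro!: measurable_restrict)
  have ch: "(CLINT x|A. iexp (\<Sum>i\<in>I. a i * X i x)) = (CLINT x|B. iexp (\<Sum>i\<in>I. a i * Y i x))" for a
  proof -
    have "(CLINT x|distr A borel (\<lambda>x. \<Sum>i\<in>I. a i * X i x). iexp x)
        = (CLINT x|distr B borel (\<lambda>x. \<Sum>i\<in>I. a i * Y i x). iexp x)"
      unfolding proj ..
    then show ?thesis using X Y by (subst (asm) (1 2) integral_distr) auto
  qed
  show ?thesis
  proof (rule measure_eqI_PiM_finite[OF I, where A="\<lambda>_. space (PiM I (\<lambda>_. borel))"])
    fix E :: "'i \<Rightarrow> real set" assume E: "\<And>i. i \<in> I \<Longrightarrow> E i \<in> sets borel"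
    have "(CLINT x|A. of_real (\<Prod>i\<in>I. indicator (E i) (X i x)))
        = (CLINT x|B. of_real (\<Prod>i\<in>I. indicator (E i) (Y i x)))"
      using cramer_wold_indicators[OF A B I X Y ch I order_refl E] by simp
    then have *: "(LINT x|A. (\<Prod>i\<in>I. indicator (E i) (X i x) :: real)) = (LINT x|B. (\<Prod>i\<in>I. indicator (E i) (Y i x)))"
      by (simp only: integral_complex_of_real of_real_eq_iff)
    have ind: "(\<Prod>i\<in>I. indicator (E i) (z i)) = (indicator (Pi\<^sub>E I E) (\<lambda>i\<in>I. z i) :: real)" for z
      using I by (auto simp: indicator_def PiE_iff prod_zero_iff)
    have PE[measurable]: "Pi\<^sub>E I E \<in> sets (PiM I (\<lambda>_. borel))"
      using I E by (intro sets_PiM_I_finite) auto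
    have "(LINT x|A. indicator (Pi\<^sub>E I E) (\<lambda>i\<in>I. X i x) :: real) = measure ?P (Pi\<^sub>E I E)"
      by (subst integral_distr[OF mX, symmetric]) (use PE in \<open>simp_all add: sets.sets_into_space Int_absorb2\<close>)
    moreover have "(LINT x|B. indicator (Pi\<^sub>E I E) (\<lambda>i\<in>I. Y i x) :: real) = measure ?Q (Pi\<^sub>E I E)"
      by (subst integral_distr[OF mY, symmetric]) (use PE in \<open>simp_all add: sets.sets_into_space Int_absorb2\<close>)
    ultimately have "measure ?P (Pi\<^sub>E I E) = measure ?Q (Pi\<^sub>E I E)"
      using * unfolding ind by simp
    moreover have "finite_measure ?P" "finite_measure ?Q"
      using A.finite_measure_distr[OF mX] B.finite_measure_distr[OF mY] by auto
    ultimately show "emeasure ?P (Pi\<^sub>E I E) = emeasure ?Q (Pi\<^sub>E I E)"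
      by (simp add: finite_measure.emeasure_eq_measure)
  next
    show "range (\<lambda>_. space (PiM I (\<lambda>_. borel))) \<subseteq> prod_algebra I (\<lambda>_. borel)"
      using I by (auto simp: prod_algebra_eq_finite space_PiM intro!: exI[of _ "\<lambda>_. UNIV"])
    show "(\<Union>i::nat. space (PiM I (\<lambda>_. borel))) = space (PiM I (\<lambda>_. borel))" by simp
    show "emeasure ?P (space (Pi\<^sub>M I (\<lambda>_. borel))) \<noteq> \<infinity>" for i
      using A.finite_measure_distr[OF mX] by (simp add: finite_measure.emeasure_eq_measure)
  qed simp_all
qed


section \<open>Differentiation along lines, and the maximum norm\<close>

lemma Rvec_space_iff: "x \<in> space (Rvec p) \<longleftrightarrow> (\<forall>i\<ge>p. x i = undefined)"
  by (auto simp: space_PiM PiE_def extensional_def)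

definition add_scaled :: "nat \<Rightarrow> (nat \<Rightarrow> real) \<Rightarrow> real \<Rightarrow> (nat \<Rightarrow> real) \<Rightarrow> (nat \<Rightarrow> real)" where
  "add_scaled p x t v = (\<lambda>i\<in>{..<p}. x i + t * v i)"

lemma add_scaled_in_space [simp]: "add_scaled p x t v \<in> space (Rvec p)"
  by (auto simp: Rvec_space_iff add_scaled_def)

lemma add_scaled_0: "x \<in> space (Rvec p) \<Longrightarrow> add_scaled p x 0 v = x"
  by (auto simp: Rvec_space_iff add_scaled_def fun_eq_iff restrict_def)

text \<open>Only partial derivatives along coordinates are given. Their continuity yields the chain rule
  on lines: the increment is telescoped over the coordinates, and the mean value theorem
  is applied to each of them.\<close>

lemma has_real_derivative_along_line:
  assumes part: "\<And>j. j < p \<Longrightarrow> has_partial p j f (g j)"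
    and cont: "\<And>j. j < p \<Longrightarrow> continuous_on (space (Rvec p)) (g j)"
  shows "((\<lambda>t. f (add_scaled p w t v)) has_real_derivative (\<Sum>j<p. v j * g j (add_scaled p w t v))) (at t)"
proof -
  define x where "x = add_scaled p w t v"
  define z where "z k h = (\<lambda>i\<in>{..<p}. x i + (if i < k then h * v i else 0))" for k h
  have x: "x \<in> space (Rvec p)" by (simp add: x_def)
  have z: "z k h \<in> space (Rvec p)" for k h by (auto simp: z_def Rvec_space_iff)
  have z0: "z 0 h = x" for h using x by (auto simp: z_def Rvec_space_iff fun_eq_iff)
  have zp: "z p h = add_scaled p w (t + h) v" for h
    by (auto simp: z_def fun_eq_iff add_scaled_def x_def algebra_simps)
  have step: "((\<lambda>h. (f (z (Suc k) h) - f (z k h)) / h) \<longlongrightarrow> v k * g k x) (at 0)" if k: "k < p" for k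
  proof -
    have upd: "(z k h)(k := a) \<in> space (Rvec p)" for h a
      using z[of k h] k by (auto simp: Rvec_space_iff)
    have "\<exists>s. 0 < s \<and> s < 1 \<and> f (z (Suc k) h) - f (z k h) = (h * v k) * g k ((z k h)(k := x k + s * (h * v k)))" for h
    proof -
      have d: "((\<lambda>s. f ((z k h)(k := x k + s * (h * v k)))) has_real_derivative
          g k ((z k h)(k := x k + s * (h * v k))) * (h * v k)) (at s)" for s
      proof -
        have "((\<lambda>u. f ((z k h)(k := u))) has_real_derivative g k ((z k h)(k := x k + s * (h * v k)))) (at (x k + s * (h * v k)))"
          using part[OF k] upd[of h "x k + s * (h * v k)"] unfolding has_partial_def by force
        moreover have "((\<lambda>s. x k + s * (h * v k)) has_real_derivative h * v k) (at s)"
          by (auto intro!: derivative_eq_intros)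
        ultimately show ?thesis by (rule DERIV_chain2)
      qed
      obtain s where s: "0 < s" "s < 1" "f ((z k h)(k := x k + 1 * (h * v k))) - f ((z k h)(k := x k + 0 * (h * v k)))
          = (1 - 0) * (g k ((z k h)(k := x k + s * (h * v k))) * (h * v k))"
        using MVT2[of 0 1, OF _ d] by auto
      have "(z k h)(k := x k + 1 * (h * v k)) = z (Suc k) h" "(z k h)(k := x k + 0 * (h * v k)) = z k h"
        using k by (auto simp: z_def fun_eq_iff)
      then show ?thesis using s by (auto simp: mult_ac)
    qed
    then obtain s where s: "\<And>h. 0 < s h" "\<And>h. s h < 1"
      "\<And>h. f (z (Suc k) h) - f (z k h) = (h * v k) * g k ((z k h)(k := x k + s h * (h * v k)))" by metis
    \<comment> \<open>The intermediate point depends on \<open>h\<close> without any regularity. It is an instance of a continuous function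
      of two real variables, evaluated where both tend to \<open>0\<close>.\<close>
    define G where "G q = (z k (fst q))(k := x k + snd q)" for q :: "real \<times> real"
    have "continuous_on UNIV (\<lambda>q. G q i)" for i
      unfolding G_def z_def by (cases "i = k"; cases "i < k"; cases "i < p"; auto intro!: continuous_intros)
    then have "continuous_on UNIV G" by (rule continuous_on_coordinatewise_then_product)
    then have cG: "continuous_on UNIV (\<lambda>q. g k (G q))"
      by (rule continuous_on_compose2[OF cont[OF k]]) (auto simp: G_def upd)
    have "((\<lambda>h. s h * (h * v k)) \<longlongrightarrow> 0) (at 0)"
    proof (rule tendsto_0_le[where K=1])
      show "((\<lambda>h. h * v k) \<longlongrightarrow> 0) (at 0)" by (auto intro!: tendsto_eq_intros)
      show "\<forall>\<^sub>F h in at 0. norm (s h * (h * v k)) \<le> norm (h * v k) * 1"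
        using s(1,2) by (intro always_eventually allI) (simp add: abs_mult mult_left_le_one_le less_imp_le)
    qed
    then have "((\<lambda>h. (h, s h * (h * v k))) \<longlongrightarrow> (0, 0)) (at 0)"
      by (intro tendsto_Pair tendsto_ident_at)
    then have "((\<lambda>h. g k (G (h, s h * (h * v k)))) \<longlongrightarrow> g k (G (0, 0))) (at 0)"
      using continuous_on_tendsto_compose[OF cG] by simp
    moreover have "G (0, 0) = x"
      using x k by (auto simp: G_def z_def fun_eq_iff Rvec_space_iff)
    ultimately have "((\<lambda>h. v k * g k (G (h, s h * (h * v k)))) \<longlongrightarrow> v k * g k x) (at 0)"
      by (intro tendsto_mult tendsto_const) simp
    moreover have "\<forall>\<^sub>F h in at 0. v k * g k (G (h, s h * (h * v k))) = (f (z (Suc k) h) - f (z k h)) / h"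
      using eventually_neq_at_within[of 0] by eventually_elim (auto simp: s(3) G_def)
    ultimately show ?thesis by (rule Lim_transform_eventually)
  qed
  have "((\<lambda>h. \<Sum>k<p. (f (z (Suc k) h) - f (z k h)) / h) \<longlongrightarrow> (\<Sum>k<p. v k * g k x)) (at 0)"
    using step by (intro tendsto_sum) auto
  moreover have "(\<Sum>k<p. (f (z (Suc k) h) - f (z k h)) / h) = (f (add_scaled p w (t + h) v) - f (add_scaled p w t v)) / h" for h
    unfolding sum_divide_distrib[symmetric] sum_lessThan_telescope[of "\<lambda>k. f (z k h)"]
    by (simp add: z0 zp x_def)
  ultimately show ?thesis
    unfolding DERIV_def x_def by simp
qed

locale C3_function =
  fixes p :: nat and f f1 f2 f3
  assumes C3: "C3_with_partials p f f1 f2 f3"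
begin

lemma
  shows cont: "continuous_on (space (Rvec p)) f"
    and cont1: "j < p \<Longrightarrow> continuous_on (space (Rvec p)) (f1 j)"
    and cont2: "j < p \<Longrightarrow> k < p \<Longrightarrow> continuous_on (space (Rvec p)) (f2 j k)"
    and cont3: "j < p \<Longrightarrow> k < p \<Longrightarrow> l < p \<Longrightarrow> continuous_on (space (Rvec p)) (f3 j k l)"
    and part1: "j < p \<Longrightarrow> has_partial p j f (f1 j)"
    and part2: "j < p \<Longrightarrow> k < p \<Longrightarrow> has_partial p k (f1 j) (f2 j k)"
    and part3: "j < p \<Longrightarrow> k < p \<Longrightarrow> l < p \<Longrightarrow> has_partial p l (f2 j k) (f3 j k l)"
  using C3 unfolding C3_with_partials_def by auto

definition dir_deriv1 where "dir_deriv1 x v = (\<Sum>j<p. v j * f1 j x)"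
definition dir_deriv2 where "dir_deriv2 x v = (\<Sum>j<p. \<Sum>k<p. v j * v k * f2 j k x)"
definition dir_deriv3 where "dir_deriv3 x v = (\<Sum>j<p. \<Sum>k<p. \<Sum>l<p. v j * v k * v l * f3 j k l x)"

lemma deriv1: "((\<lambda>t. f (add_scaled p w t v)) has_real_derivative dir_deriv1 (add_scaled p w t v) v) (at t)"
  unfolding dir_deriv1_def by (rule has_real_derivative_along_line) (auto intro: part1 cont1)

lemma deriv2: "((\<lambda>t. dir_deriv1 (add_scaled p w t v) v) has_real_derivative dir_deriv2 (add_scaled p w t v) v) (at t)"
proof -
  have "((\<lambda>t. v j * f1 j (add_scaled p w t v)) has_real_derivative v j * (\<Sum>k<p. v k * f2 j k (add_scaled p w t v))) (at t)"
    if "j < p" for j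
    by (intro DERIV_cmult has_real_derivative_along_line part2 cont2 that)
  then show ?thesis
    unfolding dir_deriv1_def dir_deriv2_def by (auto intro!: DERIV_sum simp: sum_distrib_left mult.assoc)
qed

lemma deriv3: "((\<lambda>t. dir_deriv2 (add_scaled p w t v) v) has_real_derivative dir_deriv3 (add_scaled p w t v) v) (at t)"
proof -
  have "((\<lambda>t. (v j * v k) * f2 j k (add_scaled p w t v)) has_real_derivative (v j * v k) * (\<Sum>l<p. v l * f3 j k l (add_scaled p w t v))) (at t)"
    if "j < p" "k < p" for j k
    by (intro DERIV_cmult has_real_derivative_along_line part3 cont3 that)
  then show ?thesis
    unfolding dir_deriv2_def dir_deriv3_def by (auto intro!: DERIV_sum simp: sum_distrib_left mult.assoc)
qed

text \<open>The remainder is a second derivative at an intermediate point, which the dominators bound directly.\<close>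

lemma taylor2:
  assumes w: "w \<in> space (Rvec p)"
  obtains t where "0 < t" "t < 1" "f (add_scaled p w 1 v) = f w + dir_deriv1 w v + dir_deriv2 (add_scaled p w t v) v / 2"
proof -
  define D where "D m t = (if m = 0 then f (add_scaled p w t v) else if m = 1 then dir_deriv1 (add_scaled p w t v) v else dir_deriv2 (add_scaled p w t v) v)" for m :: nat and t
  have "\<exists>t::real. 0 < t \<and> t < 1 \<and> f (add_scaled p w 1 v) = sum (\<lambda>m. (D m 0 / fact m) * 1 ^ m) {..<2} + (D 2 t / fact 2) * 1 ^ 2"
    by (rule Maclaurin) (auto simp: D_def deriv1 deriv2 less_2_cases_iff)
  then show ?thesis using that by (auto simp: D_def numeral_2_eq_2 add_scaled_0[OF w])
qed

lemma taylor3: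
  assumes w: "w \<in> space (Rvec p)"
  obtains t where "0 < t" "t < 1" "f (add_scaled p w 1 v) = f w + dir_deriv1 w v + dir_deriv2 w v / 2 + dir_deriv3 (add_scaled p w t v) v / 6"
proof -
  define D where "D m t = (if m = 0 then f (add_scaled p w t v) else if m = 1 then dir_deriv1 (add_scaled p w t v) v
     else if m = 2 then dir_deriv2 (add_scaled p w t v) v else dir_deriv3 (add_scaled p w t v) v)" for m :: nat and t
  have lt3: "m < 3 \<longleftrightarrow> m = 0 \<or> m = 1 \<or> m = 2" for m :: nat by auto
  have "\<exists>t::real. 0 < t \<and> t < 1 \<and> f (add_scaled p w 1 v) = sum (\<lambda>m. (D m 0 / fact m) * 1 ^ m) {..<3} + (D 3 t / fact 3) * 1 ^ 3"
    by (rule Maclaurin) (auto simp: D_def deriv1 deriv2 deriv3 lt3)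
  then show ?thesis using that by (auto simp: D_def numeral_3_eq_3 numeral_2_eq_2 add_scaled_0[OF w])
qed

end

lemma continuous_on_Rvec_measurable:
  fixes f :: "(nat \<Rightarrow> real) \<Rightarrow> real"
  assumes "continuous_on (space (Rvec p)) f"
  shows "f \<in> borel_measurable (Rvec p)"
proof -
  define R where "R x = (\<lambda>i\<in>{..<p}. x i)" for x :: "nat \<Rightarrow> real"
  have "continuous_on UNIV (\<lambda>x. R x i)" for i
    unfolding R_def by (cases "i < p") (auto intro!: continuous_intros continuous_on_product_coordinates)
  then have "continuous_on UNIV R" by (rule continuous_on_coordinatewise_then_product)
  then have "continuous_on UNIV (\<lambda>x. f (R x))"
    by (rule continuous_on_compose2[OF assms]) (auto simp: R_def Rvec_space_iff)
  then have 1: "(\<lambda>x. f (R x)) \<in> borel_measurable borel" by (rule borel_measurable_continuous_onI)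
  have id: "(\<lambda>x. x) \<in> measurable (Rvec p) (borel :: (nat \<Rightarrow> real) measure)"
  proof (rule measurable_coordinatewise_then_product)
    fix i
    show "(\<lambda>x. x i) \<in> borel_measurable (Rvec p)"
    proof (cases "i < p")
      case False
      then have "x \<in> space (Rvec p) \<Longrightarrow> x i = undefined" for x
        by (auto simp: Rvec_space_iff)
      then show ?thesis by (subst measurable_cong[where g="\<lambda>_. undefined"]) auto
    qed auto
  qed
  have "(\<lambda>x. f (R x)) \<in> borel_measurable (Rvec p)"
    using measurable_compose[OF id 1] by simp
  moreover have "x \<in> space (Rvec p) \<Longrightarrow> R x = x" for x
    by (auto simp: R_def Rvec_space_iff fun_eq_iff)
  ultimately show ?thesis by (subst measurable_cong[where g="\<lambda>x. f (R x)"]) auto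
qed

lemma partial_vanishes_where_constant:
  assumes part: "has_partial p j f g" and j: "j < p"
    and S: "\<And>x. x \<in> S \<Longrightarrow> x \<in> space (Rvec p)"
    and op: "\<And>x. x \<in> S \<Longrightarrow> \<forall>\<^sub>F t in nhds (x j). x(j := t) \<in> S"
    and const: "\<And>x. x \<in> S \<Longrightarrow> f x = c" and x: "x \<in> S"
  shows "g x = 0"
proof -
  have "((\<lambda>t. f (x(j := t))) has_real_derivative g x) (at (x j))"
    using part S[OF x] by (auto simp: has_partial_def)
  moreover have "((\<lambda>t. f (x(j := t))) has_real_derivative 0) (at (x j))"
  proof (rule DERIV_cong_ev[THEN iffD2, OF refl _ refl])
    show "\<forall>\<^sub>F t in nhds (x j). f (x(j := t)) = c"
      using op[OF x] by eventually_elim (rule const)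
  qed auto
  ultimately show ?thesis by (rule DERIV_unique)
qed

lemma linfnorm_le_iff: "1 \<le> p \<Longrightarrow> linfnorm p x \<le> r \<longleftrightarrow> (\<forall>j<p. \<bar>x j\<bar> \<le> r)"
  and linfnorm_less_iff: "1 \<le> p \<Longrightarrow> linfnorm p x < r \<longleftrightarrow> (\<forall>j<p. \<bar>x j\<bar> < r)"
  by (auto simp: linfnorm_def lessThan_empty_iff)

lemma linfnorm_ge: "j < p \<Longrightarrow> \<bar>x j\<bar> \<le> linfnorm p x"
  by (auto simp: linfnorm_def)

lemma linfnorm_nonneg: "1 \<le> p \<Longrightarrow> 0 \<le> linfnorm p x"
  using linfnorm_ge[of 0 p x] by linarith

lemma linfnorm_attained: "1 \<le> p \<Longrightarrow> \<exists>j<p. linfnorm p x = \<bar>x j\<bar>"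
  using Max_in[of "(\<lambda>j. \<bar>x j\<bar>) ` {..<p}"] unfolding linfnorm_def
  by (metis (no_types, lifting) finite_imageI finite_lessThan image_iff image_is_empty lessThan_empty_iff
      lessThan_iff not_one_le_zero)

lemma linfnorm_triangle:
  assumes p: "1 \<le> p" and z: "\<And>j. j < p \<Longrightarrow> z j = x j + y j"
  shows "linfnorm p z \<le> linfnorm p x + linfnorm p y"
  unfolding linfnorm_le_iff[OF p]
proof safe
  fix j assume "j < p"
  then show "\<bar>z j\<bar> \<le> linfnorm p x + linfnorm p y"
    using z[of j] linfnorm_ge[of j p x] linfnorm_ge[of j p y] by linarith
qed

lemma linfnorm_scale: "1 \<le> p \<Longrightarrow> linfnorm p (\<lambda>i\<in>{..<p}. t * x i) = \<bar>t\<bar> * linfnorm p x"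
proof (rule antisym)
  assume p: "1 \<le> p"
  show "linfnorm p (\<lambda>i\<in>{..<p}. t * x i) \<le> \<bar>t\<bar> * linfnorm p x"
    unfolding linfnorm_le_iff[OF p] by (auto simp: abs_mult intro!: mult_left_mono linfnorm_ge)
  obtain j where j: "j < p" "linfnorm p x = \<bar>x j\<bar>" using linfnorm_attained[OF p] by blast
  then show "\<bar>t\<bar> * linfnorm p x \<le> linfnorm p (\<lambda>i\<in>{..<p}. t * x i)"
    using linfnorm_ge[of j p "\<lambda>i\<in>{..<p}. t * x i"] by (simp add: abs_mult)
qed

lemma linfnorm_measurable [measurable]:
  assumes "1 \<le> p" shows "linfnorm p \<in> borel_measurable (Rvec p)"
proof -
  have "(\<lambda>x. Max ((\<lambda>j. \<bar>x j\<bar>) ` {..<p})) \<in> borel_measurable (Rvec p)"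
    using assms by (intro borel_measurable_Max) (auto simp: lessThan_empty_iff)
  then show ?thesis by (simp add: linfnorm_def[abs_def])
qed

lemma eventually_linfnorm_less:
  assumes p: "1 \<le> p" and j: "j < p" and x: "linfnorm p x < r"
  shows "\<forall>\<^sub>F t in nhds (x j). linfnorm p (x(j := t)) < r"
proof -
  have "\<bar>x j\<bar> < r" using x j by (auto simp: linfnorm_less_iff[OF p])
  moreover have "((\<lambda>t. \<bar>t\<bar>) \<longlongrightarrow> \<bar>x j\<bar>) (nhds (x j))" by (auto intro!: tendsto_intros filterlim_ident)
  ultimately have "\<forall>\<^sub>F t in nhds (x j). \<bar>t\<bar> < r" by (simp add: order_tendsto_iff)
  then show ?thesis
    by eventually_elim (use x in \<open>auto simp: linfnorm_less_iff[OF p]\<close>)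
qed

lemma eventually_linfnorm_greater:
  assumes p: "1 \<le> p" and j: "j < p" and x: "r < linfnorm p x"
  shows "\<forall>\<^sub>F t in nhds (x j). r < linfnorm p (x(j := t))"
proof -
  obtain k where k: "k < p" "linfnorm p x = \<bar>x k\<bar>" using linfnorm_attained[OF p] by blast
  show ?thesis
  proof (cases "k = j")
    case True
    have "((\<lambda>t. \<bar>t\<bar>) \<longlongrightarrow> \<bar>x j\<bar>) (nhds (x j))" by (auto intro!: tendsto_intros filterlim_ident)
    then have "\<forall>\<^sub>F t in nhds (x j). r < \<bar>t\<bar>" using x k True by (simp add: order_tendsto_iff)
    then show ?thesis
    proof eventually_elim
      case (elim t)
      then show ?case using linfnorm_ge[OF j, of "x(j := t)"] by simp
    qed
  next
    case False
    then have "r < linfnorm p (x(j := t))" for t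
      using x k linfnorm_ge[OF k(1), of "x(j := t)"] by simp
    then show ?thesis by simp
  qed
qed


section \<open>Differences of integrals and total variation\<close>

lemma abs_le_tv_fun:
  assumes A: "A \<in> sets N" and z: "\<zeta> {} = 0"
  shows "ennreal \<bar>\<zeta> A\<bar> \<le> tv_fun N \<zeta> A"
proof -
  define B where "B = binaryset A {}"
  have B: "range B \<subseteq> sets N" "disjoint_family B" "(\<Union>i. B i) = A"
  proof -
    show "range B \<subseteq> sets N" using A by (simp add: B_def range_binaryset_eq)
    show "disjoint_family B" unfolding B_def disjoint_family_on_def binaryset_def by simp
    show "(\<Union>i. B i) = A" unfolding B_def UN_binaryset_eq by blast
  qed
  have "(\<Sum>i. ennreal \<bar>\<zeta> (B i)\<bar>) = (\<Sum>i\<in>{0}. ennreal \<bar>\<zeta> (B i)\<bar>)"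
    by (rule suminf_finite) (auto simp: B_def binaryset_def z)
  then have "ennreal \<bar>\<zeta> A\<bar> = (\<Sum>i. ennreal \<bar>\<zeta> (B i)\<bar>)" by (simp add: B_def binaryset_def)
  then show ?thesis
    unfolding tv_fun_def using B by (intro SUP_upper2[of B]) auto
qed

text \<open>It will be applied with the total variation of \<open>P - Q\<close> as \<open>T\<close>, which satisfies the hypothesis for \<open>P\<close>, \<open>Q\<close>
  in both orders because \<open>|\<zeta> A| \<le> |\<zeta>| A\<close>.\<close>

lemma nn_integral_le_add_measure:
  assumes sets: "sets P = sets N" "sets Q = sets N" "sets T = sets N"
    and le: "\<And>A. A \<in> sets N \<Longrightarrow> emeasure P A \<le> emeasure Q A + emeasure T A"
    and g: "g \<in> borel_measurable N"
  shows "(\<integral>\<^sup>+x. g x \<partial>P) \<le> (\<integral>\<^sup>+x. g x \<partial>Q) + (\<integral>\<^sup>+x. g x \<partial>T)"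
  using g
proof (induction rule: borel_measurable_induct)
  case (cong f g)
  moreover have "space P = space N" "space Q = space N" "space T = space N"
    using sets by (auto dest: sets_eq_imp_space_eq)
  ultimately show ?case by (simp cong: nn_integral_cong_simp)
next
  case (set A)
  then show ?case using le sets by simp
next
  case (mult u c)
  have [measurable]: "u \<in> borel_measurable P" "u \<in> borel_measurable Q" "u \<in> borel_measurable T"
    using mult(2) sets by (auto cong: measurable_cong_sets)
  show ?case
    using mult_left_mono[OF mult.IH, of c] by (simp add: nn_integral_cmult distrib_left)
next
  case (add u v)
  have [measurable]: "u \<in> borel_measurable P" "u \<in> borel_measurable Q" "u \<in> borel_measurable T"
    "v \<in> borel_measurable P" "v \<in> borel_measurable Q" "v \<in> borel_measurable T"
    using add(1,3) sets by (auto cong: measurable_cong_sets)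
  show ?case
    using add_mono[OF add.IH(1) add.IH(2)] by (simp add: nn_integral_add ac_simps)
next
  case (seq U)
  have [measurable]: "U i \<in> borel_measurable P" "U i \<in> borel_measurable Q" "U i \<in> borel_measurable T" for i
    using seq(1) sets by (auto cong: measurable_cong_sets)
  have "(\<integral>\<^sup>+x. (SUP i. U i x) \<partial>P) = (SUP i. \<integral>\<^sup>+x. U i x \<partial>P)"
    using seq by (intro nn_integral_monotone_convergence_SUP) auto
  also have "\<dots> \<le> (SUP i. (\<integral>\<^sup>+x. U i x \<partial>Q) + (\<integral>\<^sup>+x. U i x \<partial>T))"
    using seq by (intro SUP_mono') auto
  also have "\<dots> \<le> (SUP i. \<integral>\<^sup>+x. U i x \<partial>Q) + (SUP i. \<integral>\<^sup>+x. U i x \<partial>T)"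
    by (intro SUP_least add_mono SUP_upper) auto
  also have "\<dots> = (\<integral>\<^sup>+x. (SUP i. U i x) \<partial>Q) + (\<integral>\<^sup>+x. (SUP i. U i x) \<partial>T)"
    using seq by (subst (1 2) nn_integral_monotone_convergence_SUP) auto
  finally show ?case by (simp add: image_comp)
qed

lemma integral_difference_le_tv:
  assumes P: "finite_measure P" and Q: "finite_measure Q"
    and sP: "sets P = sets N" and sQ: "sets Q = sets N"
    and \<zeta>: "\<And>A. A \<in> sets N \<Longrightarrow> \<zeta> A = measure P A - measure Q A"
    and iP: "integrable P g" and iQ: "integrable Q (g :: _ \<Rightarrow> real)"
  shows "ennreal \<bar>(\<integral>x. g x \<partial>P) - (\<integral>x. g x \<partial>Q)\<bar> \<le> (\<integral>\<^sup>+x. ennreal \<bar>g x\<bar> \<partial>tv_measure N \<zeta>)"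
proof -
  interpret P: finite_measure P by fact
  interpret Q: finite_measure Q by fact
  define T where "T = tv_measure N \<zeta>"
  have sT: "sets T = sets N" by (simp add: T_def tv_measure_def)
  have g[measurable]: "g \<in> borel_measurable N" using iP sP by (auto cong: measurable_cong_sets)
  have gm: "g \<in> borel_measurable P" "g \<in> borel_measurable Q" "g \<in> borel_measurable T"
    using g sP sQ sT by (auto cong: measurable_cong_sets)
  have eT: "ennreal \<bar>\<zeta> A\<bar> \<le> emeasure T A" if A: "A \<in> sets N" for A
    unfolding T_def using abs_le_tv_fun[OF A, of \<zeta>] \<zeta>[of "{}"]
    by (subst emeasure_tv_measure[OF P Q sP sQ \<zeta> A]) auto
  have lePQ: "emeasure P A \<le> emeasure Q A + emeasure T A" if A: "A \<in> sets N" for A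
  proof -
    have "emeasure P A \<le> ennreal (measure Q A + \<bar>\<zeta> A\<bar>)"
      unfolding P.emeasure_eq_measure using \<zeta>[OF A] by (intro ennreal_leI) auto
    also have "\<dots> \<le> emeasure Q A + emeasure T A"
      using eT[OF A] by (simp add: Q.emeasure_eq_measure add_left_mono)
    finally show ?thesis .
  qed
  have leQP: "emeasure Q A \<le> emeasure P A + emeasure T A" if A: "A \<in> sets N" for A
  proof -
    have "emeasure Q A \<le> ennreal (measure P A + \<bar>\<zeta> A\<bar>)"
      unfolding Q.emeasure_eq_measure using \<zeta>[OF A] by (intro ennreal_leI) auto
    also have "\<dots> \<le> emeasure P A + emeasure T A"
      using eT[OF A] by (simp add: P.emeasure_eq_measure add_left_mono)
    finally show ?thesis .
  qed
  show ?thesis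
  proof (cases "(\<integral>\<^sup>+x. ennreal \<bar>g x\<bar> \<partial>T) = \<infinity>")
    case True
    then show ?thesis by (simp add: T_def)
  next
    case False
    then have iT: "integrable T g" using gm by (simp add: integrable_iff_bounded less_top)
    have *: "\<bar>(\<integral>x. h x \<partial>P) - (\<integral>x. h x \<partial>Q)\<bar> \<le> (\<integral>x. h x \<partial>T)"
      if h: "integrable P h" "integrable Q h" "integrable T h" "\<And>x. 0 \<le> h x" for h :: "_ \<Rightarrow> real"
    proof -
      have [measurable]: "h \<in> borel_measurable N" using h sP by (auto cong: measurable_cong_sets)
      have nn: "0 \<le> (\<integral>x. h x \<partial>P)" "0 \<le> (\<integral>x. h x \<partial>Q)" "0 \<le> (\<integral>x. h x \<partial>T)"
        using h(4) by auto
      have "(\<integral>\<^sup>+x. h x \<partial>P) \<le> (\<integral>\<^sup>+x. h x \<partial>Q) + (\<integral>\<^sup>+x. h x \<partial>T)"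
        by (rule nn_integral_le_add_measure[OF sP sQ sT lePQ]) auto
      moreover have "(\<integral>\<^sup>+x. h x \<partial>Q) \<le> (\<integral>\<^sup>+x. h x \<partial>P) + (\<integral>\<^sup>+x. h x \<partial>T)"
        by (rule nn_integral_le_add_measure[OF sQ sP sT leQP]) auto
      ultimately show ?thesis
        using h nn by (simp add: nn_integral_eq_integral flip: ennreal_plus)
    qed
    have i: "integrable K (\<lambda>x. max 0 (g x))" "integrable K (\<lambda>x. max 0 (- g x))" if "integrable K g" for K
      using that by (auto intro!: integrable_max)
    have split: "(\<integral>x. g x \<partial>K) = (\<integral>x. max 0 (g x) \<partial>K) - (\<integral>x. max 0 (- g x) \<partial>K)"
      and asplit: "(\<integral>x. \<bar>g x\<bar> \<partial>K) = (\<integral>x. max 0 (g x) \<partial>K) + (\<integral>x. max 0 (- g x) \<partial>K)" if "integrable K g" for K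
      unfolding Bochner_Integration.integral_diff[OF i[OF that], symmetric]
        Bochner_Integration.integral_add[OF i[OF that], symmetric]
      by (auto intro!: Bochner_Integration.integral_cong)
    have "\<bar>(\<integral>x. g x \<partial>P) - (\<integral>x. g x \<partial>Q)\<bar> \<le> (\<integral>x. \<bar>g x\<bar> \<partial>T)"
      unfolding split[OF iP] split[OF iQ] asplit[OF iT]
      using *[OF i(1)[OF iP] i(1)[OF iQ] i(1)[OF iT]] *[OF i(2)[OF iP] i(2)[OF iQ] i(2)[OF iT]] by simp
    then show ?thesis
      using iT by (simp add: T_def[symmetric] nn_integral_eq_integral)
  qed
qed


section \<open>Smoothed indicators of balls\<close>

locale smoothing = C3_function p f f1 f2 f3 for p f f1 f2 f3 +
  fixes r \<epsilon> C0 C :: real and D1 D2 D3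
  assumes p: "1 \<le> p" and r: "0 \<le> r" and eps: "0 < \<epsilon>" and C0: "0 < C0" and C: "0 < C"
    and sandwich: "\<And>x. x \<in> space (Rvec p) \<Longrightarrow> f x \<in> {0..1} \<and>
           indicator {x. linfnorm p x \<le> r} x \<le> f x \<and>
           f x \<le> indicator {x. linfnorm p x \<le> r + \<epsilon>} x"
    and D1: "\<And>j. j < p \<Longrightarrow> stable_dominator p C \<epsilon> (f1 j) (D1 j)"
    and D2: "\<And>j k. j < p \<Longrightarrow> k < p \<Longrightarrow> stable_dominator p C \<epsilon> (f2 j k) (D2 j k)"
    and D3: "\<And>j k l. j < p \<Longrightarrow> k < p \<Longrightarrow> l < p \<Longrightarrow> stable_dominator p C \<epsilon> (f3 j k l) (D3 j k l)"
    and sums: "\<And>x. x \<in> space (Rvec p) \<Longrightarrow>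
           (\<Sum>j<p. D1 j x) \<le> C0 / \<epsilon> \<and>
           (\<Sum>j<p. \<Sum>k<p. D2 j k x) \<le> C0 * log_ep p / \<epsilon> ^ 2 \<and>
           (\<Sum>j<p. \<Sum>k<p. \<Sum>l<p. D3 j k l x) \<le> C0 * (log_ep p)\<^sup>2 / \<epsilon> ^ 3"

lemma obtain_smoothing:
  assumes "smoothing_constants C0 C" "1 \<le> p" "0 \<le> r" "0 < \<epsilon>"
  obtains f f1 f2 f3 D1 D2 D3 where "smoothing p f f1 f2 f3 r \<epsilon> C0 C D1 D2 D3"
proof -
  obtain f f1 f2 f3 D1 D2 D3 where *: "C3_with_partials p f f1 f2 f3 \<and>
        (\<forall>x\<in>space (Rvec p). f x \<in> {0..1} \<and>
           indicator {x. linfnorm p x \<le> r} x \<le> f x \<and>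
           f x \<le> indicator {x. linfnorm p x \<le> r + \<epsilon>} x) \<and>
        (\<forall>j<p. stable_dominator p C \<epsilon> (f1 j) (D1 j)) \<and>
        (\<forall>j<p. \<forall>k<p. stable_dominator p C \<epsilon> (f2 j k) (D2 j k)) \<and>
        (\<forall>j<p. \<forall>k<p. \<forall>l<p. stable_dominator p C \<epsilon> (f3 j k l) (D3 j k l)) \<and>
        (\<forall>x\<in>space (Rvec p).
           (\<Sum>j<p. D1 j x) \<le> C0 / \<epsilon> \<and>
           (\<Sum>j<p. \<Sum>k<p. D2 j k x) \<le> C0 * log_ep p / \<epsilon> ^ 2 \<and>
           (\<Sum>j<p. \<Sum>k<p. \<Sum>l<p. D3 j k l x) \<le> C0 * (log_ep p)\<^sup>2 / \<epsilon> ^ 3)"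
    using assms(1)[unfolded smoothing_constants_def, THEN conjunct2, THEN conjunct2, rule_format, OF assms(2-4)]
    by (elim exE) (rule that)
  have "0 < C0" "0 < C" using assms(1) by (auto simp: smoothing_constants_def)
  then have "smoothing p f f1 f2 f3 r \<epsilon> C0 C D1 D2 D3"
    using * assms(2-) by unfold_locales auto
  then show ?thesis by (rule that)
qed

lemma log_ep_ge_1: "1 \<le> p \<Longrightarrow> 1 \<le> log_ep p"
  by (simp add: log_ep_def ln_mult)

context smoothing
begin

lemma Dnonneg:
  assumes "x \<in> space (Rvec p)" "j < p" "k < p" "l < p"
  shows "0 \<le> D1 j x" "\<bar>f1 j x\<bar> \<le> D1 j x" "0 \<le> D2 j k x" "\<bar>f2 j k x\<bar> \<le> D2 j k x"
    "0 \<le> D3 j k l x" "\<bar>f3 j k l x\<bar> \<le> D3 j k l x"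
  using assms D1[of j] D2[of j k] D3[of j k l] unfolding stable_dominator_def by auto

lemma measurable_f [measurable]:
  "f \<in> borel_measurable (Rvec p)"
  "j < p \<Longrightarrow> f1 j \<in> borel_measurable (Rvec p)"
  "j < p \<Longrightarrow> k < p \<Longrightarrow> f2 j k \<in> borel_measurable (Rvec p)"
  "j < p \<Longrightarrow> k < p \<Longrightarrow> l < p \<Longrightarrow> D3 j k l \<in> borel_measurable (Rvec p)"
  using D3 by (auto intro!: continuous_on_Rvec_measurable cont cont1 cont2 simp: stable_dominator_def)

lemma f01: "x \<in> space (Rvec p) \<Longrightarrow> \<bar>f x\<bar> \<le> 1"
  using sandwich[of x] by auto

lemma f1_le:
  assumes x: "x \<in> space (Rvec p)" and j: "j < p"
  shows "\<bar>f1 j x\<bar> \<le> C0 / \<epsilon>"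
proof -
  have "\<bar>f1 j x\<bar> \<le> D1 j x" using Dnonneg[OF x j j j] by simp
  also have "\<dots> \<le> (\<Sum>j<p. D1 j x)"
    using Dnonneg(1)[OF x] j by (intro member_le_sum) auto
  finally show ?thesis using sums[OF x] by linarith
qed

lemma sum_f2_le: "x \<in> space (Rvec p) \<Longrightarrow> (\<Sum>j<p. \<Sum>k<p. \<bar>f2 j k x\<bar>) \<le> C0 * log_ep p / \<epsilon> ^ 2"
proof -
  assume x: "x \<in> space (Rvec p)"
  have "(\<Sum>j<p. \<Sum>k<p. \<bar>f2 j k x\<bar>) \<le> (\<Sum>j<p. \<Sum>k<p. D2 j k x)"
    using Dnonneg[OF x] by (intro sum_mono) auto
  then show ?thesis using sums[OF x] by linarith
qed

lemma f2_le: "x \<in> space (Rvec p) \<Longrightarrow> j < p \<Longrightarrow> k < p \<Longrightarrow> \<bar>f2 j k x\<bar> \<le> C0 * log_ep p / \<epsilon> ^ 2"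
proof -
  assume x: "x \<in> space (Rvec p)" and jk: "j < p" "k < p"
  have "\<bar>f2 j k x\<bar> \<le> (\<Sum>k<p. \<bar>f2 j k x\<bar>)"
    using jk by (intro member_le_sum) auto
  also have "\<dots> \<le> (\<Sum>j<p. \<Sum>k<p. \<bar>f2 j k x\<bar>)"
    using jk by (intro member_le_sum[of j _ "\<lambda>j. \<Sum>k<p. \<bar>f2 j k x\<bar>"]) (auto intro: sum_nonneg)
  finally show ?thesis using sum_f2_le[OF x] by linarith
qed

text \<open>The dominators are positive everywhere unless they vanish identically. Localization has to come
  from \<open>f\<close> itself, which is constant on the open sets inside and outside the annulus.\<close>

lemma f3_zero_off_annulus:
  assumes x: "x \<in> space (Rvec p)" and off: "linfnorm p x < r \<or> r + \<epsilon> < linfnorm p x"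
    and j: "j < p" "k < p" "l < p"
  shows "f3 j k l x = 0"
proof -
  have upd: "x(i := t) \<in> space (Rvec p)" if "x \<in> space (Rvec p)" "i < p" for x i t
    using that by (auto simp: Rvec_space_iff)
  have key: "f3 j k l x = 0"
    if S: "S \<subseteq> space (Rvec p)" and x: "x \<in> S"
      and op: "\<And>x i. x \<in> S \<Longrightarrow> i < p \<Longrightarrow> \<forall>\<^sub>F t in nhds (x i). x(i := t) \<in> S"
      and c: "\<And>x. x \<in> S \<Longrightarrow> f x = c" for S c
  proof -
    have 1: "f1 j x = 0" if "x \<in> S" for x
      using S c that j by (intro partial_vanishes_where_constant[OF part1 _ _ op, where c=c]) auto
    have 2: "f2 j k x = 0" if "x \<in> S" for x
      using S 1 that j by (intro partial_vanishes_where_constant[OF part2 _ _ op, where c=0]) auto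
    show ?thesis
      using S 2 x j by (intro partial_vanishes_where_constant[OF part3 _ _ op, where c=0]) auto
  qed
  from off show ?thesis
  proof
    assume l: "linfnorm p x < r"
    show ?thesis
    proof (rule key[of "{x \<in> space (Rvec p). linfnorm p x < r}" 1])
      fix y i assume y: "y \<in> {x \<in> space (Rvec p). linfnorm p x < r}" "i < p"
      then have "\<forall>\<^sub>F t in nhds (y i). linfnorm p (y(i := t)) < r"
        by (intro eventually_linfnorm_less p) auto
      then show "\<forall>\<^sub>F t in nhds (y i). y(i := t) \<in> {x \<in> space (Rvec p). linfnorm p x < r}"
        by eventually_elim (use y upd in auto)
    next
      fix y assume "y \<in> {x \<in> space (Rvec p). linfnorm p x < r}"
      then show "f y = 1" using sandwich[of y] by (auto simp: indicator_def)
    qed (use l x in auto)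
  next
    assume l: "r + \<epsilon> < linfnorm p x"
    show ?thesis
    proof (rule key[of "{x \<in> space (Rvec p). r + \<epsilon> < linfnorm p x}" 0])
      fix y i assume y: "y \<in> {x \<in> space (Rvec p). r + \<epsilon> < linfnorm p x}" "i < p"
      then have "\<forall>\<^sub>F t in nhds (y i). r + \<epsilon> < linfnorm p (y(i := t))"
        by (intro eventually_linfnorm_greater p) auto
      then show "\<forall>\<^sub>F t in nhds (y i). y(i := t) \<in> {x \<in> space (Rvec p). r + \<epsilon> < linfnorm p x}"
        by eventually_elim (use y upd in auto)
    next
      fix y assume "y \<in> {x \<in> space (Rvec p). r + \<epsilon> < linfnorm p x}"
      then show "f y = 0" using sandwich[of y] by (auto simp: indicator_def)
    qed (use l x in auto)
  qed
qed

definition annulus where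
  "annulus = {w \<in> space (Rvec p). r - \<epsilon> / log_ep p \<le> linfnorm p w \<and> linfnorm p w \<le> r + \<epsilon> + \<epsilon> / log_ep p}"

lemma annulus_sets [measurable]: "annulus \<in> sets (Rvec p)"
  unfolding annulus_def using linfnorm_measurable[OF p] by measurable

definition taylor_rem where "taylor_rem w v = f (add_scaled p w 1 v) - f w - dir_deriv1 w v - dir_deriv2 w v / 2"

lemma dir_deriv2_le: "x \<in> space (Rvec p) \<Longrightarrow> \<bar>dir_deriv2 x v\<bar> \<le> (linfnorm p v)\<^sup>2 * (C0 * log_ep p / \<epsilon> ^ 2)"
proof -
  assume x: "x \<in> space (Rvec p)"
  have vv: "\<bar>v j\<bar> * \<bar>v k\<bar> \<le> (linfnorm p v)\<^sup>2" if "j < p" "k < p" for j k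
    unfolding power2_eq_square using that p by (intro mult_mono linfnorm_ge linfnorm_nonneg) auto
  have "\<bar>dir_deriv2 x v\<bar> \<le> (\<Sum>j<p. \<Sum>k<p. \<bar>v j * v k * f2 j k x\<bar>)"
    unfolding dir_deriv2_def by (intro order_trans[OF sum_abs] sum_mono) auto
  also have "\<dots> \<le> (\<Sum>j<p. \<Sum>k<p. (linfnorm p v)\<^sup>2 * \<bar>f2 j k x\<bar>)"
    using vv by (intro sum_mono) (auto simp: abs_mult intro!: mult_right_mono)
  also have "\<dots> = (linfnorm p v)\<^sup>2 * (\<Sum>j<p. \<Sum>k<p. \<bar>f2 j k x\<bar>)"
    by (simp add: sum_distrib_left)
  also have "\<dots> \<le> (linfnorm p v)\<^sup>2 * (C0 * log_ep p / \<epsilon> ^ 2)"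
    using sum_f2_le[OF x] by (intro mult_left_mono) auto
  finally show ?thesis .
qed

lemma taylor_rem_le_quadratic:
  assumes w: "w \<in> space (Rvec p)"
  shows "\<bar>taylor_rem w v\<bar> \<le> (linfnorm p v)\<^sup>2 * (C0 * log_ep p / \<epsilon> ^ 2)"
proof -
  obtain t where "f (add_scaled p w 1 v) = f w + dir_deriv1 w v + dir_deriv2 (add_scaled p w t v) v / 2" by (rule taylor2[OF w])
  then show ?thesis
    using dir_deriv2_le[OF w, of v] dir_deriv2_le[OF add_scaled_in_space, of w t v v] unfolding taylor_rem_def by linarith
qed

text \<open>For increments shorter than \<open>\<epsilon> / log(ep)\<close> the stability of the dominators costs only
  \<open>exp C\<close>, and an intermediate point in the annulus forces \<open>w\<close> into the annulus widened by that length.\<close>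

lemma taylor_rem_le_cubic:
  assumes w: "w \<in> space (Rvec p)" and v: "linfnorm p v \<le> \<epsilon> / log_ep p"
  shows "\<bar>taylor_rem w v\<bar> \<le> exp C / 6 * (\<Sum>j<p. \<Sum>k<p. \<Sum>l<p. \<bar>v j * v k * v l\<bar> * (D3 j k l w * indicator annulus w))"
proof -
  obtain t where t: "0 < t" "t < 1" and eq: "f (add_scaled p w 1 v) = f w + dir_deriv1 w v + dir_deriv2 w v / 2 + dir_deriv3 (add_scaled p w t v) v / 6"
    by (rule taylor3[OF w])
  define y where "y = add_scaled p w t v"
  define u where "u = (\<lambda>i\<in>{..<p}. t * v i)"
  have lg: "0 < log_ep p" using log_ep_ge_1[OF p] by linarith
  have u: "u \<in> space (Rvec p)" by (auto simp: u_def Rvec_space_iff)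
  have y: "y \<in> space (Rvec p)" "y = vadd p w u"
    unfolding y_def by (simp, auto simp: add_scaled_def vadd_def u_def)
  have nu: "linfnorm p u \<le> \<epsilon> / log_ep p"
  proof -
    have "linfnorm p u \<le> linfnorm p v"
      unfolding u_def linfnorm_scale[OF p] using t linfnorm_nonneg[OF p, of v] by (simp add: mult_left_le_one_le)
    then show ?thesis using v by linarith
  qed
  have f3: "\<bar>f3 j k l y\<bar> \<le> exp C * (D3 j k l w * indicator annulus w)" if j: "j < p" "k < p" "l < p" for j k l
  proof (cases "w \<in> annulus")
    case True
    have "\<bar>f3 j k l y\<bar> \<le> D3 j k l y" using Dnonneg y j by auto
    also have "\<dots> \<le> exp (C * log_ep p * linfnorm p u / \<epsilon>) * D3 j k l w"
      using D3[OF j] w u unfolding stable_dominator_def y(2) by auto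
    also have "\<dots> \<le> exp C * D3 j k l w"
    proof (intro mult_right_mono)
      have "log_ep p * linfnorm p u / \<epsilon> \<le> 1"
        using nu lg eps by (simp add: field_simps)
      then show "exp (C * log_ep p * linfnorm p u / \<epsilon>) \<le> exp C"
        using C mult_left_le[of "log_ep p * linfnorm p u / \<epsilon>" C] by (simp add: mult.assoc)
    qed (use Dnonneg w j in auto)
    finally show ?thesis using True by simp
  next
    case False
    have 1: "linfnorm p y \<le> linfnorm p w + linfnorm p u"
      unfolding y(2) by (rule linfnorm_triangle[OF p]) (auto simp: vadd_def)
    have 2: "linfnorm p w \<le> linfnorm p y + linfnorm p u"
    proof -
      have "linfnorm p w \<le> linfnorm p y + linfnorm p (\<lambda>i\<in>{..<p}. (-1) * u i)"
        unfolding y(2) by (rule linfnorm_triangle[OF p]) (auto simp: vadd_def)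
      then show ?thesis unfolding linfnorm_scale[OF p] by simp
    qed
    have "linfnorm p y < r \<or> r + \<epsilon> < linfnorm p y"
      using False w 1 2 nu by (auto simp: annulus_def)
    then have "f3 j k l y = 0" using f3_zero_off_annulus y j by blast
    then show ?thesis using False by simp
  qed
  have "\<bar>taylor_rem w v\<bar> = \<bar>dir_deriv3 y v\<bar> / 6" unfolding taylor_rem_def eq y_def by simp
  also have "\<bar>dir_deriv3 y v\<bar> \<le> (\<Sum>j<p. \<Sum>k<p. \<Sum>l<p. \<bar>v j * v k * v l * f3 j k l y\<bar>)"
    unfolding dir_deriv3_def by (intro order_trans[OF sum_abs] sum_mono) auto
  also have "\<dots> \<le> (\<Sum>j<p. \<Sum>k<p. \<Sum>l<p. exp C * (\<bar>v j * v k * v l\<bar> * (D3 j k l w * indicator annulus w)))"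
  proof (intro sum_mono)
    fix j k l assume "j \<in> {..<p}" "k \<in> {..<p}" "l \<in> {..<p}"
    then have "\<bar>v j * v k * v l\<bar> * \<bar>f3 j k l y\<bar> \<le> \<bar>v j * v k * v l\<bar> * (exp C * (D3 j k l w * indicator annulus w))"
      using f3 by (intro mult_left_mono) auto
    then show "\<bar>v j * v k * v l * f3 j k l y\<bar> \<le> exp C * (\<bar>v j * v k * v l\<bar> * (D3 j k l w * indicator annulus w))"
      by (simp add: abs_mult mult_ac)
  qed
  finally show ?thesis unfolding sum_distrib_left[symmetric] by simp
qed

end


section \<open>Exchanging one summand\<close>

lemma linfnorm_cmult: "1 \<le> p \<Longrightarrow> linfnorm p (\<lambda>i. t * x i) = \<bar>t\<bar> * linfnorm p x"
  using linfnorm_scale[of p t x] by (simp add: linfnorm_def cong: image_cong_simp)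

text \<open>Integrated, it bounds mixed third moments by the largest pure one, as Hoelder's inequality would.\<close>

lemma abs_triple_product_le:
  fixes a b c :: real
  assumes "0 \<le> a" "0 \<le> b" "0 \<le> c"
  shows "a * b * c \<le> (a ^ 3 + b ^ 3 + c ^ 3) / 3"
proof -
  have "a ^ 3 + b ^ 3 + c ^ 3 - 3 * (a * b * c) = (a + b + c) * ((a - b)\<^sup>2 + (b - c)\<^sup>2 + (c - a)\<^sup>2) / 2"
    by (simp add: power2_eq_square power3_eq_cube field_simps)
  also have "\<dots> \<ge> 0" using assms by simp
  finally show ?thesis by simp
qed

lemma add_scaled_measurable:
  "(\<lambda>z. add_scaled p (fst z) t (snd z)) \<in> measurable (Rvec p \<Otimes>\<^sub>M Rvec p) (Rvec p)"
  unfolding add_scaled_def by (rule measurable_restrict) measurable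

lemma integrable_mult_of_squares:
  assumes [measurable]: "f \<in> borel_measurable M" "g \<in> borel_measurable M"
    and "integrable M (\<lambda>x. (f x)\<^sup>2 :: real)" "integrable M (\<lambda>x. (g x)\<^sup>2)"
  shows "integrable M (\<lambda>x. f x * g x)"
proof (rule Bochner_Integration.integrable_bound)
  show "integrable M (\<lambda>x. (f x)\<^sup>2 + (g x)\<^sup>2)" using assms by simp
  have "\<bar>a * b\<bar> \<le> a\<^sup>2 + b\<^sup>2" for a b :: real
  proof -
    have "2 * (\<bar>a\<bar> * \<bar>b\<bar>) \<le> a\<^sup>2 + b\<^sup>2" using sum_squares_bound[of "\<bar>a\<bar>" "\<bar>b\<bar>"] by simp
    moreover have "0 \<le> \<bar>a\<bar> * \<bar>b\<bar>" by simp
    ultimately show ?thesis unfolding abs_mult by linarith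
  qed
  then show "AE x in M. norm (f x * g x) \<le> norm ((f x)\<^sup>2 + (g x)\<^sup>2)"
    by (intro AE_I2) (simp add: abs_of_nonneg)
qed simp

lemma integral_sum2:
  fixes g :: "'i \<Rightarrow> 'j \<Rightarrow> 'a \<Rightarrow> real"
  assumes "\<And>j k. j \<in> A \<Longrightarrow> k \<in> B \<Longrightarrow> integrable K (g j k)"
  shows "integrable K (\<lambda>x. \<Sum>j\<in>A. \<Sum>k\<in>B. g j k x)"
    and "(\<integral>x. (\<Sum>j\<in>A. \<Sum>k\<in>B. g j k x) \<partial>K) = (\<Sum>j\<in>A. \<Sum>k\<in>B. \<integral>x. g j k x \<partial>K)"
  using assms by (auto simp: Bochner_Integration.integral_sum Bochner_Integration.integrable_sum)

lemma integral_sum3: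
  fixes g :: "'i \<Rightarrow> 'j \<Rightarrow> 'k \<Rightarrow> 'a \<Rightarrow> real"
  assumes "\<And>j k l. j \<in> A \<Longrightarrow> k \<in> B \<Longrightarrow> l \<in> C \<Longrightarrow> integrable K (g j k l)"
  shows "integrable K (\<lambda>x. \<Sum>j\<in>A. \<Sum>k\<in>B. \<Sum>l\<in>C. g j k l x)"
    and "(\<integral>x. (\<Sum>j\<in>A. \<Sum>k\<in>B. \<Sum>l\<in>C. g j k l x) \<partial>K) = (\<Sum>j\<in>A. \<Sum>k\<in>B. \<Sum>l\<in>C. \<integral>x. g j k l x \<partial>K)"
  using assms by (auto simp: Bochner_Integration.integral_sum Bochner_Integration.integrable_sum)

lemma ennreal_sum3:
  fixes g :: "'i \<Rightarrow> 'j \<Rightarrow> 'k \<Rightarrow> real"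
  assumes "\<And>j k l. j \<in> A \<Longrightarrow> k \<in> B \<Longrightarrow> l \<in> C \<Longrightarrow> 0 \<le> g j k l"
  shows "(\<Sum>j\<in>A. \<Sum>k\<in>B. \<Sum>l\<in>C. ennreal (g j k l)) = ennreal (\<Sum>j\<in>A. \<Sum>k\<in>B. \<Sum>l\<in>C. g j k l)"
  using assms by (simp add: sum_ennreal sum_nonneg)

lemma nn_integral_sum3:
  fixes g :: "'i \<Rightarrow> 'j \<Rightarrow> 'k \<Rightarrow> 'a \<Rightarrow> ennreal"
  assumes "\<And>j k l. j \<in> A \<Longrightarrow> k \<in> B \<Longrightarrow> l \<in> C \<Longrightarrow> g j k l \<in> borel_measurable K"
  shows "(\<integral>\<^sup>+x. (\<Sum>j\<in>A. \<Sum>k\<in>B. \<Sum>l\<in>C. g j k l x) \<partial>K) = (\<Sum>j\<in>A. \<Sum>k\<in>B. \<Sum>l\<in>C. \<integral>\<^sup>+x. g j k l x \<partial>K)"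
  using assms by (simp add: nn_integral_sum)

context smoothing
begin

lemma dir_deriv1_cmult: "dir_deriv1 w (\<lambda>i. t * x i) = t * dir_deriv1 w x"
  by (simp add: dir_deriv1_def sum_distrib_left mult.assoc)

lemma dir_deriv2_cmult: "dir_deriv2 w (\<lambda>i. t * x i) = t\<^sup>2 * dir_deriv2 w x"
  by (simp add: dir_deriv2_def sum_distrib_left power2_eq_square mult_ac)

lemma sum_D3_le: "w \<in> space (Rvec p) \<Longrightarrow> (\<Sum>j<p. \<Sum>k<p. \<Sum>l<p. D3 j k l w) \<le> C0 * (log_ep p)\<^sup>2 / \<epsilon> ^ 3"
  using sums by blast

lemma D3_le: "x \<in> space (Rvec p) \<Longrightarrow> j < p \<Longrightarrow> k < p \<Longrightarrow> l < p \<Longrightarrow> D3 j k l x \<le> C0 * (log_ep p)\<^sup>2 / \<epsilon> ^ 3"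
proof -
  assume x: "x \<in> space (Rvec p)" and jk: "j < p" "k < p" "l < p"
  have "D3 j k l x \<le> (\<Sum>l<p. D3 j k l x)"
    using jk Dnonneg[OF x] by (intro member_le_sum) auto
  also have "\<dots> \<le> (\<Sum>k<p. \<Sum>l<p. D3 j k l x)"
    using jk Dnonneg[OF x] by (intro member_le_sum[of k _ "\<lambda>k. \<Sum>l<p. D3 j k l x"]) (auto intro!: sum_nonneg)
  also have "\<dots> \<le> (\<Sum>j<p. \<Sum>k<p. \<Sum>l<p. D3 j k l x)"
    using jk Dnonneg[OF x] by (intro member_le_sum[of j _ "\<lambda>j. \<Sum>k<p. \<Sum>l<p. D3 j k l x"]) (auto intro!: sum_nonneg)
  finally show ?thesis using sum_D3_le[OF x] by linarith
qed

text \<open>The remainder is averaged over \<open>W\<close> first. The result differs from the average of \<open>f (add_scaled p w \<kappa> x)\<close> by a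
  quadratic polynomial in \<open>x\<close>, whose integrals under \<open>P\<close> and \<open>Q\<close> agree; so only the remainder is integrated against
  the total variation.\<close>

lemma lindeberg_step:
  fixes W P Q :: "(nat \<Rightarrow> real) measure" and \<kappa> :: real
  assumes "prob_space W" "prob_space P" "prob_space Q"
    and sets: "sets W = sets (Rvec p)" "sets P = sets (Rvec p)" "sets Q = sets (Rvec p)"
    and \<zeta>: "\<And>A. A \<in> sets (Rvec p) \<Longrightarrow> \<zeta> A = measure P A - measure Q A"
    and \<kappa>: "0 < \<kappa>"
    and sqP: "\<And>j. j < p \<Longrightarrow> integrable P (\<lambda>x. (x j)\<^sup>2)"
    and sqQ: "\<And>j. j < p \<Longrightarrow> integrable Q (\<lambda>x. (x j)\<^sup>2)"
    and mom1: "\<And>j. j < p \<Longrightarrow> (\<integral>x. x j \<partial>P) = (\<integral>x. x j \<partial>Q)"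
    and mom2: "\<And>j k. j < p \<Longrightarrow> k < p \<Longrightarrow> (\<integral>x. x j * x k \<partial>P) = (\<integral>x. x j * x k \<partial>Q)"
  defines "T \<equiv> tv_measure (Rvec p) \<zeta>"
  shows "ennreal \<bar>(\<integral>x. (\<integral>w. f (add_scaled p w \<kappa> x) \<partial>W) \<partial>P) - (\<integral>x. (\<integral>w. f (add_scaled p w \<kappa> x) \<partial>W) \<partial>Q)\<bar> \<le>
     ennreal (\<kappa>\<^sup>2 * (C0 * log_ep p / \<epsilon>\<^sup>2)) *
        (\<integral>\<^sup>+x. ennreal ((linfnorm p x)\<^sup>2) * indicator {x. linfnorm p x \<ge> \<epsilon> / (\<kappa> * log_ep p)} x \<partial>T)
     + ennreal (\<kappa> ^ 3 * exp C / 6 * (C0 * (log_ep p)\<^sup>2 / \<epsilon> ^ 3) * measure W annulus) *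
        Max ((\<lambda>j. \<integral>\<^sup>+x. ennreal (\<bar>x j\<bar> ^ 3) \<partial>T) ` {..<p})"
proof -
  interpret W: prob_space W by fact
  interpret P: prob_space P by fact
  interpret Q: prob_space Q by fact
  have sT: "sets T = sets (Rvec p)" by (simp add: T_def tv_measure_def)
  have sp: "space W = space (Rvec p)" "space P = space (Rvec p)" "space Q = space (Rvec p)" "space T = space (Rvec p)"
    using sets sT by (auto dest: sets_eq_imp_space_eq)
  have lg: "1 \<le> log_ep p" by (rule log_ep_ge_1[OF p])
  note mc = measurable_cong_sets[OF sets(1) refl] measurable_cong_sets[OF sets(2) refl]
    measurable_cong_sets[OF sets(3) refl] measurable_cong_sets[OF sT refl]
  note [measurable] = linfnorm_measurable[OF p]
  have coord[measurable]: "j < p \<Longrightarrow> (\<lambda>x. x j) \<in> borel_measurable (Rvec p)" for j by simp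
  define E where "E x = (\<integral>w. f (add_scaled p w \<kappa> x) \<partial>W)" for x
  define A where "A j = (\<integral>w. f1 j w \<partial>W)" for j
  define B where "B j k = (\<integral>w. f2 j k w \<partial>W)" for j k
  define d where "d j k l = (\<integral>w. D3 j k l w * indicator annulus w \<partial>W)" for j k l
  define R where "R x = E x - (\<integral>w. f w \<partial>W) - \<kappa> * (\<Sum>j<p. x j * A j) - \<kappa>\<^sup>2 * (\<Sum>j<p. \<Sum>k<p. x j * x k * B j k) / 2" for x
  have iW: "integrable W g" if "g \<in> borel_measurable (Rvec p)" "\<And>w. w \<in> space (Rvec p) \<Longrightarrow> \<bar>g w\<bar> \<le> c"
    for g and c :: real
    using that by (intro W.integrable_const_bound[where B=c]) (auto simp: mc sp intro!: AE_I2)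
  have i0: "integrable W f" using f01 by (intro iW[of _ 1]) auto
  have i1: "integrable W (f1 j)" if "j < p" for j using that f1_le by (intro iW[of _ "C0/\<epsilon>"]) auto
  have i2: "integrable W (f2 j k)" if "j < p" "k < p" for j k
    using that f2_le by (intro iW[of _ "C0 * log_ep p / \<epsilon> ^ 2"]) auto
  have D3b: "\<bar>D3 j k l w * indicator annulus w\<bar> \<le> C0 * (log_ep p)\<^sup>2 / \<epsilon> ^ 3"
    if "w \<in> space (Rvec p)" "j < p" "k < p" "l < p" for j k l w
    using D3_le[OF that] Dnonneg(5)[OF that] C0 eps by (auto simp: indicator_def)
  have i3: "integrable W (\<lambda>w. D3 j k l w * indicator annulus w)" if "j < p" "k < p" "l < p" for j k l
    using that D3b by (intro iW[of _ "C0 * (log_ep p)\<^sup>2 / \<epsilon> ^ 3"]) auto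
  have mm: "(\<lambda>w. add_scaled p w \<kappa> x) \<in> measurable (Rvec p) (Rvec p)" for x
    unfolding add_scaled_def by (rule measurable_restrict) measurable
  have iE: "integrable W (\<lambda>w. f (add_scaled p w \<kappa> x))" for x
    using f01 measurable_compose[OF mm measurable_f(1)] by (intro iW[of _ 1]) auto
  have mv: "add_scaled p w \<kappa> x = add_scaled p w 1 (\<lambda>i. \<kappa> * x i)" for w x by (simp add: add_scaled_def)
  have R: "R x = (\<integral>w. taylor_rem w (\<lambda>i. \<kappa> * x i) \<partial>W)" and irem: "integrable W (\<lambda>w. taylor_rem w (\<lambda>i. \<kappa> * x i))" for x
  proof -
    have iP1: "integrable W (\<lambda>w. \<kappa> * dir_deriv1 w x)" and eP1: "(\<integral>w. \<kappa> * dir_deriv1 w x \<partial>W) = \<kappa> * (\<Sum>j<p. x j * A j)"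
      unfolding dir_deriv1_def A_def using i1 by (auto simp: Bochner_Integration.integral_sum)
    have iP2: "integrable W (\<lambda>w. \<kappa>\<^sup>2 * dir_deriv2 w x / 2)"
      and eP2: "(\<integral>w. \<kappa>\<^sup>2 * dir_deriv2 w x / 2 \<partial>W) = \<kappa>\<^sup>2 * (\<Sum>j<p. \<Sum>k<p. x j * x k * B j k) / 2"
      unfolding dir_deriv2_def B_def using i2 integral_sum2[of "{..<p}" "{..<p}" W "\<lambda>j k w. x j * x k * f2 j k w"] by simp_all
    have eq: "taylor_rem w (\<lambda>i. \<kappa> * x i) = f (add_scaled p w \<kappa> x) - f w - \<kappa> * dir_deriv1 w x - \<kappa>\<^sup>2 * dir_deriv2 w x / 2" for w
      by (simp add: taylor_rem_def dir_deriv1_cmult dir_deriv2_cmult mv)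
    show "integrable W (\<lambda>w. taylor_rem w (\<lambda>i. \<kappa> * x i))"
      unfolding eq using iE i0 iP1 iP2 by (intro Bochner_Integration.integrable_diff) auto
    show "R x = (\<integral>w. taylor_rem w (\<lambda>i. \<kappa> * x i) \<partial>W)"
      unfolding eq using iE i0 iP1 iP2
      by (simp only: Bochner_Integration.integral_diff Bochner_Integration.integrable_diff eP1 eP2 R_def E_def)
  qed
  have Rquad: "\<bar>R x\<bar> \<le> \<kappa>\<^sup>2 * (C0 * log_ep p / \<epsilon>\<^sup>2) * (linfnorm p x)\<^sup>2" for x
  proof -
    have "\<bar>R x\<bar> \<le> (\<integral>w. \<bar>taylor_rem w (\<lambda>i. \<kappa> * x i)\<bar> \<partial>W)" unfolding R by (rule integral_abs_bound)
    also have "\<dots> \<le> (\<integral>w. (linfnorm p (\<lambda>i. \<kappa> * x i))\<^sup>2 * (C0 * log_ep p / \<epsilon> ^ 2) \<partial>W)"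
      using irem taylor_rem_le_quadratic by (intro integral_mono) (auto simp: sp)
    also have "\<dots> = \<kappa>\<^sup>2 * (C0 * log_ep p / \<epsilon>\<^sup>2) * (linfnorm p x)\<^sup>2"
      by (simp add: W.prob_space linfnorm_cmult[OF p] power_mult_distrib)
    finally show ?thesis .
  qed
  have Rcub: "\<bar>R x\<bar> \<le> \<kappa> ^ 3 * exp C / 6 * (\<Sum>j<p. \<Sum>k<p. \<Sum>l<p. \<bar>x j\<bar> * \<bar>x k\<bar> * \<bar>x l\<bar> * d j k l)"
    if x: "linfnorm p x < \<epsilon> / (\<kappa> * log_ep p)" for x
  proof -
    have kx: "linfnorm p (\<lambda>i. \<kappa> * x i) \<le> \<epsilon> / log_ep p"
      using x \<kappa> lg by (simp add: linfnorm_cmult[OF p] field_simps)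
    have "\<bar>R x\<bar> \<le> (\<integral>w. \<bar>taylor_rem w (\<lambda>i. \<kappa> * x i)\<bar> \<partial>W)" unfolding R by (rule integral_abs_bound)
    also have "\<dots> \<le> (\<integral>w. exp C / 6 * (\<Sum>j<p. \<Sum>k<p. \<Sum>l<p. \<bar>(\<kappa> * x j) * (\<kappa> * x k) * (\<kappa> * x l)\<bar> * (D3 j k l w * indicator annulus w)) \<partial>W)"
      using irem taylor_rem_le_cubic[OF _ kx] i3
      by (intro integral_mono integrable_mult_right integral_sum3 integrable_abs) (auto simp: sp)
    also have "\<dots> = exp C / 6 * (\<Sum>j<p. \<Sum>k<p. \<Sum>l<p. \<bar>(\<kappa> * x j) * (\<kappa> * x k) * (\<kappa> * x l)\<bar> * d j k l)"
      unfolding d_def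
      by (subst integral_mult_right_zero, subst integral_sum3) (use i3 in auto)
    also have "\<dots> = \<kappa> ^ 3 * exp C / 6 * (\<Sum>j<p. \<Sum>k<p. \<Sum>l<p. \<bar>x j\<bar> * \<bar>x k\<bar> * \<bar>x l\<bar> * d j k l)"
      using \<kappa> by (simp add: sum_distrib_left abs_mult power3_eq_cube mult_ac)
    finally show ?thesis .
  qed
  have d0: "0 \<le> d j k l" if "j < p" "k < p" "l < p" for j k l
    unfolding d_def using Dnonneg(5) that by (intro integral_nonneg_AE AE_I2) (auto simp: sp)
  have dsum: "(\<Sum>j<p. \<Sum>k<p. \<Sum>l<p. d j k l) \<le> C0 * (log_ep p)\<^sup>2 / \<epsilon> ^ 3 * measure W annulus"
  proof -
    have "(\<Sum>j<p. \<Sum>k<p. \<Sum>l<p. d j k l) = (\<integral>w. (\<Sum>j<p. \<Sum>k<p. \<Sum>l<p. D3 j k l w * indicator annulus w) \<partial>W)"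
      unfolding d_def using i3 by (subst integral_sum3) auto
    also have "\<dots> \<le> (\<integral>w. C0 * (log_ep p)\<^sup>2 / \<epsilon> ^ 3 * indicator annulus w \<partial>W)"
    proof (intro integral_mono)
      show "integrable W (\<lambda>w. \<Sum>j<p. \<Sum>k<p. \<Sum>l<p. D3 j k l w * indicator annulus w)" using i3 by (intro integral_sum3) auto
      show "integrable W (\<lambda>w. C0 * (log_ep p)\<^sup>2 / \<epsilon> ^ 3 * indicator annulus w)"
        using annulus_sets sets by (intro integrable_mult_right integrable_real_indicator)
          (auto simp: W.emeasure_eq_measure)
      fix w assume "w \<in> space W"
      then have "(\<Sum>j<p. \<Sum>k<p. \<Sum>l<p. D3 j k l w) * indicator annulus w \<le> C0 * (log_ep p)\<^sup>2 / \<epsilon> ^ 3 * indicator annulus w"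
        using sum_D3_le by (intro mult_right_mono) (auto simp: sp)
      then show "(\<Sum>j<p. \<Sum>k<p. \<Sum>l<p. D3 j k l w * indicator annulus w) \<le> C0 * (log_ep p)\<^sup>2 / \<epsilon> ^ 3 * indicator annulus w"
        by (simp only: sum_distrib_right)
    qed
    also have "\<dots> = C0 * (log_ep p)\<^sup>2 / \<epsilon> ^ 3 * measure W annulus"
      using annulus_sets sets by simp
    finally show ?thesis .
  qed
  have mE: "E \<in> borel_measurable (Rvec p)"
  proof -
    have "(\<lambda>z. f (add_scaled p (snd z) \<kappa> (fst z))) \<in> borel_measurable (Rvec p \<Otimes>\<^sub>M Rvec p)"
      using measurable_compose[OF measurable_compose[OF measurable_pair_swap' add_scaled_measurable] measurable_f(1)]
      by (simp add: case_prod_beta)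
    then have "(\<lambda>(x, w). f (add_scaled p w \<kappa> x)) \<in> borel_measurable (Rvec p \<Otimes>\<^sub>M W)"
      unfolding measurable_cong_sets[OF sets_pair_measure_cong[OF refl[of "sets (Rvec p)"] sets(1)] refl]
      by (simp add: case_prod_beta)
    then show ?thesis
      unfolding E_def by (rule W.borel_measurable_lebesgue_integral)
  qed
  have bE: "\<bar>E x\<bar> \<le> 1" for x
  proof -
    have "\<bar>E x\<bar> \<le> (\<integral>w. \<bar>f (add_scaled p w \<kappa> x)\<bar> \<partial>W)" unfolding E_def by (rule integral_abs_bound)
    also have "\<dots> \<le> (\<integral>w. 1 \<partial>W)"
      by (rule integral_mono[OF integrable_abs[OF iE]]) (simp_all add: f01)
    finally show ?thesis by (simp add: W.prob_space)
  qed
  \<comment> \<open>For \<open>K = P\<close> and \<open>K = Q\<close> the right-hand sides agree up to the integral of \<open>E\<close>.\<close>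
  have main: "integrable K R \<and> (\<integral>x. R x \<partial>K) = (\<integral>x. E x \<partial>K) - (\<integral>w. f w \<partial>W)
        - \<kappa> * (\<Sum>j<p. (\<integral>x. x j \<partial>K) * A j) - \<kappa>\<^sup>2 * (\<Sum>j<p. \<Sum>k<p. (\<integral>x. x j * x k \<partial>K) * B j k) / 2"
    if K: "prob_space K" "sets K = sets (Rvec p)" and sq: "\<And>j. j < p \<Longrightarrow> integrable K (\<lambda>x. (x j)\<^sup>2)" for K
  proof -
    interpret K: prob_space K by fact
    have m[measurable]: "j < p \<Longrightarrow> (\<lambda>x. x j) \<in> borel_measurable K" for j
      using coord unfolding measurable_cong_sets[OF K(2) refl] .
    have mEK: "E \<in> borel_measurable K" using mE unfolding measurable_cong_sets[OF K(2) refl] .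
    have k0: "integrable K E"
      by (rule K.integrable_const_bound[where B=1]) (simp_all add: bE mEK)
    have k1: "integrable K (\<lambda>x. x j)" if "j < p" for j
      by (rule K.square_integrable_imp_integrable) (simp_all add: that sq)
    have k2: "integrable K (\<lambda>x. x j * x k)" if "j < p" "k < p" for j k
      by (rule integrable_mult_of_squares) (simp_all add: that sq)
    have k1': "integrable K (\<lambda>x. \<kappa> * (\<Sum>j<p. x j * A j))"
      using k1 by (intro integrable_mult_right Bochner_Integration.integrable_sum integrable_mult_left) auto
    have k2': "integrable K (\<lambda>x. \<kappa>\<^sup>2 * (\<Sum>j<p. \<Sum>k<p. x j * x k * B j k) / 2)"
      using k2 by (intro integrable_divide integrable_mult_right integral_sum2 integrable_mult_left) auto
    have "(\<integral>x. \<kappa> * (\<Sum>j<p. x j * A j) \<partial>K) = \<kappa> * (\<Sum>j<p. (\<integral>x. x j \<partial>K) * A j)"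
      using k1 by (subst integral_mult_right_zero, subst Bochner_Integration.integral_sum) auto
    moreover have "(\<integral>x. \<kappa>\<^sup>2 * (\<Sum>j<p. \<Sum>k<p. x j * x k * B j k) / 2 \<partial>K) = \<kappa>\<^sup>2 * (\<Sum>j<p. \<Sum>k<p. (\<integral>x. x j * x k \<partial>K) * B j k) / 2"
      using k2 by (subst integral_divide_zero, subst integral_mult_right_zero, subst integral_sum2) auto
    moreover have "(\<integral>x. R x \<partial>K) = (\<integral>x. E x \<partial>K) - (\<integral>w. f w \<partial>W)
        - (\<integral>x. \<kappa> * (\<Sum>j<p. x j * A j) \<partial>K) - (\<integral>x. \<kappa>\<^sup>2 * (\<Sum>j<p. \<Sum>k<p. x j * x k * B j k) / 2 \<partial>K)"
      unfolding R_def
      by (simp only: Bochner_Integration.integral_diff Bochner_Integration.integrable_diff k0 k1' k2'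
          K.integrable_const lebesgue_integral_const K.prob_space scaleR_one)
    moreover have "integrable K R"
      unfolding R_def by (intro Bochner_Integration.integrable_diff k0 k1' k2' K.integrable_const)
    ultimately show ?thesis by (simp only: simp_thms)
  qed
  have RP: "integrable P R" and RQ: "integrable Q R"
    using main[of P] main[of Q] sqP sqQ sets \<open>prob_space P\<close> \<open>prob_space Q\<close> by auto
  have "(\<integral>x. E x \<partial>P) - (\<integral>x. E x \<partial>Q) = (\<integral>x. R x \<partial>P) - (\<integral>x. R x \<partial>Q)"
    using main[of P] main[of Q] sqP sqQ sets mom1 mom2 \<open>prob_space P\<close> \<open>prob_space Q\<close> by auto
  then have "ennreal \<bar>(\<integral>x. E x \<partial>P) - (\<integral>x. E x \<partial>Q)\<bar> = ennreal \<bar>(\<integral>x. R x \<partial>P) - (\<integral>x. R x \<partial>Q)\<bar>" by simp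
  also have "\<dots> \<le> (\<integral>\<^sup>+x. ennreal \<bar>R x\<bar> \<partial>T)"
    unfolding T_def
    by (rule integral_difference_le_tv) (use RP RQ sets \<zeta> in \<open>auto simp: P.finite_measure_axioms Q.finite_measure_axioms\<close>)
  also have "\<dots> \<le> (\<integral>\<^sup>+x. ennreal (\<kappa>\<^sup>2 * (C0 * log_ep p / \<epsilon>\<^sup>2)) *
        (ennreal ((linfnorm p x)\<^sup>2) * indicator {x. linfnorm p x \<ge> \<epsilon> / (\<kappa> * log_ep p)} x)
      + (\<Sum>j<p. \<Sum>k<p. \<Sum>l<p. ennreal (\<kappa> ^ 3 * exp C / 6 * d j k l) * ennreal (\<bar>x j\<bar> * \<bar>x k\<bar> * \<bar>x l\<bar>)) \<partial>T)"
  proof (intro nn_integral_mono)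
    fix x
    show "ennreal \<bar>R x\<bar> \<le> ennreal (\<kappa>\<^sup>2 * (C0 * log_ep p / \<epsilon>\<^sup>2)) *
        (ennreal ((linfnorm p x)\<^sup>2) * indicator {x. linfnorm p x \<ge> \<epsilon> / (\<kappa> * log_ep p)} x)
      + (\<Sum>j<p. \<Sum>k<p. \<Sum>l<p. ennreal (\<kappa> ^ 3 * exp C / 6 * d j k l) * ennreal (\<bar>x j\<bar> * \<bar>x k\<bar> * \<bar>x l\<bar>))"
    proof (cases "linfnorm p x \<ge> \<epsilon> / (\<kappa> * log_ep p)")
      case True
      have "ennreal \<bar>R x\<bar> \<le> ennreal (\<kappa>\<^sup>2 * (C0 * log_ep p / \<epsilon>\<^sup>2)) * ennreal ((linfnorm p x)\<^sup>2)"
        using Rquad[of x] C0 lg by (subst ennreal_mult[symmetric]) (auto intro!: ennreal_leI)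
      then show ?thesis using True by (intro add_increasing2) auto
    next
      case False
      have "ennreal \<bar>R x\<bar> \<le> ennreal (\<kappa> ^ 3 * exp C / 6 * (\<Sum>j<p. \<Sum>k<p. \<Sum>l<p. \<bar>x j\<bar> * \<bar>x k\<bar> * \<bar>x l\<bar> * d j k l))"
        using Rcub[of x] False by (intro ennreal_leI) auto
      also have "\<dots> = ennreal (\<Sum>j<p. \<Sum>k<p. \<Sum>l<p. (\<kappa> ^ 3 * exp C / 6 * d j k l) * (\<bar>x j\<bar> * \<bar>x k\<bar> * \<bar>x l\<bar>))"
        unfolding sum_distrib_left by (intro arg_cong[where f=ennreal] sum.cong refl) (simp add: mult_ac)
      also have "\<dots> = (\<Sum>j<p. \<Sum>k<p. \<Sum>l<p. ennreal ((\<kappa> ^ 3 * exp C / 6 * d j k l) * (\<bar>x j\<bar> * \<bar>x k\<bar> * \<bar>x l\<bar>)))"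
        by (rule ennreal_sum3[symmetric]) (use d0 \<kappa> in auto)
      also have "\<dots> = (\<Sum>j<p. \<Sum>k<p. \<Sum>l<p. ennreal (\<kappa> ^ 3 * exp C / 6 * d j k l) * ennreal (\<bar>x j\<bar> * \<bar>x k\<bar> * \<bar>x l\<bar>))"
        by (intro sum.cong refl ennreal_mult) (use d0 \<kappa> in auto)
      finally show ?thesis using False by simp
    qed
  qed
  also have "\<dots> = ennreal (\<kappa>\<^sup>2 * (C0 * log_ep p / \<epsilon>\<^sup>2)) *
        (\<integral>\<^sup>+x. ennreal ((linfnorm p x)\<^sup>2) * indicator {x. linfnorm p x \<ge> \<epsilon> / (\<kappa> * log_ep p)} x \<partial>T)
      + (\<Sum>j<p. \<Sum>k<p. \<Sum>l<p. ennreal (\<kappa> ^ 3 * exp C / 6 * d j k l) * (\<integral>\<^sup>+x. ennreal (\<bar>x j\<bar> * \<bar>x k\<bar> * \<bar>x l\<bar>) \<partial>T))"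
  proof -
    have mT[measurable]: "linfnorm p \<in> borel_measurable T" "j < p \<Longrightarrow> (\<lambda>x. x j) \<in> borel_measurable T" for j
      using linfnorm_measurable[OF p] coord by (auto simp: mc)
    have ind: "indicator {x. linfnorm p x \<ge> \<epsilon> / (\<kappa> * log_ep p)} x = (indicator {\<epsilon> / (\<kappa> * log_ep p)..} (linfnorm p x) :: ennreal)" for x
      by (simp add: indicator_def)
    have m1: "(\<lambda>x. ennreal ((linfnorm p x)\<^sup>2) * indicator {x. linfnorm p x \<ge> \<epsilon> / (\<kappa> * log_ep p)} x) \<in> borel_measurable T"
      unfolding ind by measurable
    have m2: "(\<lambda>x. ennreal (\<bar>x j\<bar> * \<bar>x k\<bar> * \<bar>x l\<bar>)) \<in> borel_measurable T" if "j < p" "k < p" "l < p" for j k l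
      using that by measurable
    show ?thesis
      apply (subst nn_integral_add)
      subgoal using m1 by (rule borel_measurable_times_ennreal[OF borel_measurable_const])
      subgoal using m2 by (auto intro!: borel_measurable_sum borel_measurable_times_ennreal)
      apply (subst nn_integral_cmult[OF m1])
      apply (subst nn_integral_sum3)
      subgoal using m2 by (auto intro!: borel_measurable_times_ennreal)
      apply (intro arg_cong2[where f="(+)"] refl sum.cong nn_integral_cmult)
      subgoal using m2 by auto
      done
  qed
  also have "(\<Sum>j<p. \<Sum>k<p. \<Sum>l<p. ennreal (\<kappa> ^ 3 * exp C / 6 * d j k l) * (\<integral>\<^sup>+x. ennreal (\<bar>x j\<bar> * \<bar>x k\<bar> * \<bar>x l\<bar>) \<partial>T))
      \<le> (\<Sum>j<p. \<Sum>k<p. \<Sum>l<p. ennreal (\<kappa> ^ 3 * exp C / 6 * d j k l) * Max ((\<lambda>j. \<integral>\<^sup>+x. ennreal (\<bar>x j\<bar> ^ 3) \<partial>T) ` {..<p}))"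
  proof (intro sum_mono mult_left_mono)
    fix j k l assume j: "j \<in> {..<p}" "k \<in> {..<p}" "l \<in> {..<p}"
    have [measurable]: "(\<lambda>x. x j) \<in> borel_measurable T" "(\<lambda>x. x k) \<in> borel_measurable T" "(\<lambda>x. x l) \<in> borel_measurable T"
      using coord j by (auto simp: mc)
    define m where "m = Max ((\<lambda>j. \<integral>\<^sup>+x. ennreal (\<bar>x j\<bar> ^ 3) \<partial>T) ` {..<p})"
    have m: "(\<integral>\<^sup>+x. ennreal (\<bar>x j\<bar> ^ 3) \<partial>T) \<le> m" if "j \<in> {..<p}" for j
      unfolding m_def using that by (intro Max_ge) auto
    have "(\<integral>\<^sup>+x. ennreal (\<bar>x j\<bar> * \<bar>x k\<bar> * \<bar>x l\<bar>) \<partial>T) \<le>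
        (\<integral>\<^sup>+x. ennreal (1/3) * (ennreal (\<bar>x j\<bar> ^ 3) + ennreal (\<bar>x k\<bar> ^ 3) + ennreal (\<bar>x l\<bar> ^ 3)) \<partial>T)"
      using abs_triple_product_le[of "\<bar>_\<bar>" "\<bar>_\<bar>" "\<bar>_\<bar>"]
      by (intro nn_integral_mono) (auto simp flip: ennreal_plus ennreal_mult intro!: ennreal_leI)
    also have "\<dots> = ennreal (1/3) * ((\<integral>\<^sup>+x. ennreal (\<bar>x j\<bar> ^ 3) \<partial>T) + (\<integral>\<^sup>+x. ennreal (\<bar>x k\<bar> ^ 3) \<partial>T)
        + (\<integral>\<^sup>+x. ennreal (\<bar>x l\<bar> ^ 3) \<partial>T))"
      by (simp add: nn_integral_cmult nn_integral_add)
    also have "\<dots> \<le> ennreal (1/3) * (m + m + m)"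
      using m j by (intro mult_left_mono add_mono) auto
    also have "m + m + m = (1 + 1 + 1) * m" by (simp only: distrib_right mult_1_left)
    also have "\<dots> = ennreal 3 * m" by simp
    also have "ennreal (1/3) * (ennreal 3 * m) = (ennreal (1/3) * ennreal 3) * m" by (simp only: mult.assoc)
    also have "ennreal (1/3) * ennreal 3 = 1" by (subst ennreal_mult[symmetric]) simp_all
    also have "1 * m = m" by simp
    finally show "(\<integral>\<^sup>+x. ennreal (\<bar>x j\<bar> * \<bar>x k\<bar> * \<bar>x l\<bar>) \<partial>T) \<le> m" .
  qed auto
  also have "\<dots> = ennreal (\<kappa> ^ 3 * exp C / 6 * (\<Sum>j<p. \<Sum>k<p. \<Sum>l<p. d j k l)) * Max ((\<lambda>j. \<integral>\<^sup>+x. ennreal (\<bar>x j\<bar> ^ 3) \<partial>T) ` {..<p})"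
    unfolding sum_distrib_left sum_distrib_right[symmetric]
    by (subst ennreal_sum3) (use d0 \<kappa> in auto)
  also have "\<dots> \<le> ennreal (\<kappa> ^ 3 * exp C / 6 * (C0 * (log_ep p)\<^sup>2 / \<epsilon> ^ 3) * measure W annulus) *
        Max ((\<lambda>j. \<integral>\<^sup>+x. ennreal (\<bar>x j\<bar> ^ 3) \<partial>T) ` {..<p})"
    using dsum \<kappa> unfolding mult.assoc[of _ "C0 * (log_ep p)\<^sup>2 / \<epsilon> ^ 3"]
    by (intro mult_right_mono ennreal_leI mult_left_mono) auto
  finally show ?thesis unfolding E_def by (simp add: add_left_mono)
qed

end


section \<open>Centered Gaussian laws and their rotation invariance\<close>

lemma prob_space_normal_law: "0 \<le> v \<Longrightarrow> prob_space (normal_law a v)"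
  by (auto simp: normal_law_def prob_space_return prob_space_normal_density)

lemma sets_normal_law [simp, measurable_cong]: "sets (normal_law a v) = sets borel"
  by (simp add: normal_law_def)

lemma return_0_convolution:
  assumes N: "finite_measure N" "sets N = sets borel"
  shows "return borel (0::real) \<star> N = N"
proof (rule measure_eqI)
  have [simp]: "finite_measure (return borel (0::real))"
    by (intro prob_space.finite_measure prob_space_return) simp
  have [measurable_cong]: "sets N = sets borel" by fact
  have spN: "space N = UNIV" using sets_eq_imp_space_eq[OF N(2)] by simp
  show "sets (return borel 0 \<star> N) = sets N" using N by simp
  fix A assume "A \<in> sets (return borel (0::real) \<star> N)"
  then have A[measurable]: "A \<in> sets borel" by simp
  interpret N: finite_measure N by fact
  have m: "(\<lambda>x. \<integral>\<^sup>+y. indicator A (x + y) \<partial>N) \<in> borel_measurable (borel :: real measure)"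
    by measurable
  have "emeasure (return borel 0 \<star> N) A = (\<integral>\<^sup>+x. \<integral>\<^sup>+y. indicator A (x + y) \<partial>N \<partial>return borel (0::real))"
    using N by (intro convolution_emeasure') auto
  also have "\<dots> = (\<integral>\<^sup>+y. indicator A y \<partial>N)"
    by (subst nn_integral_return) (use m in auto)
  finally show "emeasure (return borel 0 \<star> N) A = emeasure N A" using N by simp
qed

text \<open>The degenerate laws are included because coordinates of the \<open>Y i\<close> may have variance zero.\<close>

lemma normal_law_convolution:
  assumes "0 \<le> v" "0 \<le> w"
  shows "normal_law 0 v \<star> normal_law 0 w = normal_law 0 (v + w)"
proof (cases "v = 0 \<or> w = 0")
  case True
  have f: "finite_measure (normal_law 0 v)" "finite_measure (normal_law 0 w)"
    using assms by (auto intro: prob_space.finite_measure prob_space_normal_law)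
  from True show ?thesis
  proof
    assume "v = 0"
    then show ?thesis using return_0_convolution[OF f(2)] by (simp add: normal_law_def[of 0 0])
  next
    assume w: "w = 0"
    have "normal_law 0 v \<star> normal_law 0 w = (normal_law 0 w \<star> normal_law 0 v)"
      using f by (intro convolution_commutative) auto
    then show ?thesis using w return_0_convolution[OF f(1)] by (simp add: normal_law_def[of 0 0])
  qed
next
  case False
  then have pos: "0 < v" "0 < w" using assms by auto
  have "normal_law 0 v \<star> normal_law 0 w = density lborel (\<lambda>x. \<integral>\<^sup>+y. ennreal (normal_density 0 (sqrt v) (x - y)) * ennreal (normal_density 0 (sqrt w) y) \<partial>lborel)"
    using pos unfolding normal_law_def
    by (simp add: convolution_density prob_space_normal_density prob_space.finite_measure)
  also have "\<dots> = density lborel (\<lambda>x. \<integral>\<^sup>+y. ennreal (normal_density 0 (sqrt v) (x - y) * normal_density 0 (sqrt w) y) \<partial>lborel)"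
    by (simp add: ennreal_mult)
  also have "\<dots> = normal_law 0 (v + w)"
    using conv_normal_density_zero_mean[of "sqrt v" "sqrt w"] pos by (simp add: normal_law_def)
  finally show ?thesis .
qed

lemma normal_law_mgf:
  assumes "0 \<le> v"
  shows "(\<integral>\<^sup>+x. ennreal (exp (t * x)) \<partial>normal_law 0 v) = ennreal (exp (t\<^sup>2 * v / 2))"
proof (cases "v = 0")
  case True
  then show ?thesis by (simp add: normal_law_def nn_integral_return)
next
  case False
  then have v: "0 < v" using assms by simp
  have eq: "normal_density 0 (sqrt v) x * exp (t * x) = exp (t\<^sup>2 * v / 2) * normal_density (t * v) (sqrt v) x" for x
  proof -
    have "- x\<^sup>2 / (2 * v) + t * x = t\<^sup>2 * v / 2 + - (x - t * v)\<^sup>2 / (2 * v)"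
      using v by (simp add: field_simps power2_eq_square)
    then have "exp (- x\<^sup>2 / (2 * v)) * exp (t * x) = exp (t\<^sup>2 * v / 2) * exp (- (x - t * v)\<^sup>2 / (2 * v))"
      by (simp flip: exp_add)
    then show ?thesis using v unfolding normal_density_def by simp
  qed
  have "(\<integral>\<^sup>+x. ennreal (exp (t * x)) \<partial>normal_law 0 v)
      = (\<integral>\<^sup>+x. ennreal (exp (t\<^sup>2 * v / 2)) * ennreal (normal_density (t * v) (sqrt v) x) \<partial>lborel)"
    using False by (simp add: normal_law_def nn_integral_density eq flip: ennreal_mult)
  also have "\<dots> = ennreal (exp (t\<^sup>2 * v / 2)) * (\<integral>\<^sup>+x. ennreal (normal_density (t * v) (sqrt v) x) \<partial>lborel)"
    by (rule nn_integral_cmult) simp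
  also have "(\<integral>\<^sup>+x. ennreal (normal_density (t * v) (sqrt v) x) \<partial>lborel) = 1"
    using v by (subst nn_integral_eq_integral) auto
  finally show ?thesis by simp
qed

lemma normal_law_moments:
  assumes "0 \<le> v"
  shows "integrable (normal_law 0 v) (\<lambda>x. x\<^sup>2)" "(\<integral>x. x\<^sup>2 \<partial>normal_law 0 v) = v" "(\<integral>x. x \<partial>normal_law 0 v) = 0"
proof -
  have "integrable (normal_law 0 v) (\<lambda>x. x\<^sup>2) \<and> (\<integral>x. x\<^sup>2 \<partial>normal_law 0 v) = v \<and> (\<integral>x. x \<partial>normal_law 0 v) = 0"
  proof (cases "v = 0")
    case True
    have "integrable (return borel 0) (\<lambda>x::real. x\<^sup>2)"
      by (auto simp: integrable_iff_bounded nn_integral_return)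
    then show ?thesis using True by (simp add: normal_law_def integral_return)
  next
    case False
    then have v: "0 < sqrt v" "v > 0" using assms by auto
    show ?thesis
      using False v normal_moment_even[OF v(1), of 0 1] integral_normal_moment_nz_1[OF v(1), of 0]
      by (auto simp: normal_law_def integrable_real_density integral_real_density has_bochner_integral_iff
          integrable_density integral_density)
  qed
  then show "integrable (normal_law 0 v) (\<lambda>x. x\<^sup>2)" "(\<integral>x. x\<^sup>2 \<partial>normal_law 0 v) = v" "(\<integral>x. x \<partial>normal_law 0 v) = 0"
    by auto
qed

text \<open>\<open>S\<close> may be singular, so there need not be a density; the law is given by its linear projections.\<close>

locale gaussian_law = prob_space \<mu> for \<mu> :: "(nat \<Rightarrow> real) measure" +
  fixes p :: nat and S :: "nat \<Rightarrow> nat \<Rightarrow> real"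
  assumes p: "1 \<le> p" and sets_mu [measurable_cong]: "sets \<mu> = sets (Rvec p)"
    and psd: "\<And>a. 0 \<le> (\<Sum>j<p. \<Sum>k<p. a j * S j k * a k)"
    and proj: "\<And>a. distr \<mu> borel (\<lambda>y. \<Sum>j<p. a j * y j) = normal_law 0 (\<Sum>j<p. \<Sum>k<p. a j * S j k * a k)"
begin

definition quad_form where "quad_form a = (\<Sum>j<p. \<Sum>k<p. a j * S j k * a k)"

lemma coord_measurable [measurable]: "j < p \<Longrightarrow> (\<lambda>y. y j) \<in> borel_measurable \<mu>"
  unfolding measurable_cong_sets[OF sets_mu refl] by simp

lemma space_mu: "space \<mu> = space (Rvec p)" using sets_mu by (rule sets_eq_imp_space_eq)

lemma coord_law: "j < p \<Longrightarrow> distr \<mu> borel (\<lambda>y. y j) = normal_law 0 (S j j) \<and> 0 \<le> S j j"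
proof -
  assume j: "j < p"
  define a where "a i = (if i = j then 1 else 0 :: real)" for i
  have 1: "(\<Sum>i<p. a i * y i) = y j" for y
    using j by (simp add: a_def if_distrib[of "\<lambda>c. c * _"] cong: if_cong)
  have 2: "(\<Sum>i<p. \<Sum>k<p. a i * S i k * a k) = S j j"
    using j by (simp add: a_def if_distrib[of "\<lambda>c. c * _"] if_distrib[of "\<lambda>c. _ * c"] cong: if_cong)
  show ?thesis using proj[of a] psd[of a] unfolding 1 2 by simp
qed

lemma coord_mgf: "j < p \<Longrightarrow> (\<integral>\<^sup>+y. ennreal (exp (t * y j)) \<partial>\<mu>) = ennreal (exp (t\<^sup>2 * S j j / 2))"
proof -
  assume j: "j < p"
  have "(\<integral>\<^sup>+y. ennreal (exp (t * y j)) \<partial>\<mu>) = (\<integral>\<^sup>+x. ennreal (exp (t * x)) \<partial>distr \<mu> borel (\<lambda>y. y j))"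
    using j by (subst nn_integral_distr) auto
  then show ?thesis using coord_law[OF j] by (simp add: normal_law_mgf)
qed

text \<open>For an independent pair with the same Gaussian law, \<open>rot \<theta>\<close> and \<open>rot (\<theta> + pi / 2)\<close> again form such a pair.
  The curve runs from the second component at \<open>\<theta> = 0\<close> to the first at \<open>\<theta> = pi / 2\<close>.\<close>

definition rot :: "real \<Rightarrow> (nat \<Rightarrow> real) \<times> (nat \<Rightarrow> real) \<Rightarrow> nat \<Rightarrow> real" where
  "rot \<theta> z = (\<lambda>j\<in>{..<p}. sin \<theta> * fst z j + cos \<theta> * snd z j)"

lemma rot_measurable [measurable]: "rot \<theta> \<in> measurable (\<mu> \<Otimes>\<^sub>M \<mu>) (Rvec p)"
  unfolding rot_def by (rule measurable_restrict) measurable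

lemma pair_projection_law:
  "distr (\<mu> \<Otimes>\<^sub>M \<mu>) borel (\<lambda>z. (\<Sum>j<p. a j * fst z j) + (\<Sum>j<p. b j * snd z j)) = normal_law 0 (quad_form a + quad_form b)"
proof -
  interpret pp: pair_prob_space \<mu> \<mu> ..
  have "normal_law 0 (quad_form a + quad_form b) = (distr \<mu> borel (\<lambda>y. \<Sum>j<p. a j * y j) \<star> distr \<mu> borel (\<lambda>y. \<Sum>j<p. b j * y j))"
    unfolding proj quad_form_def by (rule normal_law_convolution[symmetric]) (rule psd)+
  also have "\<dots> = distr (\<mu> \<Otimes>\<^sub>M \<mu>) borel (\<lambda>z. (\<Sum>j<p. a j * fst z j) + (\<Sum>j<p. b j * snd z j))"
    unfolding convolution_def
    by (subst pair_measure_distr)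
      (auto simp: distr_distr comp_def case_prod_beta intro!: prob_space_imp_sigma_finite prob_space_distr)
  finally show ?thesis ..
qed

text \<open>By the Cramer-Wold device only linear combinations matter, and for these the cross terms of the two
  quadratic forms cancel.\<close>

lemma rotation_invariance:
  assumes [measurable]: "H \<in> borel_measurable (Rvec p \<Otimes>\<^sub>M Rvec p)"
  shows "(\<integral>\<^sup>+z. H (rot \<theta> z, rot (\<theta> + pi / 2) z) \<partial>(\<mu> \<Otimes>\<^sub>M \<mu>)) = (\<integral>\<^sup>+z. H z \<partial>(\<mu> \<Otimes>\<^sub>M \<mu>))"
proof -
  interpret pp: pair_prob_space \<mu> \<mu> ..
  define I where "I = {..<p} <+> {..<p}"
  define s c where "s = sin \<theta>" and "c = cos \<theta>"
  have sc: "s\<^sup>2 + c\<^sup>2 = 1" "s * s + c * c = 1" by (auto simp: s_def c_def simp flip: power2_eq_square)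
  define X where "X i z = (case i of Inl j \<Rightarrow> fst z j | Inr j \<Rightarrow> snd z j)" for i :: "nat + nat" and z :: "(nat \<Rightarrow> real) \<times> (nat \<Rightarrow> real)"
  define X' where "X' i z = (case i of Inl j \<Rightarrow> rot \<theta> z j | Inr j \<Rightarrow> rot (\<theta> + pi/2) z j)" for i :: "nat + nat" and z
  have X: "i \<in> I \<Longrightarrow> X i \<in> borel_measurable (\<mu> \<Otimes>\<^sub>M \<mu>)" for i
    unfolding I_def X_def by (auto simp: fun_eq_iff)
  have X': "i \<in> I \<Longrightarrow> X' i \<in> borel_measurable (\<mu> \<Otimes>\<^sub>M \<mu>)" for i
    unfolding I_def X'_def rot_def by auto
  have law: "distr (\<mu> \<Otimes>\<^sub>M \<mu>) (PiM I (\<lambda>_. borel)) (\<lambda>z. \<lambda>i\<in>I. X' i z) = distr (\<mu> \<Otimes>\<^sub>M \<mu>) (PiM I (\<lambda>_. borel)) (\<lambda>z. \<lambda>i\<in>I. X i z)"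
  proof (rule cramer_wold)
    fix a :: "nat + nat \<Rightarrow> real"
    define a1 a2 where "a1 j = a (Inl j)" and "a2 j = a (Inr j)" for j
    have "(\<Sum>i\<in>I. a i * X i z) = (\<Sum>j<p. a1 j * fst z j) + (\<Sum>j<p. a2 j * snd z j)" for z
      by (simp add: I_def sum.Plus X_def a1_def a2_def)
    moreover have "(\<Sum>i\<in>I. a i * X' i z) = (\<Sum>j<p. (s * a1 j + c * a2 j) * fst z j) + (\<Sum>j<p. (c * a1 j - s * a2 j) * snd z j)" for z
      by (simp add: I_def sum.Plus X'_def a1_def a2_def rot_def sin_add cos_add s_def c_def algebra_simps
          flip: sum.distrib sum_subtractf)
    moreover have "quad_form (\<lambda>j. s * a1 j + c * a2 j) + quad_form (\<lambda>j. c * a1 j - s * a2 j) = quad_form a1 + quad_form a2"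
    proof -
      have "(s * a1 j + c * a2 j) * S j k * (s * a1 k + c * a2 k) + (c * a1 j - s * a2 j) * S j k * (c * a1 k - s * a2 k)
         = (s * s + c * c) * (a1 j * S j k * a1 k + a2 j * S j k * a2 k)" for j k
        by (simp add: algebra_simps)
      then show ?thesis unfolding quad_form_def sc by (simp flip: sum.distrib)
    qed
    ultimately show "distr (\<mu> \<Otimes>\<^sub>M \<mu>) borel (\<lambda>x. \<Sum>i\<in>I. a i * X' i x) = distr (\<mu> \<Otimes>\<^sub>M \<mu>) borel (\<lambda>x. \<Sum>i\<in>I. a i * X i x)"
      by (simp add: pair_projection_law)
  qed (auto simp: I_def X X' pp.prob_space_axioms intro: X[unfolded I_def] X'[unfolded I_def])
  define H' where "H' x = H (\<lambda>j\<in>{..<p}. x (Inl j), \<lambda>j\<in>{..<p}. x (Inr j))" for x :: "nat + nat \<Rightarrow> real"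
  have H'[measurable]: "H' \<in> borel_measurable (PiM I (\<lambda>_. borel))"
  proof -
    have "(\<lambda>x. \<lambda>j\<in>{..<p}. x (Inl j)) \<in> measurable (PiM I (\<lambda>_. borel)) (Rvec p)"
      "(\<lambda>x. \<lambda>j\<in>{..<p}. x (Inr j)) \<in> measurable (PiM I (\<lambda>_. borel)) (Rvec p)"
      by (rule measurable_restrict, rule measurable_component_singleton, auto simp: I_def)+
    then show ?thesis unfolding H'_def by measurable
  qed
  have mX: "(\<lambda>z. \<lambda>i\<in>I. X i z) \<in> measurable (\<mu> \<Otimes>\<^sub>M \<mu>) (PiM I (\<lambda>_. borel))"
    "(\<lambda>z. \<lambda>i\<in>I. X' i z) \<in> measurable (\<mu> \<Otimes>\<^sub>M \<mu>) (PiM I (\<lambda>_. borel))"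
    using X X' by (auto intro!: measurable_restrict)
  have "(\<integral>\<^sup>+z. H' (\<lambda>i\<in>I. X' i z) \<partial>(\<mu> \<Otimes>\<^sub>M \<mu>)) = (\<integral>\<^sup>+z. H' (\<lambda>i\<in>I. X i z) \<partial>(\<mu> \<Otimes>\<^sub>M \<mu>))"
    using arg_cong[OF law, of "\<lambda>N. \<integral>\<^sup>+x. H' x \<partial>N"] mX by (simp add: nn_integral_distr)
  moreover have "H' (\<lambda>i\<in>I. X' i z) = H (rot \<theta> z, rot (\<theta> + pi / 2) z)" for z
    unfolding H'_def by (rule arg_cong[where f=H]) (auto simp: I_def X'_def rot_def fun_eq_iff)
  moreover have "(\<integral>\<^sup>+z. H' (\<lambda>i\<in>I. X i z) \<partial>(\<mu> \<Otimes>\<^sub>M \<mu>)) = (\<integral>\<^sup>+z. H z \<partial>(\<mu> \<Otimes>\<^sub>M \<mu>))"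
  proof (rule nn_integral_cong)
    fix z assume "z \<in> space (\<mu> \<Otimes>\<^sub>M \<mu>)"
    then have "fst z \<in> space (Rvec p)" "snd z \<in> space (Rvec p)"
      by (auto simp: space_pair_measure space_mu)
    then show "H' (\<lambda>i\<in>I. X i z) = H z"
      unfolding H'_def by (intro arg_cong[where f=H])
        (auto simp: I_def X_def fun_eq_iff prod_eq_iff Rvec_space_iff)
  qed
  ultimately show ?thesis by simp
qed

end


section \<open>Concentration of the norm of a Gaussian vector above its median\<close>

context gaussian_law
begin

lemma norm_measurable [measurable]: "linfnorm p \<in> borel_measurable \<mu>"
  unfolding measurable_cong_sets[OF sets_mu refl] by (rule linfnorm_measurable[OF p])

lemma norm_rot_measurable [measurable]: "(\<lambda>z. linfnorm p (rot \<theta> z)) \<in> borel_measurable (\<mu> \<Otimes>\<^sub>M \<mu>)"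
  by (rule measurable_compose[OF rot_measurable linfnorm_measurable[OF p]])

text \<open>Seen from its end point \<open>y\<close>, the step starts at \<open>cos h * y - sin h * y'\<close> with \<open>y'\<close> independent of \<open>y\<close>.
  If \<open>J\<close> is a coordinate where \<open>\<bar>y J\<bar>\<close> is the norm of \<open>y\<close>, the norm of the starting point is at
  least the modulus of its coordinate \<open>J\<close>. For fixed \<open>y\<close> this leaves a multiple of
  the one Gaussian variable \<open>y' J\<close>, so the dimension does not enter.\<close>

lemma small_rotation_mgf:
  assumes \<sigma>2: "\<And>j. j < p \<Longrightarrow> S j j \<le> \<sigma>2" and \<kappa>: "0 \<le> \<kappa>" and h: "0 \<le> sin h"
  shows "(\<integral>\<^sup>+z. ennreal (exp (\<kappa> * (linfnorm p (rot (\<theta> + h) z) - linfnorm p (rot \<theta> z)))) \<partial>(\<mu> \<Otimes>\<^sub>M \<mu>))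
    \<le> (\<integral>\<^sup>+y. ennreal (exp (\<kappa> * (1 - cos h) * linfnorm p y)) \<partial>\<mu>) * ennreal (exp ((\<kappa> * sin h)\<^sup>2 * \<sigma>2 / 2))"
proof -
  define H where "H z = ennreal (exp (\<kappa> * (linfnorm p (fst z) - linfnorm p (rot (h + pi/2) z))))"
    for z :: "(nat \<Rightarrow> real) \<times> (nat \<Rightarrow> real)"
  have rotm: "rot (h + pi/2) \<in> measurable (Rvec p \<Otimes>\<^sub>M Rvec p) (Rvec p)"
    unfolding rot_def by (rule measurable_restrict) measurable
  note [measurable] = linfnorm_measurable[OF p]
  have H1[measurable]: "H \<in> borel_measurable (Rvec p \<Otimes>\<^sub>M Rvec p)"
    unfolding H_def using measurable_compose[OF rotm linfnorm_measurable[OF p]] by measurable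
  have H2[measurable]: "H \<in> borel_measurable (\<mu> \<Otimes>\<^sub>M \<mu>)"
    using H1 measurable_cong_sets[OF sets_pair_measure_cong[OF sets_mu sets_mu] refl] by blast
  \<comment> \<open>The starting point is recovered from the end point and its independent companion.\<close>
  have rot_back: "rot (h + pi/2) (rot (\<theta> + h) z, rot (\<theta> + h + pi/2) z) = rot \<theta> z" for z
  proof
    fix j
    have "cos h * (sin (\<theta> + h) * a + cos (\<theta> + h) * b) - sin h * (cos (\<theta> + h) * a - sin (\<theta> + h) * b)
        = sin \<theta> * a + cos \<theta> * b" for a b
    proof -
      have "sin \<theta> = sin (\<theta> + h) * cos h - cos (\<theta> + h) * sin h" "cos \<theta> = cos (\<theta> + h) * cos h + sin (\<theta> + h) * sin h"
        using sin_diff[of "\<theta> + h" h] cos_diff[of "\<theta> + h" h] by simp_all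
      then show ?thesis by (simp only: ring_distribs mult_ac)
    qed
    from this[of "fst z j" "snd z j"]
    show "rot (h + pi/2) (rot (\<theta> + h) z, rot (\<theta> + h + pi/2) z) j = rot \<theta> z j"
      by (simp add: rot_def sin_add[of _ "pi/2"] cos_add[of _ "pi/2"])
  qed
  have "(\<integral>\<^sup>+z. ennreal (exp (\<kappa> * (linfnorm p (rot (\<theta> + h) z) - linfnorm p (rot \<theta> z)))) \<partial>(\<mu> \<Otimes>\<^sub>M \<mu>))
      = (\<integral>\<^sup>+z. H (rot (\<theta> + h) z, rot (\<theta> + h + pi/2) z) \<partial>(\<mu> \<Otimes>\<^sub>M \<mu>))"
    by (simp add: H_def rot_back)
  also have "\<dots> = (\<integral>\<^sup>+z. H z \<partial>(\<mu> \<Otimes>\<^sub>M \<mu>))" by (rule rotation_invariance[OF H1])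
  also have "\<dots> = (\<integral>\<^sup>+y. \<integral>\<^sup>+y'. H (y, y') \<partial>\<mu> \<partial>\<mu>)" by (rule nn_integral_fst[symmetric]) measurable
  also have "\<dots> \<le> (\<integral>\<^sup>+y. ennreal (exp (\<kappa> * (1 - cos h) * linfnorm p y)) * ennreal (exp ((\<kappa> * sin h)\<^sup>2 * \<sigma>2 / 2)) \<partial>\<mu>)"
  proof (rule nn_integral_mono)
    fix y
    obtain J where J: "J < p" "linfnorm p y = \<bar>y J\<bar>" using linfnorm_attained[OF p] by blast
    define s where "s = (if 0 \<le> y J then 1 else -1 :: real)"
    have s: "s * y J = linfnorm p y" "s\<^sup>2 = 1" "\<bar>s\<bar> = 1" using J by (auto simp: s_def)
    have le: "linfnorm p y - linfnorm p (rot (h + pi/2) (y, y')) \<le> (1 - cos h) * linfnorm p y + sin h * s * y' J" for y'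
    proof -
      have "s * (cos h * y J - sin h * y' J) \<le> \<bar>cos h * y J - sin h * y' J\<bar>"
        using abs_ge_self[of "s * (cos h * y J - sin h * y' J)"] s(3) by (simp add: abs_mult)
      also have "\<dots> \<le> linfnorm p (rot (h + pi/2) (y, y'))"
        using linfnorm_ge[OF J(1), of "rot (h + pi/2) (y, y')"] J(1)
        by (simp add: rot_def sin_add cos_add)
      finally show ?thesis unfolding s(1)[symmetric] by (simp add: algebra_simps)
    qed
    have "(\<integral>\<^sup>+y'. H (y, y') \<partial>\<mu>) \<le> (\<integral>\<^sup>+y'. ennreal (exp (\<kappa> * (1 - cos h) * linfnorm p y)) * ennreal (exp ((\<kappa> * sin h * s) * y' J)) \<partial>\<mu>)"
    proof (rule nn_integral_mono)
      fix y'
      have "\<kappa> * (linfnorm p y - linfnorm p (rot (h + pi/2) (y, y'))) \<le> \<kappa> * ((1 - cos h) * linfnorm p y + sin h * s * y' J)"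
        using le \<kappa> by (rule mult_left_mono)
      then show "H (y, y') \<le> ennreal (exp (\<kappa> * (1 - cos h) * linfnorm p y)) * ennreal (exp ((\<kappa> * sin h * s) * y' J))"
        unfolding H_def by (subst ennreal_mult[symmetric]) (auto intro!: ennreal_leI simp: algebra_simps simp flip: exp_add)
    qed
    also have "\<dots> = ennreal (exp (\<kappa> * (1 - cos h) * linfnorm p y)) * ennreal (exp ((\<kappa> * sin h * s)\<^sup>2 * S J J / 2))"
      using J(1) by (subst nn_integral_cmult) (simp_all add: coord_mgf)
    also have "\<dots> \<le> ennreal (exp (\<kappa> * (1 - cos h) * linfnorm p y)) * ennreal (exp ((\<kappa> * sin h)\<^sup>2 * \<sigma>2 / 2))"
      using \<sigma>2[OF J(1)] s(2) by (intro mult_left_mono ennreal_leI) (simp_all add: power_mult_distrib mult_left_mono)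
    finally show "(\<integral>\<^sup>+y'. H (y, y') \<partial>\<mu>) \<le> ennreal (exp (\<kappa> * (1 - cos h) * linfnorm p y)) * ennreal (exp ((\<kappa> * sin h)\<^sup>2 * \<sigma>2 / 2))" .
  qed
  also have "\<dots> = (\<integral>\<^sup>+y. ennreal (exp (\<kappa> * (1 - cos h) * linfnorm p y)) \<partial>\<mu>) * ennreal (exp ((\<kappa> * sin h)\<^sup>2 * \<sigma>2 / 2))"
    by (rule nn_integral_multc) measurable
  finally show ?thesis .
qed

lemma exp_norm_integrable: "(\<integral>\<^sup>+y. ennreal (exp (linfnorm p y)) \<partial>\<mu>) < \<infinity>"
proof -
  have "(\<integral>\<^sup>+y. ennreal (exp (linfnorm p y)) \<partial>\<mu>) \<le> (\<integral>\<^sup>+y. (\<Sum>j<p. ennreal (exp (1 * y j)) + ennreal (exp ((-1) * y j))) \<partial>\<mu>)"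
  proof (rule nn_integral_mono)
    fix y
    obtain J where J: "J < p" "linfnorm p y = \<bar>y J\<bar>" using linfnorm_attained[OF p] by blast
    have "ennreal (exp (linfnorm p y)) \<le> ennreal (exp (1 * y J)) + ennreal (exp ((-1) * y J))"
      unfolding J(2) by (cases "0 \<le> y J") (auto simp: add_increasing2 add_increasing)
    also have "\<dots> \<le> (\<Sum>j<p. ennreal (exp (1 * y j)) + ennreal (exp ((-1) * y j)))"
      using J(1) by (intro member_le_sum) auto
    finally show "ennreal (exp (linfnorm p y)) \<le> (\<Sum>j<p. ennreal (exp (1 * y j)) + ennreal (exp ((-1) * y j)))" .
  qed
  also have "\<dots> = (\<Sum>j<p. (\<integral>\<^sup>+y. ennreal (exp (1 * y j)) \<partial>\<mu>) + (\<integral>\<^sup>+y. ennreal (exp ((-1) * y j)) \<partial>\<mu>))"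
    by (subst nn_integral_sum) (auto simp: nn_integral_add)
  also have "\<dots> < \<infinity>"
  proof (subst infinity_ennreal_def, subst ennreal_sum_less_top[OF finite_lessThan], intro ballI)
    fix j assume "j \<in> {..<p}"
    then show "(\<integral>\<^sup>+y. ennreal (exp (1 * y j)) \<partial>\<mu>) + (\<integral>\<^sup>+y. ennreal (exp ((-1) * y j)) \<partial>\<mu>) < \<top>"
      by (subst (1 2) coord_mgf) (auto simp flip: ennreal_plus)
  qed
  finally show ?thesis .
qed

text \<open>The cost of the factors \<open>1 - cos h\<close>, which are quadratic in the step width, disappears in the limit of
  infinitely many steps.\<close>

lemma exp_norm_integral_tendsto_1:
  "(\<lambda>N. \<integral>\<^sup>+y. ennreal (exp (a / real (Suc N) * linfnorm p y)) \<partial>\<mu>) \<longlonglongrightarrow> 1" if a: "0 \<le> a" for a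
proof -
  obtain K :: nat where K: "a \<le> real (Suc K)" using real_arch_simple[of a] by (metis of_nat_Suc le_add_same_cancel1 order.trans zero_le_one add.commute)
  have "(\<lambda>N. \<integral>\<^sup>+y. ennreal (exp (a / real (Suc (N + K)) * linfnorm p y)) \<partial>\<mu>) \<longlonglongrightarrow> (\<integral>\<^sup>+y. 1 \<partial>\<mu>)"
  proof (rule nn_integral_dominated_convergence[where w="\<lambda>y. ennreal (exp (linfnorm p y))"])
    show "(\<integral>\<^sup>+y. ennreal (exp (linfnorm p y)) \<partial>\<mu>) < \<infinity>" by (rule exp_norm_integrable)
    show "AE y in \<mu>. ennreal (exp (a / real (Suc (N + K)) * linfnorm p y)) \<le> ennreal (exp (linfnorm p y))" for N
    proof (intro AE_I2 ennreal_leI)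
      fix y
      have "a / real (Suc (N + K)) \<le> 1" using K by (simp add: divide_le_eq)
      then show "exp (a / real (Suc (N + K)) * linfnorm p y) \<le> exp (linfnorm p y)"
        unfolding exp_le_cancel_iff by (rule mult_left_le_one_le[OF linfnorm_nonneg[OF p], rotated]) (use a in auto)
    qed
    show "AE y in \<mu>. (\<lambda>N. ennreal (exp (a / real (Suc (N + K)) * linfnorm p y))) \<longlonglongrightarrow> 1"
    proof (intro AE_I2)
      fix y
      have "(\<lambda>N. a / real (Suc N)) \<longlonglongrightarrow> 0" by (rule tendsto_divide_0[OF tendsto_const]) (rule filterlim_compose[OF filterlim_real_sequentially[THEN filterlim_at_top_imp_at_infinity] filterlim_Suc])
      then have "(\<lambda>N. a / real (Suc (N + K))) \<longlonglongrightarrow> 0" by (rule LIMSEQ_ignore_initial_segment[where f="\<lambda>N. a / real (Suc N)"])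
      then have "(\<lambda>N. ennreal (exp (a / real (Suc (N + K)) * linfnorm p y))) \<longlonglongrightarrow> ennreal (exp (0 * linfnorm p y))"
        by (intro tendsto_ennrealI tendsto_exp tendsto_mult_right)
      then show "(\<lambda>N. ennreal (exp (a / real (Suc (N + K)) * linfnorm p y))) \<longlonglongrightarrow> 1" by simp
    qed
  qed measurable
  then show ?thesis
    using LIMSEQ_offset[of "\<lambda>N. \<integral>\<^sup>+y. ennreal (exp (a / real (Suc N) * linfnorm p y)) \<partial>\<mu>" K] by (simp add: emeasure_space_1)
qed

text \<open>The increment over a quarter turn is the mean of \<open>N\<close> rescaled small increments; convexity of \<open>exp\<close>
  moves the mean outside, and \<open>N\<close> tends to infinity. The constant \<open>pi\<^sup>2 / 8\<close>
  that comes out is rounded up to \<open>2\<close>.\<close>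

lemma symmetrized_mgf:
  assumes \<sigma>2: "\<And>j. j < p \<Longrightarrow> S j j \<le> \<sigma>2" and \<tau>: "0 \<le> \<tau>"
  shows "(\<integral>\<^sup>+z. ennreal (exp (\<tau> * (linfnorm p (fst z) - linfnorm p (snd z)))) \<partial>(\<mu> \<Otimes>\<^sub>M \<mu>)) \<le> ennreal (exp (2 * \<tau>\<^sup>2 * \<sigma>2))"
    (is "?D \<le> _")
proof -
  have \<sigma>0: "0 \<le> \<sigma>2" using \<sigma>2[of 0] coord_law[of 0] p by auto
  have bound: "?D \<le> (\<integral>\<^sup>+y. ennreal (exp ((2 * \<tau>) / real (Suc n) * linfnorm p y)) \<partial>\<mu>) * ennreal (exp (2 * \<tau>\<^sup>2 * \<sigma>2))" for n
  proof -
    define N where "N = Suc n"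
    define h where "h = pi / 2 / real N"
    have N: "0 < real N" "1 \<le> real N" by (auto simp: N_def)
    have h0: "0 \<le> h" by (simp add: h_def)
    have h1: "h \<le> pi / 2" using N by (simp add: h_def divide_le_eq)
    have Nh: "real N * h = pi / 2" using N by (simp add: h_def)
    have sin0: "0 \<le> sin h" using h0 h1 by (intro sin_ge_zero) auto
    have sinh: "sin h \<le> h" using h0 by (rule sin_x_le_x)
    have pi4: "pi \<le> 4" using pi_less_4 by simp
    have cosh: "1 - cos h \<le> h\<^sup>2 / 2"
    proof -
      have "cos h = 1 - 2 * (sin (h/2))\<^sup>2" using cos_double_sin[of "h/2"] by simp
      moreover have "(sin (h/2))\<^sup>2 \<le> (h/2)\<^sup>2"
        using h0 h1 sin_x_le_x[of "h/2"] sin_ge_zero[of "h/2"] by (intro power_mono) auto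
      ultimately show ?thesis by (simp add: power_divide)
    qed
    have c1: "\<tau> * N * (1 - cos h) \<le> 2 * \<tau> / N"
    proof -
      have "real N * (1 - cos h) \<le> real N * (h\<^sup>2 / 2)" using cosh N by (intro mult_left_mono) auto
      also have "\<dots> = (pi / 2)\<^sup>2 / 2 / N" unfolding Nh[symmetric] using N by (simp add: power2_eq_square)
      also have "\<dots> \<le> 2 / N"
      proof -
        have "(pi/2)\<^sup>2 \<le> 2\<^sup>2" using pi4 by (intro power_mono) auto
        then show ?thesis using N by (intro divide_right_mono) auto
      qed
      finally show ?thesis using \<tau> mult_left_mono[of "N * (1 - cos h)" "2 / N" \<tau>] by (simp add: mult_ac)
    qed
    have s1: "(\<tau> * N * sin h)\<^sup>2 * \<sigma>2 / 2 \<le> 2 * \<tau>\<^sup>2 * \<sigma>2"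
    proof -
      have "real N * sin h \<le> 2" using mult_left_mono[OF sinh, of "real N"] Nh pi4 N by linarith
      then have "(real N * sin h)\<^sup>2 \<le> 2\<^sup>2" using sin0 by (intro power_mono) auto
      then have "\<tau>\<^sup>2 * (real N * sin h)\<^sup>2 \<le> \<tau>\<^sup>2 * 4" by (intro mult_left_mono) auto
      then have "\<tau>\<^sup>2 * (real N * sin h)\<^sup>2 * \<sigma>2 \<le> \<tau>\<^sup>2 * 4 * \<sigma>2" using \<sigma>0 by (rule mult_right_mono)
      then show ?thesis by (simp add: power_mult_distrib mult_ac)
    qed
    define \<Delta> where "\<Delta> k z = linfnorm p (rot (real k * h + h) z) - linfnorm p (rot (real k * h) z)" for k z
    have tele: "linfnorm p (fst z) - linfnorm p (snd z) = (\<Sum>k<N. \<Delta> k z)" if z: "z \<in> space (\<mu> \<Otimes>\<^sub>M \<mu>)" for z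
    proof -
      have "(\<Sum>k<N. \<Delta> k z) = (\<Sum>k<N. linfnorm p (rot (real (Suc k) * h) z) - linfnorm p (rot (real k * h) z))"
        by (simp add: \<Delta>_def distrib_right add.commute)
      also have "\<dots> = linfnorm p (rot (real N * h) z) - linfnorm p (rot (real 0 * h) z)"
        by (rule sum_lessThan_telescope[of "\<lambda>k. linfnorm p (rot (real k * h) z)"])
      also have "rot (real N * h) z = fst z"
        using z unfolding Nh by (auto simp: rot_def fun_eq_iff space_pair_measure space_mu Rvec_space_iff)
      also have "rot (real 0 * h) z = snd z"
        using z by (auto simp: rot_def fun_eq_iff space_pair_measure space_mu Rvec_space_iff)
      finally show ?thesis by simp
    qed
    have conv: "exp (\<tau> * (\<Sum>k<N. \<Delta> k z)) \<le> (\<Sum>k<N. 1 / N * exp (\<tau> * N * \<Delta> k z))" for z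
    proof -
      have "exp (\<Sum>k<N. (1 / real N) *\<^sub>R (\<tau> * N * \<Delta> k z)) \<le> (\<Sum>k<N. 1 / real N * exp (\<tau> * N * \<Delta> k z))"
        by (rule convex_on_sum[OF _ _ exp_convex]) (use N in \<open>auto simp: N_def\<close>)
      then show ?thesis using N by (simp add: sum_distrib_left)
    qed
    have "?D \<le> (\<integral>\<^sup>+z. (\<Sum>k<N. ennreal (1 / N) * ennreal (exp (\<tau> * N * \<Delta> k z))) \<partial>(\<mu> \<Otimes>\<^sub>M \<mu>))"
    proof (rule nn_integral_mono)
      fix z assume z: "z \<in> space (\<mu> \<Otimes>\<^sub>M \<mu>)"
      have "ennreal (exp (\<tau> * (linfnorm p (fst z) - linfnorm p (snd z)))) \<le> ennreal (\<Sum>k<N. 1 / N * exp (\<tau> * N * \<Delta> k z))"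
        using conv[of z] tele[OF z] by (intro ennreal_leI) simp
      also have "\<dots> = (\<Sum>k<N. ennreal (1 / N * exp (\<tau> * N * \<Delta> k z)))"
        by (rule sum_ennreal[symmetric]) auto
      also have "\<dots> = (\<Sum>k<N. ennreal (1 / N) * ennreal (exp (\<tau> * N * \<Delta> k z)))"
        by (intro sum.cong refl ennreal_mult) auto
      finally show "ennreal (exp (\<tau> * (linfnorm p (fst z) - linfnorm p (snd z)))) \<le> (\<Sum>k<N. ennreal (1 / N) * ennreal (exp (\<tau> * N * \<Delta> k z)))" .
    qed
    also have "\<dots> = (\<Sum>k<N. ennreal (1 / N) * (\<integral>\<^sup>+z. ennreal (exp (\<tau> * N * \<Delta> k z)) \<partial>(\<mu> \<Otimes>\<^sub>M \<mu>)))"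
      unfolding \<Delta>_def by (subst nn_integral_sum, measurable) (intro sum.cong refl nn_integral_cmult, measurable)
    also have "\<dots> \<le> (\<Sum>k<N. ennreal (1 / N) * ((\<integral>\<^sup>+y. ennreal (exp ((2 * \<tau>) / N * linfnorm p y)) \<partial>\<mu>) * ennreal (exp (2 * \<tau>\<^sup>2 * \<sigma>2))))"
    proof (intro sum_mono mult_left_mono)
      fix k
      have "(\<integral>\<^sup>+z. ennreal (exp (\<tau> * N * \<Delta> k z)) \<partial>(\<mu> \<Otimes>\<^sub>M \<mu>))
        \<le> (\<integral>\<^sup>+y. ennreal (exp (\<tau> * N * (1 - cos h) * linfnorm p y)) \<partial>\<mu>) * ennreal (exp ((\<tau> * N * sin h)\<^sup>2 * \<sigma>2 / 2))"
        unfolding \<Delta>_def using \<tau> sin0 by (intro small_rotation_mgf \<sigma>2) auto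
      also have "\<dots> \<le> (\<integral>\<^sup>+y. ennreal (exp ((2 * \<tau>) / N * linfnorm p y)) \<partial>\<mu>) * ennreal (exp (2 * \<tau>\<^sup>2 * \<sigma>2))"
        using s1 mult_right_mono[OF c1 linfnorm_nonneg[OF p]]
        by (intro mult_mono nn_integral_mono ennreal_leI) auto
      finally show "(\<integral>\<^sup>+z. ennreal (exp (\<tau> * N * \<Delta> k z)) \<partial>(\<mu> \<Otimes>\<^sub>M \<mu>))
        \<le> (\<integral>\<^sup>+y. ennreal (exp ((2 * \<tau>) / N * linfnorm p y)) \<partial>\<mu>) * ennreal (exp (2 * \<tau>\<^sup>2 * \<sigma>2))" .
    qed auto
    also have "\<dots> = (of_nat N * ennreal (1 / N)) * ((\<integral>\<^sup>+y. ennreal (exp ((2 * \<tau>) / N * linfnorm p y)) \<partial>\<mu>) * ennreal (exp (2 * \<tau>\<^sup>2 * \<sigma>2)))"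
      by (simp add: mult.assoc)
    also have "of_nat N * ennreal (1 / N) = 1"
      using N by (simp add: ennreal_of_nat_eq_real_of_nat flip: ennreal_mult)
    finally show ?thesis by (simp add: N_def)
  qed
  have "(\<lambda>n. (\<integral>\<^sup>+y. ennreal (exp ((2 * \<tau>) / real (Suc n) * linfnorm p y)) \<partial>\<mu>) * ennreal (exp (2 * \<tau>\<^sup>2 * \<sigma>2)))
     \<longlonglongrightarrow> 1 * ennreal (exp (2 * \<tau>\<^sup>2 * \<sigma>2))"
    using \<tau> by (intro tendsto_mult_ennreal exp_norm_integral_tendsto_1 tendsto_const) auto
  then have "?D \<le> 1 * ennreal (exp (2 * \<tau>\<^sup>2 * \<sigma>2))"
    by (rule LIMSEQ_le_const) (use bound in auto)
  then show ?thesis by simp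
qed

text \<open>One of two independent copies stays below the median with probability at least one half, so
  the symmetrized bound and Markov's inequality give a bound around the median.\<close>

lemma concentration_above_median:
  assumes \<sigma>2: "\<And>j. j < p \<Longrightarrow> S j j \<le> \<sigma>2" and \<tau>: "0 \<le> \<tau>"
    and med: "1/2 \<le> \<P>(y in \<mu>. linfnorm p y \<le> q)"
  shows "\<P>(y in \<mu>. linfnorm p y > q + u) \<le> 2 * exp (2 * \<tau>\<^sup>2 * \<sigma>2 - \<tau> * u)"
proof -
  define A B where "A = {y \<in> space \<mu>. linfnorm p y > q + u}" and "B = {y \<in> space \<mu>. linfnorm p y \<le> q}"
  have [measurable]: "A \<in> sets \<mu>" "B \<in> sets \<mu>" unfolding A_def B_def by measurable
  interpret pp: pair_prob_space \<mu> \<mu> ..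
  have "ennreal (exp (\<tau> * u)) * (emeasure \<mu> A * emeasure \<mu> B) = (\<integral>\<^sup>+z. ennreal (exp (\<tau> * u)) * indicator (A \<times> B) z \<partial>(\<mu> \<Otimes>\<^sub>M \<mu>))"
    by (simp add: nn_integral_cmult_indicator emeasure_pair_measure_Times)
  also have "\<dots> \<le> (\<integral>\<^sup>+z. ennreal (exp (\<tau> * (linfnorm p (fst z) - linfnorm p (snd z)))) \<partial>(\<mu> \<Otimes>\<^sub>M \<mu>))"
  proof (rule nn_integral_mono)
    fix z show "ennreal (exp (\<tau> * u)) * indicator (A \<times> B) z \<le> ennreal (exp (\<tau> * (linfnorm p (fst z) - linfnorm p (snd z))))"
      using \<tau> by (cases z) (auto simp: indicator_def A_def B_def intro!: ennreal_leI mult_left_mono)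
  qed
  also have "\<dots> \<le> ennreal (exp (2 * \<tau>\<^sup>2 * \<sigma>2))" by (rule symmetrized_mgf[OF \<sigma>2 \<tau>])
  finally have "exp (\<tau> * u) * (measure \<mu> A * measure \<mu> B) \<le> exp (2 * \<tau>\<^sup>2 * \<sigma>2)"
    by (simp add: emeasure_eq_measure flip: ennreal_mult)
  moreover have "exp (\<tau> * u) * (measure \<mu> A * (1/2)) \<le> exp (\<tau> * u) * (measure \<mu> A * measure \<mu> B)"
    using med unfolding B_def by (intro mult_left_mono) auto
  ultimately have "exp (\<tau> * u) * measure \<mu> A \<le> 2 * exp (2 * \<tau>\<^sup>2 * \<sigma>2)" by linarith
  then show ?thesis unfolding A_def[symmetric] exp_diff by (simp add: field_simps)
qed

end


section \<open>Medians, moments and tails of Gaussian vectors\<close>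

lemma exists_median:
  assumes "prob_space M" and Z: "Z \<in> borel_measurable M"
  shows "\<exists>q. is_median M Z q"
proof -
  interpret prob_space M by fact
  define D where "D = distr M borel Z"
  interpret D: prob_space D unfolding D_def using Z by (rule prob_space_distr)
  interpret D: real_distribution D
    by unfold_locales (simp_all add: D_def)
  define A where "A = {x. cdf D x \<ge> 1/2}"
  have ne: "A \<noteq> {}"
  proof -
    have "\<forall>\<^sub>F x in at_top. cdf D x > 1/2"
      using D.cdf_lim_at_top_prob by (rule order_tendstoD) simp
    then obtain x where "cdf D x > 1/2" by (auto simp: eventually_at_top_linorder)
    then show ?thesis by (auto simp: A_def intro!: exI[of _ x])
  qed
  have bdd: "bdd_below A"
  proof -
    have "\<forall>\<^sub>F x in at_bot. cdf D x < 1/2"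
      using D.cdf_lim_at_bot by (rule order_tendstoD) simp
    then obtain b where "\<And>x. x \<le> b \<Longrightarrow> cdf D x < 1/2" by (auto simp: eventually_at_bot_linorder)
    note b = this
    have "b \<le> x" if "x \<in> A" for x
      by (rule ccontr) (use that b[of x] in \<open>auto simp: A_def\<close>)
    then show ?thesis by (rule bdd_belowI)
  qed
  define q where "q = Inf A"
  have above: "cdf D x \<ge> 1/2" if gt: "x > q" for x
  proof -
    obtain y where "y \<in> A" "y < x" using cInf_lessD[OF ne, of x] gt unfolding q_def by blast
    then show ?thesis using D.cdf_nondecreasing[of y x] by (auto simp: A_def)
  qed
  have below: "cdf D x < 1/2" if "x < q" for x
    by (rule ccontr) (use cInf_lower[OF _ bdd, of x] that in \<open>auto simp: A_def q_def\<close>)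
  have "cdf D q \<ge> 1/2"
  proof (rule tendsto_lowerbound)
    show "(cdf D \<longlongrightarrow> cdf D q) (at_right q)"
      using D.cdf_is_right_cont[of q] by (simp add: continuous_within)
    show "\<forall>\<^sub>F x in at_right q. 1/2 \<le> cdf D x"
      using above by (auto simp: eventually_at_right_less eventually_at_filter)
  qed simp
  moreover have "measure D {..<q} \<le> 1/2"
  proof (rule tendsto_upperbound)
    show "(cdf D \<longlongrightarrow> measure D {..<q}) (at_left q)" by (rule D.cdf_at_left)
    show "\<forall>\<^sub>F x in at_left q. cdf D x \<le> 1/2"
      using below by (auto simp: eventually_at_filter less_imp_le)
  qed simp
  then have "measure D {q..} \<ge> 1/2"
  proof -
    have "UNIV - {..<q} = {q..}" by auto
    then have "measure D {q..} = 1 - measure D {..<q}"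
      using D.prob_compl[of "{..<q}"] by (simp add: D_def)
    then show ?thesis using \<open>measure D {..<q} \<le> 1/2\<close> by simp
  qed
  ultimately have "is_median M Z q"
    using Z by (simp add: is_median_def cdf_def D_def measure_distr vimage_def Int_def conj_commute)
  then show ?thesis ..
qed

lemma median_is_median:
  assumes "prob_space M" "Z \<in> borel_measurable M"
  shows "is_median M Z (median M Z)"
  unfolding median_def by (rule someI_ex[OF exists_median[OF assms]])

text \<open>The maximum of \<open>s powr q * exp (- s\<^sup>2 / (8 * \<sigma>\<^sup>2))\<close> over \<open>s\<close>, in the form \<open>ln w \<le> w - 1\<close>.\<close>

lemma exp_neg_square_le_powr:
  fixes q s \<sigma> :: real
  assumes q: "0 < q" and s: "0 < s" and \<sigma>: "0 < \<sigma>"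
  shows "exp (- (s\<^sup>2 / (8 * \<sigma>\<^sup>2))) \<le> (2 / s) powr q * (\<sigma> powr q * (q / exp 1) powr (q / 2))"
proof -
  define w where "w = s\<^sup>2 / (4 * q * \<sigma>\<^sup>2)"
  have w: "0 < w" using assms by (simp add: w_def)
  have "ln w \<le> w - 1" by (rule ln_le_minus_one[OF w])
  then have "q / 2 * ln w \<le> q / 2 * (w - 1)" using q by (intro mult_left_mono) auto
  also have "\<dots> = s\<^sup>2 / (8 * \<sigma>\<^sup>2) - q / 2" using q \<sigma> by (simp add: w_def field_simps)
  also have "ln w = 2 * ln s - (ln 4 + ln q + 2 * ln \<sigma>)"
    using assms by (simp add: w_def ln_div ln_mult ln_realpow)
  also have "ln (4::real) = 2 * ln 2" using ln_realpow[of 2 2] by simp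
  finally have "- (s\<^sup>2 / (8 * \<sigma>\<^sup>2)) \<le> q * ln (2 / s) + (q * ln \<sigma> + q / 2 * ln (q / exp 1))"
    using assms by (simp add: ln_div algebra_simps diff_divide_distrib)
  then have "exp (- (s\<^sup>2 / (8 * \<sigma>\<^sup>2))) \<le> exp (q * ln (2 / s) + (q * ln \<sigma> + q / 2 * ln (q / exp 1)))" by simp
  also have "\<dots> = (2 / s) powr q * (\<sigma> powr q * (q / exp 1) powr (q / 2))"
    using assms by (simp add: powr_def exp_add)
  finally show ?thesis .
qed

context gaussian_law
begin

lemma one_dimensional_tail:
  assumes p1: "p = 1" and \<sigma>2: "S 0 0 \<le> \<sigma>2" and \<tau>: "0 \<le> \<tau>"
  shows "\<P>(y in \<mu>. linfnorm p y > s) \<le> 2 * exp (2 * \<tau>\<^sup>2 * \<sigma>2 - \<tau> * s)"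
proof -
  define A where "A = {y \<in> space \<mu>. linfnorm p y > s}"
  have norm1: "linfnorm p y = \<bar>y 0\<bar>" for y using p1 by (simp add: linfnorm_def lessThan_Suc)
  have [measurable]: "A \<in> sets \<mu>" unfolding A_def by measurable
  have [measurable]: "(\<lambda>y. y 0) \<in> borel_measurable \<mu>" using p1 by (intro coord_measurable) auto
  have "ennreal (exp (\<tau> * s)) * emeasure \<mu> A = (\<integral>\<^sup>+y. ennreal (exp (\<tau> * s)) * indicator A y \<partial>\<mu>)"
    by (simp add: nn_integral_cmult_indicator)
  also have "\<dots> \<le> (\<integral>\<^sup>+y. ennreal (exp (\<tau> * y 0)) + ennreal (exp ((- \<tau>) * y 0)) \<partial>\<mu>)"
  proof (rule nn_integral_mono)
    fix y :: "nat \<Rightarrow> real"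
    have "exp (\<tau> * s) \<le> exp (\<tau> * y 0) + exp ((- \<tau>) * y 0)" if "\<bar>y 0\<bar> > s"
    proof (cases "0 \<le> y 0")
      case True
      then have "\<tau> * s \<le> \<tau> * y 0" using that \<tau> by (intro mult_left_mono) auto
      then show ?thesis by (simp add: add_increasing2)
    next
      case False
      then have "\<tau> * s \<le> \<tau> * (- y 0)" using that \<tau> by (intro mult_left_mono) auto
      then show ?thesis by (simp add: add_increasing)
    qed
    then show "ennreal (exp (\<tau> * s)) * indicator A y \<le> ennreal (exp (\<tau> * y 0)) + ennreal (exp ((- \<tau>) * y 0))"
      by (auto simp: indicator_def A_def norm1 simp flip: ennreal_plus intro!: ennreal_leI)
  qed
  also have "\<dots> = ennreal (exp (\<tau>\<^sup>2 * S 0 0 / 2)) + ennreal (exp ((- \<tau>)\<^sup>2 * S 0 0 / 2))"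
    using p1 coord_mgf[of 0 \<tau>] coord_mgf[of 0 "-\<tau>"] by (subst nn_integral_add) auto
  also have "\<dots> = ennreal (2 * exp (\<tau>\<^sup>2 * S 0 0 / 2))" by (simp flip: ennreal_plus)
  finally have "exp (\<tau> * s) * measure \<mu> A \<le> 2 * exp (\<tau>\<^sup>2 * S 0 0 / 2)"
    by (simp add: emeasure_eq_measure flip: ennreal_mult)
  also have "\<dots> \<le> 2 * exp (2 * \<tau>\<^sup>2 * \<sigma>2)"
  proof -
    have "\<tau>\<^sup>2 * S 0 0 \<le> \<tau>\<^sup>2 * \<sigma>2" "0 \<le> \<tau>\<^sup>2 * S 0 0"
      using \<sigma>2 coord_law[of 0] p1 by (auto intro: mult_left_mono)
    then show ?thesis by simp
  qed
  finally show ?thesis unfolding A_def[symmetric] exp_diff by (simp add: field_simps)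
qed

text \<open>The multiple \<open>2 * log_ep p - 1\<close> of \<open>s\<close> is as large as \<open>W_annulus_le\<close> permits. In dimension one it
  equals \<open>1\<close>, and the tail of a single normal variable is available; in higher dimension it is at
  least \<open>2\<close>, so that either \<open>s\<close> is at most twice the median and the bound is trivial, or the threshold
  exceeds the median by \<open>s\<close>.\<close>

lemma norm_tail:
  assumes \<sigma>2: "\<And>j. j < p \<Longrightarrow> S j j \<le> \<sigma>\<^sup>2" and \<sigma>: "0 \<le> \<sigma>"
    and med: "is_median \<mu> (linfnorm p) m" and q: "0 < q" and s: "0 < s"
  shows "\<P>(y in \<mu>. linfnorm p y > (2 * log_ep p - 1) * s)
    \<le> 5 * ((2 / s) powr q * (m powr q + \<sigma> powr q * (q / exp 1) powr (q / 2)))"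
proof -
  define Pr where "Pr = \<P>(y in \<mu>. linfnorm p y > (2 * log_ep p - 1) * s)"
  have m0: "0 \<le> m"
  proof (rule ccontr)
    assume "\<not> 0 \<le> m"
    then have "\<not> linfnorm p y \<le> m" for y using linfnorm_nonneg[OF p, of y] by linarith
    then have "{y \<in> space \<mu>. linfnorm p y \<le> m} = {}" by blast
    then have "\<P>(y in \<mu>. linfnorm p y \<le> m) = 0" by (simp only: measure_empty)
    then show False using med unfolding is_median_def by linarith
  qed
  show ?thesis
  proof (cases "s \<le> 2 * m")
    case True
    then have "1 \<le> (2 / s * m) powr q" using s q by (intro ge_one_powr_ge_zero) (auto simp: field_simps)
    also have "(2 / s * m) powr q = (2 / s) powr q * m powr q"
      by (rule powr_mult)
    finally have "1 \<le> (2 / s) powr q * m powr q" .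
    moreover have "0 \<le> (2 / s) powr q * (\<sigma> powr q * (q / exp 1) powr (q / 2))" by simp
    ultimately have "1 \<le> (2 / s) powr q * (m powr q + \<sigma> powr q * (q / exp 1) powr (q / 2))"
      unfolding distrib_left by linarith
    then show ?thesis
      using prob_le_1[of "{y \<in> space \<mu>. linfnorm p y > (2 * log_ep p - 1) * s}"] by linarith
  next
    case False
    have chernoff: "Pr \<le> 2 * exp (2 * \<tau>\<^sup>2 * \<sigma>\<^sup>2 - \<tau> * s)" if \<tau>: "0 \<le> \<tau>" for \<tau>
    proof (cases "p = 1")
      case True
      then have "2 * log_ep p - 1 = 1" by (simp add: log_ep_def)
      then show ?thesis using one_dimensional_tail[OF True _ \<tau>, of "\<sigma>\<^sup>2" s] \<sigma>2[of 0] p by (simp add: Pr_def)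
    next
      case False
      then have p2: "2 \<le> p" using p by simp
      have "ln 2 \<le> ln (real p)" using p2 by simp
      moreover have "log_ep p = 1 + ln (real p)" using p by (simp add: log_ep_def ln_mult)
      ultimately have "3 / 2 \<le> log_ep p" using ln2_ge_two_thirds by linarith
      then have "2 * s \<le> (2 * log_ep p - 1) * s" using s by (intro mult_right_mono) auto
      then have le: "m + s \<le> (2 * log_ep p - 1) * s" using \<open>\<not> s \<le> 2 * m\<close> m0 by linarith
      have "Pr \<le> \<P>(y in \<mu>. linfnorm p y > m + s)"
        unfolding Pr_def using le by (intro finite_measure_mono) auto
      also have "\<dots> \<le> 2 * exp (2 * \<tau>\<^sup>2 * \<sigma>\<^sup>2 - \<tau> * s)"
        using med by (intro concentration_above_median \<sigma>2 \<tau>) (auto simp: is_median_def)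
      finally show ?thesis .
    qed
    have "Pr \<le> 2 * ((2 / s) powr q * (\<sigma> powr q * (q / exp 1) powr (q / 2)))"
    proof (cases "\<sigma> = 0")
      case True
      have "((\<lambda>t::real. 2 * exp (- (t * s))) \<longlongrightarrow> 2 * 0) at_top"
      proof (intro tendsto_mult tendsto_const)
        have "filterlim (\<lambda>t. t * s) at_top at_top"
          using s by (intro filterlim_at_top_mult_tendsto_pos[OF tendsto_const _ filterlim_ident])
        then show "((\<lambda>t::real. exp (- (t * s))) \<longlongrightarrow> 0) at_top"
          by (intro filterlim_compose[OF exp_at_bot] filterlim_compose[OF filterlim_uminus_at_bot_at_top])
      qed
      moreover have "\<forall>\<^sub>F t in at_top. Pr \<le> 2 * exp (- (t * s))"
        using eventually_ge_at_top[of 0] by eventually_elim (use chernoff True in auto)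
      ultimately have "Pr \<le> 2 * 0" by (intro tendsto_lowerbound) auto
      then show ?thesis using True q by simp
    next
      case False
      then have \<sigma>: "0 < \<sigma>" using \<sigma> by simp
      \<comment> \<open>\<open>\<tau> = s / (4 * \<sigma>\<^sup>2)\<close> minimizes the exponent.\<close>
      have "Pr \<le> 2 * exp (2 * (s / (4 * \<sigma>\<^sup>2))\<^sup>2 * \<sigma>\<^sup>2 - s / (4 * \<sigma>\<^sup>2) * s)"
        using s by (intro chernoff) simp
      also have "2 * (s / (4 * \<sigma>\<^sup>2))\<^sup>2 * \<sigma>\<^sup>2 - s / (4 * \<sigma>\<^sup>2) * s = - (s\<^sup>2 / (8 * \<sigma>\<^sup>2))"
        using \<sigma> by (simp add: power2_eq_square field_simps)
      finally show ?thesis using exp_neg_square_le_powr[OF q s \<sigma>] by linarith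
    qed
    moreover have "0 \<le> (2 / s) powr q * m powr q" "0 \<le> (2 / s) powr q * (\<sigma> powr q * (q / exp 1) powr (q / 2))" by simp_all
    ultimately show ?thesis unfolding Pr_def distrib_left by linarith
  qed
qed

end

lemma gaussian_vector_law:
  assumes M: "prob_space M" and p: "1 \<le> p" and Y: "gaussian_vector M p Y S"
    and psd: "\<And>a. 0 \<le> (\<Sum>j<p. \<Sum>k<p. a j * S j k * a k)"
  shows "gaussian_law (distr M (Rvec p) Y) p S"
proof -
  interpret prob_space M by fact
  have m: "Y \<in> measurable M (Rvec p)" using Y by (simp add: gaussian_vector_def)
  show ?thesis
  proof (intro gaussian_law.intro gaussian_law_axioms.intro p psd)
    show "prob_space (distr M (Rvec p) Y)" by (rule prob_space_distr[OF m])
    fix a :: "nat \<Rightarrow> real"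
    have "distr (distr M (Rvec p) Y) borel (\<lambda>y. \<Sum>j<p. a j * y j) = distr M borel (\<lambda>\<omega>. \<Sum>j<p. a j * Y \<omega> j)"
      by (subst distr_distr[OF _ m]) (auto simp: comp_def)
    then show "distr (distr M (Rvec p) Y) borel (\<lambda>y. \<Sum>j<p. a j * y j) = normal_law 0 (\<Sum>j<p. \<Sum>k<p. a j * S j k * a k)"
      using Y by (simp add: gaussian_vector_def)
  qed simp
qed

lemma gaussian_vector_moments:
  assumes M: "prob_space M" and p: "1 \<le> p" and Y: "gaussian_vector M p Y S"
    and psd: "\<And>a. 0 \<le> (\<Sum>j<p. \<Sum>k<p. a j * S j k * a k)"
    and sym: "\<And>j k. S j k = S k j"
  shows "j < p \<Longrightarrow> integrable M (\<lambda>\<omega>. (Y \<omega> j)\<^sup>2)" "j < p \<Longrightarrow> (\<integral>\<omega>. Y \<omega> j \<partial>M) = 0"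
    "j < p \<Longrightarrow> k < p \<Longrightarrow> (\<integral>\<omega>. Y \<omega> j * Y \<omega> k \<partial>M) = S j k"
    "j < p \<Longrightarrow> Var M (\<lambda>\<omega>. Y \<omega> j) = S j j"
proof -
  interpret prob_space M by fact
  have m: "Y \<in> measurable M (Rvec p)" using Y by (simp add: gaussian_vector_def)
  have mj[measurable]: "j < p \<Longrightarrow> (\<lambda>\<omega>. Y \<omega> j) \<in> borel_measurable M" for j
    using measurable_compose[OF m measurable_component_singleton[of j "{..<p}" "\<lambda>_. borel"]] by simp
  have lin: "integrable M (\<lambda>\<omega>. (\<Sum>j<p. a j * Y \<omega> j)\<^sup>2) \<and> (\<integral>\<omega>. (\<Sum>j<p. a j * Y \<omega> j)\<^sup>2 \<partial>M) = (\<Sum>j<p. \<Sum>k<p. a j * S j k * a k)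
      \<and> (\<integral>\<omega>. (\<Sum>j<p. a j * Y \<omega> j) \<partial>M) = 0" for a
  proof -
    define w where "w = (\<Sum>j<p. \<Sum>k<p. a j * S j k * a k)"
    have mm: "(\<lambda>\<omega>. \<Sum>j<p. a j * Y \<omega> j) \<in> borel_measurable M" by measurable
    have d: "distr M borel (\<lambda>\<omega>. \<Sum>j<p. a j * Y \<omega> j) = normal_law 0 w" and w: "0 \<le> w"
      using Y psd by (auto simp: gaussian_vector_def w_def)
    show ?thesis
      using normal_law_moments[OF w] mm unfolding d[symmetric] w_def[symmetric]
      by (simp add: integrable_distr_eq integral_distr)
  qed
  have unit: "(\<Sum>i<p. (if i = j then 1 else 0) * Y \<omega> i) = Y \<omega> j" if "j < p" for j \<omega>
    using that by (simp add: if_distrib[of "\<lambda>c. c * _"] cong: if_cong)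
  have unit2: "(\<Sum>i<p. \<Sum>k<p. (if i = j then 1 else 0) * S i k * (if k = l then 1 else 0)) = S j l" if "j < p" "l < p" for j l
    using that by (simp add: if_distrib[of "\<lambda>c. c * _"] if_distrib[of "\<lambda>c. _ * c"] cong: if_cong)
  have sq: "integrable M (\<lambda>\<omega>. (Y \<omega> j)\<^sup>2)" and e2: "(\<integral>\<omega>. (Y \<omega> j)\<^sup>2 \<partial>M) = S j j" and e1: "(\<integral>\<omega>. Y \<omega> j \<partial>M) = 0" if "j < p" for j
    using lin[of "\<lambda>i. if i = j then 1 else 0"] that by (auto simp: unit unit2)
  show "j < p \<Longrightarrow> integrable M (\<lambda>\<omega>. (Y \<omega> j)\<^sup>2)" "j < p \<Longrightarrow> (\<integral>\<omega>. Y \<omega> j \<partial>M) = 0"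
    using sq e1 by auto
  show "j < p \<Longrightarrow> Var M (\<lambda>\<omega>. Y \<omega> j) = S j j" using e1 e2 by (simp add: Var_def)
  assume jk: "j < p" "k < p"
  have "(\<integral>\<omega>. (Y \<omega> j + Y \<omega> k)\<^sup>2 \<partial>M) = S j j + S j k + S k j + S k k"
  proof -
    have "(\<Sum>i<p. ((if i = j then 1 else 0) + (if i = k then 1 else 0)) * Y \<omega> i) = Y \<omega> j + Y \<omega> k" for \<omega>
      using jk by (simp add: distrib_right sum.distrib unit)
    moreover have "(\<Sum>i<p. \<Sum>l<p. ((if i = j then 1 else 0) + (if i = k then 1 else 0)) * S i l * ((if l = j then 1 else 0) + (if l = k then 1 else 0)))
      = S j j + S j k + S k j + S k k"
      using jk by (simp only: distrib_right distrib_left sum.distrib unit2)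
    ultimately show ?thesis
      using lin[of "\<lambda>i. (if i = j then 1 else 0) + (if i = k then 1 else 0)"] by simp
  qed
  moreover have "(\<integral>\<omega>. (Y \<omega> j + Y \<omega> k)\<^sup>2 \<partial>M) = S j j + 2 * (\<integral>\<omega>. Y \<omega> j * Y \<omega> k \<partial>M) + S k k"
  proof -
    have i: "integrable M (\<lambda>\<omega>. Y \<omega> j * Y \<omega> k)"
      by (rule integrable_mult_of_squares) (simp_all add: jk sq)
    have "(Y \<omega> j + Y \<omega> k)\<^sup>2 = (Y \<omega> j)\<^sup>2 + 2 * (Y \<omega> j * Y \<omega> k) + (Y \<omega> k)\<^sup>2" for \<omega>
      by (simp add: power2_eq_square algebra_simps)
    then show ?thesis using i sq[OF jk(1)] sq[OF jk(2)] e2[OF jk(1)] e2[OF jk(2)] by simp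
  qed
  ultimately show "(\<integral>\<omega>. Y \<omega> j * Y \<omega> k \<partial>M) = S j k" using sym[of k j] by simp
qed

lemma gaussian_vector_norm_tail:
  assumes M: "prob_space M" and p: "1 \<le> p" and Y: "gaussian_vector M p Y S"
    and psd: "\<And>a. 0 \<le> (\<Sum>j<p. \<Sum>k<p. a j * S j k * a k)"
    and sym: "\<And>j k. S j k = S k j" and q: "0 < q" and s: "0 < s"
  shows "\<P>(\<omega> in M. linfnorm p (Y \<omega>) > (2 * log_ep p - 1) * s)
    \<le> 5 * ((2 / s) powr q * (mu_i M p Y powr q + sigma_max M p Y powr q * (q / exp 1) powr (q / 2)))"
proof -
  interpret prob_space M by fact
  have m[measurable]: "Y \<in> measurable M (Rvec p)" using Y by (simp add: gaussian_vector_def)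
  note [measurable] = linfnorm_measurable[OF p]
  interpret G: gaussian_law "distr M (Rvec p) Y" p S by (rule gaussian_vector_law[OF M p Y psd])
  have distr: "measure (distr M (Rvec p) Y) {y \<in> space (distr M (Rvec p) Y). P (linfnorm p y)} = \<P>(\<omega> in M. P (linfnorm p (Y \<omega>)))"
    if [measurable]: "Measurable.pred borel P" for P
    using measurable_space[OF m] by (subst measure_distr[OF m]) (auto intro!: arg_cong[where f="measure M"])
  have med: "is_median (distr M (Rvec p) Y) (linfnorm p) (mu_i M p Y)"
    using median_is_median[OF M, of "\<lambda>\<omega>. linfnorm p (Y \<omega>)"] distr[of "\<lambda>x. x \<le> mu_i M p Y"] distr[of "\<lambda>x. x \<ge> mu_i M p Y"]
    by (simp add: is_median_def mu_i_def)
  have V: "(\<lambda>j. Var M (\<lambda>\<omega>. Y \<omega> j)) ` {..<p} = (\<lambda>j. S j j) ` {..<p}"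
    using gaussian_vector_moments(4)[OF M p Y psd sym] by (intro image_cong) auto
  have S0: "j < p \<Longrightarrow> 0 \<le> S j j" for j using G.coord_law by auto
  have sig: "S j j \<le> (sigma_max M p Y)\<^sup>2" if "j < p" for j
  proof -
    have "S j j \<le> Max ((\<lambda>j. S j j) ` {..<p})" using that by (intro Max_ge) auto
    then show ?thesis using S0[OF that] by (simp add: sigma_max_def V)
  qed
  have "0 \<le> sigma_max M p Y"
  proof -
    have "S 0 0 \<le> Max ((\<lambda>j. S j j) ` {..<p})" using p by (intro Max_ge) auto
    then have "0 \<le> Max ((\<lambda>j. S j j) ` {..<p})" using S0[of 0] p by linarith
    then show ?thesis unfolding sigma_max_def V by simp
  qed
  from G.norm_tail[OF sig this med q s] show ?thesis
    using distr[of "\<lambda>x. x > (2 * log_ep p - 1) * s"] by simp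
qed

lemma cov_psd:
  assumes M: "prob_space M" and X: "X \<in> measurable M (Rvec p)"
    and sq: "\<And>j. j < p \<Longrightarrow> integrable M (\<lambda>\<omega>. (X \<omega> j)\<^sup>2)"
  shows "0 \<le> (\<Sum>j<p. \<Sum>k<p. a j * cov M X j k * a k)"
proof -
  interpret prob_space M by fact
  have mj[measurable]: "j < p \<Longrightarrow> (\<lambda>\<omega>. X \<omega> j) \<in> borel_measurable M" for j
    using measurable_compose[OF X measurable_component_singleton[of j "{..<p}" "\<lambda>_. borel"]] by simp
  have i: "integrable M (\<lambda>\<omega>. X \<omega> j * X \<omega> k)" if jk: "j < p" "k < p" for j k
    by (rule integrable_mult_of_squares) (simp_all add: jk sq)
  have "(\<integral>\<omega>. (\<Sum>j<p. a j * X \<omega> j)\<^sup>2 \<partial>M) = (\<integral>\<omega>. (\<Sum>j<p. \<Sum>k<p. a j * a k * (X \<omega> j * X \<omega> k)) \<partial>M)"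
    by (simp add: power2_eq_square sum_product mult_ac)
  also have "\<dots> = (\<Sum>j<p. \<Sum>k<p. a j * a k * cov M X j k)"
    unfolding cov_def by (subst integral_sum2) (use i in auto)
  finally have "(\<Sum>j<p. \<Sum>k<p. a j * cov M X j k * a k) = (\<integral>\<omega>. (\<Sum>j<p. a j * X \<omega> j)\<^sup>2 \<partial>M)"
    by (simp add: mult_ac)
  then show ?thesis by simp
qed

lemma cov_sym: "cov M X j k = cov M X k j"
  by (simp add: cov_def mult.commute)


section \<open>Anti-concentration of the norm of a Gaussian vector\<close>

text \<open>A Gaussian vector is a Gaussian process on a finite set of indices, which is compact in the discrete
  metric and on which all paths are continuous. The indices are embedded into the reals and the law
  is transported to functions on them.\<close>

lemma anti_concentration_max_norm:
  fixes V :: "'a \<Rightarrow> nat \<Rightarrow> real"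
  assumes M: "prob_space M" and p: "1 \<le> p" and V: "V \<in> measurable M (Rvec p)"
    and lin: "\<And>a. \<exists>v\<ge>0. distr M borel (\<lambda>\<omega>. \<Sum>j<p. a j * V \<omega> j) = normal_law 0 v"
    and smin: "0 < sigma_min M p V" and AC: "anti_concentration_constant m \<theta>"
    and r: "0 \<le> r" and \<epsilon>: "0 \<le> \<epsilon>" and small: "1 < m \<Longrightarrow> 2 * \<epsilon> \<le> r"
  shows "rpow r m * \<P>(\<omega> in M. r - \<epsilon> \<le> linfnorm p (V \<omega>) \<and> linfnorm p (V \<omega>) \<le> r + \<epsilon>)
    \<le> AC_form \<theta> m (median M (\<lambda>\<omega>. linfnorm p (V \<omega>))) (sigma_max M p V) (sigma_min M p V) * \<epsilon>"
proof -
  interpret prob_space M by fact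
  define S where "S = real ` {..<p}"
  have S: "finite S" "S \<noteq> {}" using p by (auto simp: S_def lessThan_empty_iff)
  define T where "T \<omega> = (\<lambda>t\<in>S. V \<omega> (nat \<lfloor>t\<rfloor>))" for \<omega>
  define N where "N = distr M (PiM S (\<lambda>_. borel)) T"
  define Z where "Z t w = w t" for t :: real and w :: "real \<Rightarrow> real"
  define G where "G w = (SUP t\<in>S. \<bar>Z t w\<bar>)" for w
  define d where "d = (discrete_metric.dd :: real \<Rightarrow> real \<Rightarrow> real)"
  have Vj[measurable]: "j < p \<Longrightarrow> (\<lambda>\<omega>. V \<omega> j) \<in> borel_measurable M" for j
    using measurable_compose[OF V measurable_component_singleton[of j "{..<p}" "\<lambda>_. borel"]] by simp
  have T[measurable]: "T \<in> measurable M (PiM S (\<lambda>_. borel))"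
    unfolding T_def by (rule measurable_restrict) (auto simp: S_def)
  have N: "prob_space N" unfolding N_def by (rule prob_space_distr[OF T])
  have Zm: "Z t \<in> borel_measurable (PiM S (\<lambda>_. borel))" if "t \<in> S" for t
    unfolding Z_def using that by measurable
  have Gm[measurable]: "G \<in> borel_measurable (PiM S (\<lambda>_. borel))"
  proof -
    have "(\<lambda>w. Max ((\<lambda>t. \<bar>Z t w\<bar>) ` S)) \<in> borel_measurable (PiM S (\<lambda>_. borel))"
      using S Zm by (intro borel_measurable_Max) auto
    then show ?thesis using S by (simp add: G_def[abs_def] cSup_eq_Max)
  qed
  have GT: "G (T \<omega>) = linfnorm p (V \<omega>)" for \<omega>
    using S by (auto simp: G_def cSup_eq_Max linfnorm_def T_def Z_def S_def image_image intro!: arg_cong[where f=Max] image_cong)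
  have ZT: "Z (real j) (T \<omega>) = V \<omega> j" if "j < p" for j \<omega>
    using that by (simp add: Z_def T_def S_def)
  have meas: "measure N {w \<in> space N. P (G w)} = \<P>(\<omega> in M. P (linfnorm p (V \<omega>)))"
    if [measurable]: "Measurable.pred borel P" for P
  proof -
    have "{w \<in> space N. P (G w)} \<in> sets (PiM S (\<lambda>_. borel))" by (simp add: N_def)
    then show ?thesis
      unfolding N_def using measurable_space[OF T]
      by (subst measure_distr[OF T]) (auto simp: GT intro!: arg_cong[where f="measure M"])
  qed
  have med: "median N G = median M (\<lambda>\<omega>. linfnorm p (V \<omega>))"
  proof -
    have "is_median N G q = is_median M (\<lambda>\<omega>. linfnorm p (V \<omega>)) q" for q
      unfolding is_median_def using meas[of "\<lambda>x. x \<le> q"] meas[of "\<lambda>x. x \<ge> q"] by simp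
    then show ?thesis by (simp add: median_def)
  qed
  have var: "Var N (Z (real j)) = Var M (\<lambda>\<omega>. V \<omega> j)" if j: "j < p" for j
  proof -
    have jS: "real j \<in> S" using j by (simp add: S_def)
    have [measurable]: "Z (real j) \<in> borel_measurable (PiM S (\<lambda>_. borel))" by (rule Zm[OF jS])
    show ?thesis unfolding Var_def N_def
      by (subst (1 2) integral_distr[OF T]) (auto simp: ZT[OF j])
  qed
  have vars: "(\<lambda>t. Var N (Z t)) ` S = (\<lambda>j. Var M (\<lambda>\<omega>. V \<omega> j)) ` {..<p}"
    unfolding S_def image_image using var by (intro image_cong) auto
  have smax: "sqrt (SUP t\<in>S. Var N (Z t)) = sigma_max M p V" and smin': "sqrt (INF t\<in>S. Var N (Z t)) = sigma_min M p V"
    unfolding vars sigma_max_def sigma_min_def using p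
    by (simp_all add: cSup_eq_Max cInf_eq_Min lessThan_empty_iff)
  have MS: "Metric_space S d" unfolding d_def by (rule metric_M_dd)
  have top: "Metric_space.mtopology S d = discrete_topology S"
    unfolding d_def by (rule discrete_metric.mtopology_discrete_metric)
  have compact: "compact_space (Metric_space.mtopology S d)"
    unfolding top using S by (simp add: compact_space_discrete_topology)
  have cont: "sample_continuous N S d Z"
    unfolding sample_continuous_def top by simp
  have gauss: "centered_gaussian_process N S Z"
    unfolding centered_gaussian_process_def
  proof (intro conjI ballI allI impI)
    fix t assume "t \<in> S"
    then show "Z t \<in> borel_measurable N" using Zm by (simp add: N_def)
  next
    fix F and a :: "real \<Rightarrow> real" assume F: "finite F \<and> F \<subseteq> S"
    define J where "J = {j. j < p \<and> real j \<in> F}"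
    have FJ: "F = real ` J" "inj_on real J" "J \<subseteq> {..<p}"
      using F by (auto simp: J_def S_def inj_on_def)
    have "(\<Sum>t\<in>F. a t * Z t (T \<omega>)) = (\<Sum>j<p. (if j \<in> J then a (real j) else 0) * V \<omega> j)" for \<omega>
    proof -
      have "(\<Sum>t\<in>F. a t * Z t (T \<omega>)) = (\<Sum>j\<in>J. a (real j) * V \<omega> j)"
        unfolding FJ(1) by (subst sum.reindex[OF FJ(2)]) (auto intro!: sum.cong simp: ZT J_def)
      also have "\<dots> = (\<Sum>j<p. (if j \<in> J then a (real j) else 0) * V \<omega> j)"
        using FJ(3) by (intro sum.mono_neutral_cong_left) auto
      finally show ?thesis .
    qed
    moreover have "distr N borel (\<lambda>w. \<Sum>t\<in>F. a t * Z t w) = distr M borel (\<lambda>\<omega>. \<Sum>t\<in>F. a t * Z t (T \<omega>))"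
      unfolding N_def using Zm F by (subst distr_distr[OF _ T]) (auto simp: comp_def intro!: borel_measurable_sum)
    ultimately show "\<exists>v\<ge>0. distr N borel (\<lambda>w. \<Sum>t\<in>F. a t * Z t w) = normal_law 0 v"
      using lin[of "\<lambda>j. if j \<in> J then a (real j) else 0"] by simp
  qed
  have pos: "0 < (INF t\<in>S. Var N (Z t))"
    using smin unfolding smin'[symmetric] by simp
  have "rpow r m * measure N {w \<in> space N. r - \<epsilon> \<le> (SUP t\<in>S. \<bar>Z t w\<bar>) \<and> (SUP t\<in>S. \<bar>Z t w\<bar>) \<le> r + \<epsilon>}
      \<le> AC_form \<theta> m (median N (\<lambda>w. SUP t\<in>S. \<bar>Z t w\<bar>)) (sqrt (SUP t\<in>S. Var N (Z t))) (sqrt (INF t\<in>S. Var N (Z t))) * \<epsilon>"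
    using AC[unfolded anti_concentration_constant_def, rule_format, OF conjI[OF N conjI[OF MS conjI[OF S(2)
        conjI[OF compact conjI[OF gauss conjI[OF cont pos]]]]]] \<epsilon> r] small by blast
  then show ?thesis
    unfolding smax smin' using meas[of "\<lambda>x. r - \<epsilon> \<le> x \<and> x \<le> r + \<epsilon>"] med by (simp add: G_def[abs_def])
qed


section \<open>The interpolating sums\<close>

text \<open>The integral over the law of \<open>A\<close> is the inner one, as in \<open>lindeberg_step\<close>.\<close>

lemma (in prob_space) integral_indep_pair:
  fixes f :: "'b \<Rightarrow> 'b \<Rightarrow> real"
  assumes ind: "indep_var S A T B" and f: "(\<lambda>z. f (fst z) (snd z)) \<in> borel_measurable (S \<Otimes>\<^sub>M T)"
    and bound: "\<And>x y. \<bar>f x y\<bar> \<le> c"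
  shows "(\<integral>\<omega>. f (A \<omega>) (B \<omega>) \<partial>M) = (\<integral>y. (\<integral>x. f x y \<partial>distr M S A) \<partial>distr M T B)"
proof -
  have A: "random_variable S A" and B: "random_variable T B"
    and eq: "distr M S A \<Otimes>\<^sub>M distr M T B = distr M (S \<Otimes>\<^sub>M T) (\<lambda>x. (A x, B x))"
    using ind by (auto simp: indep_var_distribution_eq)
  interpret A: prob_space "distr M S A" by (rule prob_space_distr[OF A])
  interpret B: prob_space "distr M T B" by (rule prob_space_distr[OF B])
  interpret P: pair_prob_space "distr M S A" "distr M T B" ..
  have i: "integrable (distr M S A \<Otimes>\<^sub>M distr M T B) (\<lambda>z. f (fst z) (snd z))"
  proof (rule P.integrable_const_bound[where B=c])
    show "(\<lambda>z. f (fst z) (snd z)) \<in> borel_measurable (distr M S A \<Otimes>\<^sub>M distr M T B)"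
      using f by (simp cong: measurable_cong_sets sets_pair_measure_cong)
  qed (use bound in auto)
  have "(\<integral>y. (\<integral>x. f x y \<partial>distr M S A) \<partial>distr M T B) = (\<integral>z. f (fst z) (snd z) \<partial>(distr M S A \<Otimes>\<^sub>M distr M T B))"
    using P.integral_snd[of f] i by (simp add: case_prod_beta')
  also have "\<dots> = (\<integral>\<omega>. f (A \<omega>) (B \<omega>) \<partial>M)"
    unfolding eq using A B f by (subst integral_distr) auto
  finally show ?thesis ..
qed

lemma (in prob_space) sum_indep_normal_laws:
  fixes Z :: "'i \<Rightarrow> 'a \<Rightarrow> real"
  assumes I: "finite I" and ind: "indep_vars (\<lambda>_. borel) Z I"
    and law: "\<And>i. i \<in> I \<Longrightarrow> distr M borel (Z i) = normal_law 0 (v i)" and v: "\<And>i. i \<in> I \<Longrightarrow> 0 \<le> v i"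
  shows "distr M borel (\<lambda>\<omega>. \<Sum>i\<in>I. Z i \<omega>) = normal_law 0 (\<Sum>i\<in>I. v i)"
  using assms
proof (induction I rule: finite_induct)
  case empty
  then show ?case by (simp add: normal_law_def)
next
  case (insert i I)
  have ind': "indep_vars (\<lambda>_. borel) Z I" using insert.prems(1) by (rule indep_vars_subset) auto
  have rv: "random_variable borel (Z l)" if "l \<in> insert i I" for l
    using insert.prems(1) that by (auto simp: indep_vars_def)
  have "distr M borel (\<lambda>\<omega>. Z i \<omega> + (\<Sum>i\<in>I. Z i \<omega>)) = (distr M borel (Z i) \<star> distr M borel (\<lambda>\<omega>. \<Sum>i\<in>I. Z i \<omega>))"
    using insert.hyps insert.prems(1) rv
    by (intro sum_indep_random_variable indep_vars_sum borel_measurable_sum) auto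
  also have "\<dots> = normal_law 0 (v i + (\<Sum>i\<in>I. v i))"
    using insert ind' by (simp add: normal_law_convolution sum_nonneg)
  finally show ?case using insert by simp
qed

locale clt_setting = prob_space M for M :: "'a measure" +
  fixes p n :: nat and X Y :: "nat \<Rightarrow> 'a \<Rightarrow> nat \<Rightarrow> real"
  assumes p: "1 \<le> p" and n: "1 \<le> n"
    and X_meas: "\<And>i. i \<in> {1..n} \<Longrightarrow> X i \<in> measurable M (Rvec p)"
    and X_sq: "\<And>i j. i \<in> {1..n} \<Longrightarrow> j < p \<Longrightarrow> integrable M (\<lambda>\<omega>. (X i \<omega> j)\<^sup>2)"
    and X_mean: "\<And>i j. i \<in> {1..n} \<Longrightarrow> j < p \<Longrightarrow> (\<integral>\<omega>. X i \<omega> j \<partial>M) = 0"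
    and Y_gauss: "\<And>i. i \<in> {1..n} \<Longrightarrow> gaussian_vector M p (Y i) (cov M (X i))"
    and indep: "indep_vars (\<lambda>_. Rvec p) (case_sum X Y) ({1..n} <+> {1..n})"
begin

lemma Y_meas: "i \<in> {1..n} \<Longrightarrow> Y i \<in> measurable M (Rvec p)"
  using Y_gauss by (auto simp: gaussian_vector_def)

lemma psd: "i \<in> {1..n} \<Longrightarrow> 0 \<le> (\<Sum>j<p. \<Sum>k<p. a j * cov M (X i) j k * a k)"
  by (intro cov_psd prob_space_axioms X_meas X_sq)

lemma X_coord [measurable]: "i \<in> {1..n} \<Longrightarrow> j < p \<Longrightarrow> (\<lambda>\<omega>. X i \<omega> j) \<in> borel_measurable M"
  and Y_coord [measurable]: "i \<in> {1..n} \<Longrightarrow> j < p \<Longrightarrow> (\<lambda>\<omega>. Y i \<omega> j) \<in> borel_measurable M"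
  using measurable_compose[OF X_meas measurable_component_singleton[of j "{..<p}" "\<lambda>_. borel"]]
    measurable_compose[OF Y_meas measurable_component_singleton[of j "{..<p}" "\<lambda>_. borel"]] by auto

lemma U_meas: "k \<le> n \<Longrightarrow> U p n X Y k \<in> measurable M (Rvec p)"
  unfolding U_def by (rule measurable_restrict) (auto intro!: borel_measurable_divide borel_measurable_add borel_measurable_sum)

text \<open>The sum without its \<open>k\<close>-th summand: \<open>U k\<close> and \<open>U (k - 1)\<close> arise from it by adding
  \<open>X k / \<surd>n\<close> and \<open>Y k / \<surd>n\<close>.\<close>

definition W :: "nat \<Rightarrow> 'a \<Rightarrow> nat \<Rightarrow> real" where
  "W k \<omega> = (\<lambda>j\<in>{..<p}. ((\<Sum>i=1..k-1. X i \<omega> j) + (\<Sum>i=k+1..n. Y i \<omega> j)) / sqrt (real n))"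

lemma W_meas: "k \<in> {1..n} \<Longrightarrow> W k \<in> measurable M (Rvec p)"
  unfolding W_def by (rule measurable_restrict) (auto intro!: borel_measurable_divide borel_measurable_add borel_measurable_sum)

lemma U_eq_X:
  assumes k: "k \<in> {1..n}"
  shows "U p n X Y k \<omega> = add_scaled p (W k \<omega>) (1 / sqrt (real n)) (X k \<omega>)"
proof -
  have "(\<Sum>i=1..k. X i \<omega> j) = (\<Sum>i=1..k-1. X i \<omega> j) + X k \<omega> j" for j
    using k by (cases k) auto
  then show ?thesis unfolding U_def W_def add_scaled_def by (auto simp: fun_eq_iff add_divide_distrib)
qed

lemma U_eq_Y:
  assumes k: "k \<in> {1..n}"
  shows "U p n X Y (k - 1) \<omega> = add_scaled p (W k \<omega>) (1 / sqrt (real n)) (Y k \<omega>)"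
proof -
  have "{k-1+1..n} = insert k {k+1..n}" using k by auto
  then have "(\<Sum>i=k-1+1..n. Y i \<omega> j) = Y k \<omega> j + (\<Sum>i=k+1..n. Y i \<omega> j)" for j
    by (simp only: sum.insert finite_atLeastAtMost) simp
  then show ?thesis unfolding U_def W_def add_scaled_def by (auto simp: fun_eq_iff add_divide_distrib)
qed

lemma W_indep:
  assumes k: "k \<in> {1..n}" and a: "a \<in> {Inl k, Inr k}"
  shows "indep_var (Rvec p) (W k) (Rvec p) (case_sum X Y a)"
proof -
  define A where "A = {1..k-1} <+> {k+1..n}"
  have A: "A \<inter> {a} = {}" "A \<subseteq> {1..n} <+> {1..n}" "{a} \<subseteq> {1..n} <+> {1..n}"
    using k a by (auto simp: A_def)
  define g where "g w = (\<lambda>j\<in>{..<p}. ((\<Sum>i=1..k-1. w (Inl i) j) + (\<Sum>i=k+1..n. w (Inr i) j)) / sqrt (real n))"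
    for w :: "nat + nat \<Rightarrow> nat \<Rightarrow> real"
  have comp: "(\<lambda>w. w i j) \<in> borel_measurable (PiM A (\<lambda>_. Rvec p))" if "i \<in> A" "j < p" for i j
    using measurable_compose[OF measurable_component_singleton[of i A "\<lambda>_. Rvec p"]
        measurable_component_singleton[of j "{..<p}" "\<lambda>_. borel"]] that by simp
  have g: "g \<in> measurable (PiM A (\<lambda>_. Rvec p)) (Rvec p)"
    unfolding g_def
    by (rule measurable_restrict) (intro borel_measurable_divide borel_measurable_add borel_measurable_sum comp borel_measurable_const, auto simp: A_def)
  have h: "(\<lambda>w. w a) \<in> measurable (PiM {a} (\<lambda>_. Rvec p)) (Rvec p)" by simp
  have "indep_var (Rvec p) (g \<circ> (\<lambda>\<omega>. restrict (\<lambda>i. case_sum X Y i \<omega>) A)) (Rvec p) ((\<lambda>w. w a) \<circ> (\<lambda>\<omega>. restrict (\<lambda>i. case_sum X Y i \<omega>) {a}))"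
    by (rule indep_var_compose[OF indep_var_restrict[OF indep A] g h])
  moreover have "g \<circ> (\<lambda>\<omega>. restrict (\<lambda>i. case_sum X Y i \<omega>) A) = W k"
    by (auto simp: fun_eq_iff g_def W_def A_def intro!: arg_cong2[where f="(+)"] sum.cong)
  moreover have "(\<lambda>w. w a) \<circ> (\<lambda>\<omega>. restrict (\<lambda>i. case_sum X Y i \<omega>) {a}) = case_sum X Y a"
    by (auto simp: fun_eq_iff)
  ultimately show ?thesis by simp
qed

lemma U0_linear_law:
  "\<exists>v\<ge>0. distr M borel (\<lambda>\<omega>. \<Sum>j<p. a j * U p n X Y 0 \<omega> j) = normal_law 0 v"
proof -
  define b where "b j = a j / sqrt (real n)" for j
  define v where "v i = (\<Sum>j<p. \<Sum>k<p. b j * cov M (X i) j k * b k)" for i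
  define Z where "Z s \<omega> = (\<Sum>j<p. b j * case_sum X Y s \<omega> j)" for s and \<omega>
  have law: "distr M borel (Z (Inr i)) = normal_law 0 (v i)" "0 \<le> v i" if "i \<in> {1..n}" for i
    using Y_gauss[OF that] psd[OF that] by (auto simp: gaussian_vector_def Z_def[abs_def] v_def)
  define JR :: "(nat + nat) set" where "JR = Inr ` {1..n}"
  have "indep_vars (\<lambda>_. borel) Z JR"
  proof -
    have "indep_vars (\<lambda>_. Rvec p) (case_sum X Y) JR"
      using indep by (rule indep_vars_subset) (auto simp: JR_def)
    from indep_vars_compose2[OF this, of "\<lambda>_ w. \<Sum>j<p. b j * w j" "\<lambda>_. borel"]
    show ?thesis by (simp add: Z_def[abs_def])
  qed
  note ind = this
  have "distr M borel (\<lambda>\<omega>. \<Sum>s\<in>JR. Z s \<omega>) = normal_law 0 (\<Sum>s\<in>JR. v (projr s))"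
  proof -
    have "distr M borel (Z s) = normal_law 0 (v (projr s))" "0 \<le> v (projr s)" if "s \<in> JR" for s
      using that law unfolding JR_def by (elim imageE, simp only: sum.sel)+
    then show ?thesis
      by (intro sum_indep_normal_laws[OF _ ind]) (simp_all add: JR_def)
  qed
  moreover have "(\<Sum>s\<in>JR. Z s \<omega>) = (\<Sum>j<p. a j * U p n X Y 0 \<omega> j)" for \<omega>
  proof -
    have "(\<Sum>s\<in>JR. Z s \<omega>) = (\<Sum>i=1..n. \<Sum>j<p. b j * Y i \<omega> j)"
      unfolding JR_def by (subst sum.reindex) (auto simp: Z_def)
    also have "\<dots> = (\<Sum>j<p. \<Sum>i=1..n. b j * Y i \<omega> j)" by (rule sum.swap)
    also have "\<dots> = (\<Sum>j<p. a j * U p n X Y 0 \<omega> j)"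
      by (intro sum.cong refl) (simp add: U_def b_def sum_distrib_left sum_divide_distrib)
    finally show ?thesis .
  qed
  ultimately show ?thesis
    by (intro exI[of _ "\<Sum>s\<in>JR. v (projr s)"]) (auto intro!: sum_nonneg simp: law JR_def simp del: One_nat_def)
qed

lemma anti_concentration_U0:
  assumes "0 < sigma_min M p (U p n X Y 0)" "anti_concentration_constant m (\<Theta> m)"
    and "0 \<le> r" "0 \<le> \<epsilon>" "1 < m \<Longrightarrow> 2 * \<epsilon> \<le> r"
  shows "rpow r m * \<P>(\<omega> in M. r - \<epsilon> \<le> linfnorm p (U p n X Y 0 \<omega>) \<and> linfnorm p (U p n X Y 0 \<omega>) \<le> r + \<epsilon>)
    \<le> Phi_AC M p n X Y \<Theta> m * \<epsilon>"
  unfolding Phi_AC_def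
  by (rule anti_concentration_max_norm[OF prob_space_axioms p U_meas U0_linear_law assms]) simp_all

lemma lindeberg_swap:
  fixes r \<epsilon> C0 C :: real
  assumes sm: "smoothing p f f1 f2 f3 r \<epsilon> C0 C D1 D2 D3" and k: "k \<in> {1..n}"
  shows "ennreal \<bar>(\<integral>\<omega>. f (U p n X Y k \<omega>) \<partial>M) - (\<integral>\<omega>. f (U p n X Y (k - 1) \<omega>) \<partial>M)\<bar> \<le>
     ennreal (C0 * log_ep p / (n * \<epsilon>\<^sup>2)) *
        (\<integral>\<^sup>+x. ennreal ((linfnorm p x)\<^sup>2) * indicator {x. linfnorm p x \<ge> sqrt (real n) * \<epsilon> / log_ep p} x \<partial>abs_zeta M p (X k) (Y k))
     + ennreal (exp C * C0 * (log_ep p)\<^sup>2 / (6 * (n * sqrt n) * \<epsilon> ^ 3) *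
          \<P>(\<omega> in M. r - \<epsilon> / log_ep p \<le> linfnorm p (W k \<omega>) \<and> linfnorm p (W k \<omega>) \<le> r + \<epsilon> + \<epsilon> / log_ep p)) *
        third_pseudo_moment M p (X k) (Y k)"
proof -
  interpret smoothing p f f1 f2 f3 r \<epsilon> C0 C D1 D2 D3 by fact
  define \<kappa> where "\<kappa> = 1 / sqrt (real n)"
  have n0: "0 < real n" using n by simp
  have \<kappa>: "0 < \<kappa>" using n0 by (simp add: \<kappa>_def)
  have \<kappa>2: "\<kappa>\<^sup>2 = 1 / n" "\<kappa> ^ 3 = 1 / (n * sqrt n)" using n0 by (simp_all add: \<kappa>_def power2_eq_square power3_eq_cube)
  define PW PX PY where "PW = distr M (Rvec p) (W k)" and "PX = distr M (Rvec p) (X k)" and "PY = distr M (Rvec p) (Y k)"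
  note mX = X_meas[OF k] and mY = Y_meas[OF k] and mW = W_meas[OF k]
  have fm: "(\<lambda>z. f (add_scaled p (fst z) \<kappa> (snd z))) \<in> borel_measurable (Rvec p \<Otimes>\<^sub>M Rvec p)"
    by (rule measurable_compose[OF add_scaled_measurable measurable_f(1)])
  have fb: "\<bar>f (add_scaled p x t y)\<bar> \<le> 1" for x t y by (rule f01) simp
  have EX: "(\<integral>\<omega>. f (U p n X Y k \<omega>) \<partial>M) = (\<integral>x. (\<integral>w. f (add_scaled p w \<kappa> x) \<partial>PW) \<partial>PX)"
    using integral_indep_pair[OF W_indep[OF k, of "Inl k"], of "\<lambda>w x. f (add_scaled p w \<kappa> x)" 1] fm fb
    by (simp add: U_eq_X[OF k] \<kappa>_def PW_def PX_def)
  have EY: "(\<integral>\<omega>. f (U p n X Y (k - 1) \<omega>) \<partial>M) = (\<integral>x. (\<integral>w. f (add_scaled p w \<kappa> x) \<partial>PW) \<partial>PY)"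
    using integral_indep_pair[OF W_indep[OF k, of "Inr k"], of "\<lambda>w x. f (add_scaled p w \<kappa> x)" 1] fm fb
    by (simp only: U_eq_Y[OF k] \<kappa>_def PW_def PY_def) simp
  have Ymom: "j < p \<Longrightarrow> integrable M (\<lambda>\<omega>. (Y k \<omega> j)\<^sup>2)" "j < p \<Longrightarrow> (\<integral>\<omega>. Y k \<omega> j \<partial>M) = 0"
    "j < p \<Longrightarrow> l < p \<Longrightarrow> (\<integral>\<omega>. Y k \<omega> j * Y k \<omega> l \<partial>M) = cov M (X k) j l" for j l
    using gaussian_vector_moments[OF prob_space_axioms p Y_gauss[OF k] psd[OF k] cov_sym] by auto
  have step: "ennreal \<bar>(\<integral>x. (\<integral>w. f (add_scaled p w \<kappa> x) \<partial>PW) \<partial>PX) - (\<integral>x. (\<integral>w. f (add_scaled p w \<kappa> x) \<partial>PW) \<partial>PY)\<bar> \<le>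
     ennreal (\<kappa>\<^sup>2 * (C0 * log_ep p / \<epsilon>\<^sup>2)) *
        (\<integral>\<^sup>+x. ennreal ((linfnorm p x)\<^sup>2) * indicator {x. linfnorm p x \<ge> \<epsilon> / (\<kappa> * log_ep p)} x \<partial>tv_measure (Rvec p) (zeta M (X k) (Y k)))
     + ennreal (\<kappa> ^ 3 * exp C / 6 * (C0 * (log_ep p)\<^sup>2 / \<epsilon> ^ 3) * measure PW annulus) *
        Max ((\<lambda>j. \<integral>\<^sup>+x. ennreal (\<bar>x j\<bar> ^ 3) \<partial>tv_measure (Rvec p) (zeta M (X k) (Y k))) ` {..<p})"
  proof (rule lindeberg_step)
    show "prob_space PW" "prob_space PX" "prob_space PY"
      unfolding PW_def PX_def PY_def by (rule prob_space_distr, fact)+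
    show "sets PW = sets (Rvec p)" "sets PX = sets (Rvec p)" "sets PY = sets (Rvec p)"
      by (simp_all add: PW_def PX_def PY_def)
    fix A assume "A \<in> sets (Rvec p)"
    then show "zeta M (X k) (Y k) A = measure PX A - measure PY A"
      unfolding PX_def PY_def zeta_def
      by (subst (1 2) measure_distr) (auto simp: mX mY vimage_def Int_def conj_commute)
  next
    fix j assume j: "j < p"
    show "integrable PX (\<lambda>x. (x j)\<^sup>2)" using X_sq[OF k j] j by (simp add: PX_def integrable_distr_eq[OF mX])
    show "integrable PY (\<lambda>x. (x j)\<^sup>2)" using Ymom(1)[OF j] j by (simp add: PY_def integrable_distr_eq[OF mY])
    show "(\<integral>x. x j \<partial>PX) = (\<integral>x. x j \<partial>PY)"
      using X_mean[OF k j] Ymom(2)[OF j] j by (simp add: PX_def PY_def integral_distr[OF mX] integral_distr[OF mY])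
    fix l assume l: "l < p"
    show "(\<integral>x. x j * x l \<partial>PX) = (\<integral>x. x j * x l \<partial>PY)"
      using Ymom(3)[OF j l] j l by (simp add: PX_def PY_def integral_distr[OF mX] integral_distr[OF mY] cov_def)
  qed fact
  have thr: "\<epsilon> / (\<kappa> * log_ep p) = sqrt (real n) * \<epsilon> / log_ep p" by (simp add: \<kappa>_def)
  have c1: "\<kappa>\<^sup>2 * (C0 * log_ep p / \<epsilon>\<^sup>2) = C0 * log_ep p / (n * \<epsilon>\<^sup>2)" by (simp add: \<kappa>2)
  have c2: "\<kappa> ^ 3 * exp C / 6 * (C0 * (log_ep p)\<^sup>2 / \<epsilon> ^ 3) = exp C * C0 * (log_ep p)\<^sup>2 / (6 * (n * sqrt n) * \<epsilon> ^ 3)"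
    by (simp add: \<kappa>2)
  have ann: "measure PW annulus = \<P>(\<omega> in M. r - \<epsilon> / log_ep p \<le> linfnorm p (W k \<omega>) \<and> linfnorm p (W k \<omega>) \<le> r + \<epsilon> + \<epsilon> / log_ep p)"
    unfolding PW_def using measurable_space[OF mW]
    by (subst measure_distr[OF mW annulus_sets]) (auto simp: annulus_def intro!: arg_cong[where f="measure M"])
  show ?thesis
    using step unfolding EX EY thr c1 c2 ann abs_zeta_def third_pseudo_moment_def .
qed

text \<open>The annulus has already been widened by \<open>\<epsilon> / log(ep)\<close> in the Taylor step; the truncation level of
  \<open>Y k / \<surd>n\<close> is \<open>(2 * log(ep) - 1) * \<epsilon> / log(ep)\<close>, so that the total widening is \<open>2 * \<epsilon>\<close>.\<close>

lemma W_annulus_le: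
  assumes k: "k \<in> {1..n}" and \<epsilon>: "0 < \<epsilon>"
  shows "\<P>(\<omega> in M. a - \<epsilon> / log_ep p \<le> linfnorm p (W k \<omega>) \<and> linfnorm p (W k \<omega>) \<le> b + \<epsilon> / log_ep p)
    \<le> \<P>(\<omega> in M. a - 2 * \<epsilon> \<le> linfnorm p (U p n X Y (k - 1) \<omega>) \<and> linfnorm p (U p n X Y (k - 1) \<omega>) \<le> b + 2 * \<epsilon>)
      + \<P>(\<omega> in M. linfnorm p (Y k \<omega>) > (2 * log_ep p - 1) * (sqrt (real n) * \<epsilon> / log_ep p))"
    (is "measure M ?A \<le> measure M ?B + measure M ?D")
proof -
  have [measurable]: "(\<lambda>\<omega>. linfnorm p (W k \<omega>)) \<in> borel_measurable M" "(\<lambda>\<omega>. linfnorm p (Y k \<omega>)) \<in> borel_measurable M"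
    "(\<lambda>\<omega>. linfnorm p (U p n X Y (k - 1) \<omega>)) \<in> borel_measurable M"
    using k by (auto intro!: measurable_compose[OF _ linfnorm_measurable[OF p]] W_meas Y_meas U_meas)
  have lg: "1 \<le> log_ep p" by (rule log_ep_ge_1[OF p])
  have n0: "0 < sqrt (real n)" using n by simp
  have BD: "?B \<in> sets M" "?D \<in> sets M" by measurable
  have "?A \<subseteq> ?B \<union> ?D"
  proof
    fix \<omega> assume A: "\<omega> \<in> ?A"
    show "\<omega> \<in> ?B \<union> ?D"
    proof (cases "\<omega> \<in> ?D")
      case False
      define y where "y = (\<lambda>i\<in>{..<p}. 1 / sqrt (real n) * Y k \<omega> i)"
      have U: "U p n X Y (k - 1) \<omega> j = W k \<omega> j + y j" if "j < p" for j
        unfolding U_eq_Y[OF k] using that by (simp add: add_scaled_def y_def)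
      have "linfnorm p (Y k \<omega>) \<le> (2 * log_ep p - 1) * (sqrt (real n) * \<epsilon> / log_ep p)" using False A by auto
      then have ny: "linfnorm p y \<le> 2 * \<epsilon> - \<epsilon> / log_ep p"
        using n0 lg unfolding y_def linfnorm_scale[OF p] by (simp add: field_simps)
      have 1: "linfnorm p (U p n X Y (k - 1) \<omega>) \<le> linfnorm p (W k \<omega>) + linfnorm p y"
        by (rule linfnorm_triangle[OF p U])
      have "linfnorm p (W k \<omega>) \<le> linfnorm p (U p n X Y (k - 1) \<omega>) + linfnorm p (\<lambda>i\<in>{..<p}. (-1) * y i)"
        by (rule linfnorm_triangle[OF p]) (simp add: U del: One_nat_def)
      then have 2: "linfnorm p (W k \<omega>) \<le> linfnorm p (U p n X Y (k - 1) \<omega>) + linfnorm p y"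
        unfolding linfnorm_scale[OF p] by simp
      show ?thesis using A 1 2 ny by auto
    qed simp
  qed
  then have "measure M ?A \<le> measure M (?B \<union> ?D)" using BD by (intro finite_measure_mono sets.Un)
  also have "\<dots> \<le> measure M ?B + measure M ?D" using BD by (intro measure_Un_le)
  finally show ?thesis .
qed

end


section \<open>Comparison of distribution functions\<close>

context clt_setting
begin

definition normU :: "nat \<Rightarrow> 'a \<Rightarrow> real" where
  "normU k \<omega> = linfnorm p (U p n X Y k \<omega>)"

lemma normU_meas [measurable]: "k \<le> n \<Longrightarrow> normU k \<in> borel_measurable M"
  unfolding normU_def by (rule measurable_compose[OF U_meas linfnorm_measurable[OF p]])

lemma normU_nonneg: "0 \<le> normU k \<omega>"
  unfolding normU_def by (rule linfnorm_nonneg[OF p])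

text \<open>Both smoothed indicators that will be needed, with \<open>r0 = r\<close> and \<open>r0 = r - \<epsilon>\<close>, lead to the same window
  of half-width \<open>3 * \<epsilon>\<close> around \<open>r\<close>.\<close>

lemma smooth_difference_le:
  fixes m2 l3 :: "nat \<Rightarrow> real" and \<epsilon> C0 C r r0 :: real
  assumes sm: "smoothing p f f1 f2 f3 r0 \<epsilon> C0 C D1 D2 D3" and r0: "r - \<epsilon> \<le> r0" "r0 \<le> r"
    and m2: "\<And>i. i \<in> {1..n} \<Longrightarrow> (\<integral>\<^sup>+x. ennreal ((linfnorm p x)\<^sup>2) *
         indicator {x. linfnorm p x \<ge> sqrt (real n) * \<epsilon> / log_ep p} x \<partial>abs_zeta M p (X i) (Y i)) = ennreal (m2 i)"
    and l3: "\<And>i. i \<in> {1..n} \<Longrightarrow> third_pseudo_moment M p (X i) (Y i) = ennreal (l3 i)"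
    and nn: "\<And>i. 0 \<le> m2 i" "\<And>i. 0 \<le> l3 i" and k: "k \<le> n"
  defines "A \<equiv> C0 * log_ep p / (n * \<epsilon>\<^sup>2)"
    and "\<alpha> \<equiv> exp C * C0 * (log_ep p)\<^sup>2 / (6 * (n * sqrt n) * \<epsilon> ^ 3)"
  shows "\<bar>(\<integral>\<omega>. f (U p n X Y k \<omega>) \<partial>M) - (\<integral>\<omega>. f (U p n X Y 0 \<omega>) \<partial>M)\<bar> \<le>
    (\<Sum>i=1..k. A * m2 i + \<alpha> * l3 i * (\<P>(\<omega> in M. r - 3 * \<epsilon> \<le> normU (i - 1) \<omega> \<and> normU (i - 1) \<omega> \<le> r + 3 * \<epsilon>)
      + \<P>(\<omega> in M. linfnorm p (Y i \<omega>) > (2 * log_ep p - 1) * (sqrt (real n) * \<epsilon> / log_ep p))))"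
  using k
proof (induction k)
  case 0
  then show ?case by simp
next
  case (Suc k)
  interpret smoothing p f f1 f2 f3 r0 \<epsilon> C0 C D1 D2 D3 by fact
  have lg: "1 \<le> log_ep p" by (rule log_ep_ge_1[OF p])
  have A: "0 \<le> A" and \<alpha>: "0 \<le> \<alpha>" using C0 lg eps by (auto simp: A_def \<alpha>_def)
  define i where "i = Suc k"
  have i: "i \<in> {1..n}" "i - 1 = k" using Suc.prems by (auto simp: i_def)
  define w where "w = \<P>(\<omega> in M. r0 - \<epsilon> / log_ep p \<le> linfnorm p (W i \<omega>) \<and> linfnorm p (W i \<omega>) \<le> r0 + \<epsilon> + \<epsilon> / log_ep p)"
  define T where "T = \<P>(\<omega> in M. linfnorm p (Y i \<omega>) > (2 * log_ep p - 1) * (sqrt (real n) * \<epsilon> / log_ep p))"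
  define Q where "Q = \<P>(\<omega> in M. r - 3 * \<epsilon> \<le> normU k \<omega> \<and> normU k \<omega> \<le> r + 3 * \<epsilon>)"
  have w: "w \<le> Q + T"
  proof -
    have "w \<le> \<P>(\<omega> in M. r0 - 2 * \<epsilon> \<le> normU k \<omega> \<and> normU k \<omega> \<le> r0 + \<epsilon> + 2 * \<epsilon>) + T"
      using W_annulus_le[OF i(1) eps, of r0 "r0 + \<epsilon>"] by (simp only: w_def T_def normU_def i(2))
    also have "\<P>(\<omega> in M. r0 - 2 * \<epsilon> \<le> normU k \<omega> \<and> normU k \<omega> \<le> r0 + \<epsilon> + 2 * \<epsilon>) \<le> Q"
    proof -
      have [measurable]: "normU k \<in> borel_measurable M" using Suc.prems by simp
      show ?thesis unfolding Q_def using r0 by (intro finite_measure_mono) auto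
    qed
    finally show ?thesis by simp
  qed
  have "ennreal \<bar>(\<integral>\<omega>. f (U p n X Y i \<omega>) \<partial>M) - (\<integral>\<omega>. f (U p n X Y k \<omega>) \<partial>M)\<bar>
      \<le> ennreal A * ennreal (m2 i) + ennreal (\<alpha> * w) * ennreal (l3 i)"
    using lindeberg_swap[OF sm i(1)] by (simp only: m2[OF i(1)] l3[OF i(1)] A_def \<alpha>_def w_def i(2))
  also have "\<dots> = ennreal (A * m2 i + \<alpha> * w * l3 i)"
    using A \<alpha> nn by (simp add: ennreal_mult w_def)
  finally have "\<bar>(\<integral>\<omega>. f (U p n X Y i \<omega>) \<partial>M) - (\<integral>\<omega>. f (U p n X Y k \<omega>) \<partial>M)\<bar> \<le> A * m2 i + \<alpha> * w * l3 i"
    using A \<alpha> nn by (subst (asm) ennreal_le_iff) (auto simp: w_def)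
  also have "\<dots> \<le> A * m2 i + \<alpha> * l3 i * (Q + T)"
    using mult_left_mono[OF w, of "\<alpha> * l3 i"] \<alpha> nn by (simp add: mult_ac)
  finally have step: "\<bar>(\<integral>\<omega>. f (U p n X Y (Suc k) \<omega>) \<partial>M) - (\<integral>\<omega>. f (U p n X Y k \<omega>) \<partial>M)\<bar> \<le> A * m2 (Suc k) + \<alpha> * l3 (Suc k) * (Q + T)"
    by (simp only: i_def)
  show ?case
    using Suc.IH Suc.prems step unfolding T_def Q_def i_def by simp
qed

text \<open>The ball of radius \<open>r\<close> is sandwiched between the smoothed indicators started at \<open>r - \<epsilon>\<close> and at \<open>r\<close>;
  passing from the radii \<open>r - \<epsilon>\<close> and \<open>r + \<epsilon>\<close> back to \<open>r\<close> costs the probability of a window for \<open>U 0\<close>. When \<open>r < \<epsilon>\<close> there is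
  no inner smoothing, but then the whole ball lies in that window.\<close>

lemma probability_difference_le:
  fixes m2 l3 :: "nat \<Rightarrow> real" and \<epsilon> C0 C r :: real
  assumes sc: "smoothing_constants C0 C" and eps: "0 < \<epsilon>" and r: "0 \<le> r"
    and m2: "\<And>i. i \<in> {1..n} \<Longrightarrow> (\<integral>\<^sup>+x. ennreal ((linfnorm p x)\<^sup>2) *
         indicator {x. linfnorm p x \<ge> sqrt (real n) * \<epsilon> / log_ep p} x \<partial>abs_zeta M p (X i) (Y i)) = ennreal (m2 i)"
    and l3: "\<And>i. i \<in> {1..n} \<Longrightarrow> third_pseudo_moment M p (X i) (Y i) = ennreal (l3 i)"
    and nn: "\<And>i. 0 \<le> m2 i" "\<And>i. 0 \<le> l3 i" and k: "k \<le> n"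
  defines "A \<equiv> C0 * log_ep p / (n * \<epsilon>\<^sup>2)"
    and "\<alpha> \<equiv> exp C * C0 * (log_ep p)\<^sup>2 / (6 * (n * sqrt n) * \<epsilon> ^ 3)"
  shows "\<bar>\<P>(\<omega> in M. normU k \<omega> \<le> r) - \<P>(\<omega> in M. normU 0 \<omega> \<le> r)\<bar> \<le>
    \<P>(\<omega> in M. r - \<epsilon> \<le> normU 0 \<omega> \<and> normU 0 \<omega> \<le> r + \<epsilon>) +
    (\<Sum>i=1..n. A * m2 i + \<alpha> * l3 i * (\<P>(\<omega> in M. r - 3 * \<epsilon> \<le> normU (i - 1) \<omega> \<and> normU (i - 1) \<omega> \<le> r + 3 * \<epsilon>)
      + \<P>(\<omega> in M. linfnorm p (Y i \<omega>) > (2 * log_ep p - 1) * (sqrt (real n) * \<epsilon> / log_ep p))))"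
    (is "_ \<le> ?R + sum ?B _")
proof -
  have [measurable]: "normU k \<in> borel_measurable M" "normU 0 \<in> borel_measurable M" using k by auto
  define Pr where "Pr l x = \<P>(\<omega> in M. normU l \<omega> \<le> x)" for l x
  have lg: "1 \<le> log_ep p" by (rule log_ep_ge_1[OF p])
  have C0: "0 < C0" using sc by (simp add: smoothing_constants_def)
  have B0: "0 \<le> ?B i" for i using C0 lg eps nn by (auto simp: A_def \<alpha>_def intro!: add_nonneg_nonneg)
  have Bk: "(\<Sum>i=1..k. ?B i) \<le> (\<Sum>i=1..n. ?B i)"
    using k B0 by (intro sum_mono2) auto
  have sandwich: "Pr l r0 \<le> (\<integral>\<omega>. f (U p n X Y l \<omega>) \<partial>M) \<and> (\<integral>\<omega>. f (U p n X Y l \<omega>) \<partial>M) \<le> Pr l (r0 + \<epsilon>)"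
    if sm: "smoothing p f f1 f2 f3 r0 \<epsilon> C0 C D1 D2 D3" and l: "l \<le> n" for f f1 f2 f3 r0 D1 D2 D3 l
  proof -
    interpret smoothing p f f1 f2 f3 r0 \<epsilon> C0 C D1 D2 D3 by fact
    note mU = U_meas[OF l]
    have sp: "\<omega> \<in> space M \<Longrightarrow> U p n X Y l \<omega> \<in> space (Rvec p)" for \<omega> using measurable_space[OF mU] .
    have [measurable]: "normU l \<in> borel_measurable M" using l by simp
    have fi: "integrable M (\<lambda>\<omega>. f (U p n X Y l \<omega>))"
      using f01 sp measurable_compose[OF mU measurable_f(1)] by (intro integrable_const_bound[where B=1]) auto
    have ii: "integrable M (\<lambda>\<omega>. indicator {\<omega> \<in> space M. normU l \<omega> \<le> x} \<omega> :: real)" for x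
      by (rule integrable_real_indicator) (auto simp: emeasure_eq_measure)
    have "Pr l x = (\<integral>\<omega>. indicator {\<omega> \<in> space M. normU l \<omega> \<le> x} \<omega> \<partial>M)" for x
      unfolding Pr_def by simp
    moreover have "(\<integral>\<omega>. indicator {\<omega> \<in> space M. normU l \<omega> \<le> r0} \<omega> \<partial>M) \<le> (\<integral>\<omega>. f (U p n X Y l \<omega>) \<partial>M)"
    proof (rule integral_mono[OF ii fi])
      fix \<omega> assume "\<omega> \<in> space M"
      then show "indicator {\<omega> \<in> space M. normU l \<omega> \<le> r0} \<omega> \<le> f (U p n X Y l \<omega>)"
        using sandwich[OF sp, of \<omega>] by (auto simp: indicator_def normU_def)
    qed
    moreover have "(\<integral>\<omega>. f (U p n X Y l \<omega>) \<partial>M) \<le> (\<integral>\<omega>. indicator {\<omega> \<in> space M. normU l \<omega> \<le> r0 + \<epsilon>} \<omega> \<partial>M)"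
    proof (rule integral_mono[OF fi ii])
      fix \<omega> assume "\<omega> \<in> space M"
      then show "f (U p n X Y l \<omega>) \<le> indicator {\<omega> \<in> space M. normU l \<omega> \<le> r0 + \<epsilon>} \<omega>"
        using sandwich[OF sp, of \<omega>] by (auto simp: indicator_def normU_def split: if_splits)
    qed
    ultimately show ?thesis by metis
  qed
  have gap: "Pr 0 y - Pr 0 x \<le> ?R" if "r - \<epsilon> \<le> x" "x \<le> y" "y \<le> r + \<epsilon>" for x y
  proof -
    have "Pr 0 y \<le> measure M ({\<omega> \<in> space M. normU 0 \<omega> \<le> x} \<union> {\<omega> \<in> space M. r - \<epsilon> \<le> normU 0 \<omega> \<and> normU 0 \<omega> \<le> r + \<epsilon>})"
      unfolding Pr_def using that by (intro finite_measure_mono) auto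
    also have "\<dots> \<le> Pr 0 x + ?R" unfolding Pr_def by (intro measure_Un_le) measurable
    finally show ?thesis by simp
  qed
  have upper: "Pr k r - Pr 0 r \<le> ?R + (\<Sum>i=1..n. ?B i)"
  proof -
    obtain f f1 f2 f3 D1 D2 D3 where sm: "smoothing p f f1 f2 f3 r \<epsilon> C0 C D1 D2 D3"
      by (rule obtain_smoothing[OF sc p r eps])
    have "\<bar>(\<integral>\<omega>. f (U p n X Y k \<omega>) \<partial>M) - (\<integral>\<omega>. f (U p n X Y 0 \<omega>) \<partial>M)\<bar> \<le> (\<Sum>i=1..k. ?B i)"
      unfolding A_def \<alpha>_def
      by (rule smooth_difference_le[OF sm _ _ m2 l3 nn k]) (use eps in auto)
    then show ?thesis
      using sandwich[OF sm, of k] sandwich[OF sm, of 0] k Bk gap[of r "r + \<epsilon>"] eps by fastforce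
  qed
  have lower: "Pr 0 r - Pr k r \<le> ?R + (\<Sum>i=1..n. ?B i)"
  proof (cases "\<epsilon> \<le> r")
    case True
    obtain f f1 f2 f3 D1 D2 D3 where sm: "smoothing p f f1 f2 f3 (r - \<epsilon>) \<epsilon> C0 C D1 D2 D3"
      by (rule obtain_smoothing[OF sc p _ eps, of "r - \<epsilon>"]) (use True in auto)
    have "\<bar>(\<integral>\<omega>. f (U p n X Y k \<omega>) \<partial>M) - (\<integral>\<omega>. f (U p n X Y 0 \<omega>) \<partial>M)\<bar> \<le> (\<Sum>i=1..k. ?B i)"
      unfolding A_def \<alpha>_def
      by (rule smooth_difference_le[OF sm _ _ m2 l3 nn k]) (use eps in auto)
    then show ?thesis
      using sandwich[OF sm, of k] sandwich[OF sm, of 0] k Bk gap[of "r - \<epsilon>" r] eps by fastforce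
  next
    case False
    have "Pr 0 (r - \<epsilon>) = 0"
    proof -
      have "r - \<epsilon> < normU 0 \<omega>" for \<omega> using False normU_nonneg[of 0 \<omega>] by linarith
      then have "{\<omega> \<in> space M. normU 0 \<omega> \<le> r - \<epsilon>} = {}" by (auto simp: not_le)
      then show ?thesis unfolding Pr_def by (simp only: measure_empty)
    qed
    moreover have "0 \<le> Pr k r" by (simp add: Pr_def)
    moreover have "0 \<le> (\<Sum>i=1..n. ?B i)" using B0 by (intro sum_nonneg) auto
    ultimately show ?thesis using gap[of "r - \<epsilon>" r] eps by linarith
  qed
  show ?thesis using upper lower unfolding Pr_def by linarith
qed

end


section \<open>The self-improving inequality\<close>

lemma (in prob_space) prob_window_le:
  assumes [measurable]: "N \<in> borel_measurable M" "N0 \<in> borel_measurable M" and ab: "a \<le> b"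
  shows "\<P>(\<omega> in M. a \<le> N \<omega> \<and> N \<omega> \<le> b) \<le> \<P>(\<omega> in M. a \<le> N0 \<omega> \<and> N0 \<omega> \<le> (b::real))
    + \<bar>\<P>(\<omega> in M. N \<omega> \<le> b) - \<P>(\<omega> in M. N0 \<omega> \<le> b)\<bar>
    + \<bar>\<P>(\<omega> in M. N \<omega> < a) - \<P>(\<omega> in M. N0 \<omega> < a)\<bar>"
proof -
  have "\<P>(\<omega> in M. a \<le> Z \<omega> \<and> Z \<omega> \<le> b) = \<P>(\<omega> in M. Z \<omega> \<le> b) - \<P>(\<omega> in M. Z \<omega> < a)"
    if [measurable]: "Z \<in> borel_measurable M" for Z
  proof -
    have "{\<omega> \<in> space M. a \<le> Z \<omega> \<and> Z \<omega> \<le> b} = {\<omega> \<in> space M. Z \<omega> \<le> b} - {\<omega> \<in> space M. Z \<omega> < a}" by auto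
    then show ?thesis using ab by (simp add: finite_measure_Diff subset_eq)
  qed
  from this[OF assms(1)] this[OF assms(2)] show ?thesis by simp
qed

text \<open>The part of the line to the left of a closed window is open, whereas the supremum only sees
  the events \<open>N \<omega> \<le> r\<close>; a limit from the left passes from these to \<open>N \<omega> < x\<close>.\<close>

lemma (in prob_space) prob_less_limit_bound:
  assumes [measurable]: "N \<in> borel_measurable M" "N0 \<in> borel_measurable M" and x: "0 < x"
    and le: "\<And>r. 0 \<le> r \<Longrightarrow> r powr m * \<bar>\<P>(\<omega> in M. N \<omega> \<le> r) - \<P>(\<omega> in M. N0 \<omega> \<le> r)\<bar> \<le> d"
  shows "x powr m * \<bar>\<P>(\<omega> in M. N \<omega> < x) - \<P>(\<omega> in M. N0 \<omega> < (x::real))\<bar> \<le> d"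
proof -
  have lim: "((\<lambda>r. \<P>(\<omega> in M. Z \<omega> \<le> r)) \<longlongrightarrow> \<P>(\<omega> in M. Z \<omega> < x)) (at_left x)"
    if [measurable]: "Z \<in> borel_measurable M" for Z
  proof -
    interpret D: prob_space "distr M borel Z" by (rule prob_space_distr) measurable
    interpret D: real_distribution "distr M borel Z" by unfold_locales simp_all
    have "cdf (distr M borel Z) = (\<lambda>r. \<P>(\<omega> in M. Z \<omega> \<le> r))"
      by (simp add: fun_eq_iff cdf_def measure_distr vimage_def Int_def conj_commute)
    moreover have "measure (distr M borel Z) {..<x} = \<P>(\<omega> in M. Z \<omega> < x)"
      by (simp add: measure_distr vimage_def Int_def conj_commute)
    ultimately show ?thesis using D.cdf_at_left[of x] by simp
  qed
  have "((\<lambda>r. r powr m * \<bar>\<P>(\<omega> in M. N \<omega> \<le> r) - \<P>(\<omega> in M. N0 \<omega> \<le> r)\<bar>)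
      \<longlongrightarrow> x powr m * \<bar>\<P>(\<omega> in M. N \<omega> < x) - \<P>(\<omega> in M. N0 \<omega> < x)\<bar>) (at_left x)"
    using x by (intro tendsto_intros lim) auto
  moreover have "\<forall>\<^sub>F r in at_left x. r powr m * \<bar>\<P>(\<omega> in M. N \<omega> \<le> r) - \<P>(\<omega> in M. N0 \<omega> \<le> r)\<bar> \<le> d"
    using eventually_at_left_real[OF x] by eventually_elim (auto intro: le)
  ultimately show ?thesis by (intro tendsto_upperbound) auto
qed

text \<open>Here \<open>a i\<close> are the weights of the cubic terms and \<open>D\<close> collects the terms that do not involve the window
  probabilities. Each window probability for \<open>N (i - 1)\<close> is at most the one for \<open>N 0\<close> plus two differences of
  distribution functions, which \<open>\<delta>\<close> bounds after multiplication with \<open>(r + 3 * \<epsilon>) powr m\<close> and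
  \<open>(r - 3 * \<epsilon>) powr m\<close>. For \<open>r \<ge> 4 * \<epsilon>\<close> both cost at most \<open>4 powr m * \<delta>\<close>, which the smallness of the
  weights turns into \<open>\<delta> / 12\<close>. The supremum \<open>\<delta>\<close> is finite because the tail bound takes over from \<open>rn\<close> on,
  so it can be absorbed.\<close>

lemma (in prob_space) self_improving_bound:
  fixes N :: "nat \<Rightarrow> 'a \<Rightarrow> real" and m t rn \<epsilon> \<Phi>0 \<Phi>m D :: real and a :: "nat \<Rightarrow> real"
  assumes meas: "\<And>k. k \<le> n \<Longrightarrow> N k \<in> borel_measurable M" and N0: "\<And>k \<omega>. 0 \<le> N k \<omega>"
    and m: "0 < m" and rn: "0 < rn" and \<epsilon>: "0 < \<epsilon>"
    and tail: "\<And>r k. rn \<le> r \<Longrightarrow> k \<le> n \<Longrightarrow> r powr m * \<P>(\<omega> in M. N k \<omega> \<ge> r) \<le> t"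
    and AC0: "\<And>r \<eta>. 0 \<le> r \<Longrightarrow> 0 \<le> \<eta> \<Longrightarrow> \<P>(\<omega> in M. r - \<eta> \<le> N 0 \<omega> \<and> N 0 \<omega> \<le> r + \<eta>) \<le> \<Phi>0 * \<eta>"
    and ACm: "\<And>r \<eta>. 0 \<le> \<eta> \<Longrightarrow> 2 * \<eta> \<le> r \<Longrightarrow> r powr m * \<P>(\<omega> in M. r - \<eta> \<le> N 0 \<omega> \<and> N 0 \<omega> \<le> r + \<eta>) \<le> \<Phi>m * \<eta>"
    and a: "\<And>i. 0 \<le> a i" and asum: "(\<Sum>i=1..n. a i) \<le> 1 / (12 * 4 powr m)" and D: "0 \<le> D"
    and step: "\<And>r k. 0 \<le> r \<Longrightarrow> k \<in> {1..n} \<Longrightarrow>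
       \<bar>\<P>(\<omega> in M. N k \<omega> \<le> r) - \<P>(\<omega> in M. N 0 \<omega> \<le> r)\<bar> \<le>
         \<P>(\<omega> in M. r - \<epsilon> \<le> N 0 \<omega> \<and> N 0 \<omega> \<le> r + \<epsilon>) + D +
         (\<Sum>i=1..n. a i * \<P>(\<omega> in M. r - 3 * \<epsilon> \<le> N (i - 1) \<omega> \<and> N (i - 1) \<omega> \<le> r + 3 * \<epsilon>))"
    and r: "0 \<le> r" and k: "k \<in> {1..n}"
  shows "r powr m * \<bar>\<P>(\<omega> in M. N k \<omega> \<le> r) - \<P>(\<omega> in M. N 0 \<omega> \<le> r)\<bar>
     \<le> t + 6 / 5 * (5 / 4 * \<Phi>m * \<epsilon> + 19 / 12 * (4 * \<epsilon>) powr m * \<Phi>0 * \<epsilon> + rn powr m * D)"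
proof -
  note [measurable] = meas
  have [measurable]: "N 0 \<in> borel_measurable M" by (rule meas) simp
  define Pr where "Pr k x = \<P>(\<omega> in M. N k \<omega> \<le> x)" for k x
  define Ps where "Ps k x = \<P>(\<omega> in M. N k \<omega> < x)" for k x
  define Win where "Win k a b = \<P>(\<omega> in M. a \<le> N k \<omega> \<and> N k \<omega> \<le> b)" for k a b
  define g where "g k r = r powr m * \<bar>Pr k r - Pr 0 r\<bar>" for k r
  have t0: "0 \<le> t" using tail[of rn 0] by (meson order.trans measure_nonneg powr_ge_zero mult_nonneg_nonneg le0 order_refl)
  have \<Phi>0: "0 \<le> \<Phi>0"
  proof -
    have "0 \<le> \<P>(\<omega> in M. 1 - 1 \<le> N 0 \<omega> \<and> N 0 \<omega> \<le> 1 + 1)" by simp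
    also have "\<dots> \<le> \<Phi>0 * 1" by (rule AC0) auto
    finally show ?thesis by simp
  qed
  have \<Phi>m: "0 \<le> \<Phi>m"
  proof -
    have "0 \<le> 2 powr m * \<P>(\<omega> in M. 2 - 1 \<le> N 0 \<omega> \<and> N 0 \<omega> \<le> 2 + 1)" by simp
    also have "\<dots> \<le> \<Phi>m * 1" by (rule ACm) auto
    finally show ?thesis by simp
  qed
  have P01: "0 \<le> Pr k x" "Pr k x \<le> 1" for k x by (auto simp: Pr_def)
  have g0: "0 \<le> g k r" for k r by (simp add: g_def)
  \<comment> \<open>From \<open>rn\<close> on, the difference of the distribution functions is a difference of tails.\<close>
  have far: "g k r \<le> t" if kr: "k \<le> n" "rn \<le> r" for k r
  proof -
    have mk[measurable]: "N k \<in> borel_measurable M" by (rule meas[OF kr(1)])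
    have compl: "1 - Pr l r \<le> \<P>(\<omega> in M. N l \<omega> \<ge> r)" if [measurable]: "N l \<in> borel_measurable M" for l
    proof -
      have "1 - Pr l r = measure M (space M - {\<omega> \<in> space M. N l \<omega> \<le> r})"
        unfolding Pr_def by (rule prob_compl[symmetric]) measurable
      also have "\<dots> \<le> \<P>(\<omega> in M. N l \<omega> \<ge> r)" by (intro finite_measure_mono) auto
      finally show ?thesis .
    qed
    have "\<bar>Pr k r - Pr 0 r\<bar> \<le> max (\<P>(\<omega> in M. N k \<omega> \<ge> r)) (\<P>(\<omega> in M. N 0 \<omega> \<ge> r))"
      using compl[of k] compl[of 0] P01[of k r] P01[of 0 r] mk by auto
    then have "g k r \<le> r powr m * max (\<P>(\<omega> in M. N k \<omega> \<ge> r)) (\<P>(\<omega> in M. N 0 \<omega> \<ge> r))"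
      unfolding g_def by (rule mult_left_mono) simp
    also have "\<dots> \<le> t" using tail[OF kr(2) kr(1)] tail[OF kr(2), of 0] by (auto simp: max_def)
    finally show ?thesis .
  qed
  define G where "G = {g k r | k r. k \<le> n \<and> 0 \<le> r}"
  define \<delta> where "\<delta> = Sup G"
  have gb: "g k r \<le> rn powr m + t" if "k \<le> n" "0 \<le> r" for k r
  proof (cases "rn \<le> r")
    case True
    then show ?thesis using far[OF that(1) True] by (simp add: add_increasing)
  next
    case False
    have "\<bar>Pr k r - Pr 0 r\<bar> \<le> 1" using P01[of k r] P01[of 0 r] by auto
    then have "g k r \<le> rn powr m * 1"
      unfolding g_def using False that m by (intro mult_mono powr_mono2) auto
    then show ?thesis using t0 by simp
  qed
  then have bdd: "bdd_above G" unfolding G_def by (intro bdd_aboveI[of _ "rn powr m + t"]) auto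
  have g\<delta>: "g k r \<le> \<delta>" if "k \<le> n" "0 \<le> r" for k r
    unfolding \<delta>_def using bdd that by (intro cSup_upper) (auto simp: G_def)
  have \<delta>0: "0 \<le> \<delta>" using g\<delta>[of 0 0] g0[of 0 0] by simp
  define B where "B = 5 / 4 * \<Phi>m * \<epsilon> + 19 / 12 * (4 * \<epsilon>) powr m * \<Phi>0 * \<epsilon> + rn powr m * D"
  have fm: "0 < 4 powr m" "1 \<le> 4 powr m" using m by (auto intro: ge_one_powr_ge_zero)
  \<comment> \<open>Before \<open>rn\<close>, the supremum itself enters, but with a small factor.\<close>
  have near: "g k r \<le> B + \<delta> / 6" if k: "k \<in> {1..n}" and r: "0 \<le> r" "r < rn" for k r
  proof -
    have rD: "r powr m * D \<le> rn powr m * D" using r m D by (intro mult_right_mono powr_mono2) auto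
    have base: "g k r \<le> r powr m * Win 0 (r - \<epsilon>) (r + \<epsilon>) + rn powr m * D
        + q / (12 * 4 powr m)" if q: "\<And>i. i \<in> {1..n} \<Longrightarrow> r powr m * Win (i - 1) (r - 3 * \<epsilon>) (r + 3 * \<epsilon>) \<le> q" and q0: "0 \<le> q" for q
    proof -
      have "g k r \<le> r powr m * (Win 0 (r - \<epsilon>) (r + \<epsilon>) + D + (\<Sum>i=1..n. a i * Win (i - 1) (r - 3 * \<epsilon>) (r + 3 * \<epsilon>)))"
        using step[OF r(1) k] unfolding g_def Pr_def Win_def by (rule mult_left_mono) simp
      also have "\<dots> = r powr m * Win 0 (r - \<epsilon>) (r + \<epsilon>) + r powr m * D + (\<Sum>i=1..n. a i * (r powr m * Win (i - 1) (r - 3 * \<epsilon>) (r + 3 * \<epsilon>)))"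
        by (simp add: distrib_left sum_distrib_left mult_ac)
      also have "(\<Sum>i=1..n. a i * (r powr m * Win (i - 1) (r - 3 * \<epsilon>) (r + 3 * \<epsilon>))) \<le> (\<Sum>i=1..n. a i * q)"
        using q a by (intro sum_mono mult_left_mono) auto
      also have "\<dots> \<le> (1 / (12 * 4 powr m)) * q"
        unfolding sum_distrib_right[symmetric] using asum q0 by (rule mult_right_mono)
      finally show ?thesis using rD by simp
    qed
    have mi: "N (i - 1) \<in> borel_measurable M" and ni: "i - 1 \<le> n" if "i \<in> {1..n}" for i
      using that by (auto intro: meas)
    show ?thesis
    proof (cases "4 * \<epsilon> \<le> r")
      case True
      have r4: "r powr m \<le> 4 powr m * x powr m" if "r \<le> 4 * x" for x
      proof -
        have "r powr m \<le> (4 * x) powr m" using r that m by (intro powr_mono2) auto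
        then show ?thesis by (simp add: powr_mult)
      qed
      have W0: "r powr m * Win 0 (x - \<epsilon>) (x + \<epsilon>) \<le> 4 powr m * (\<Phi>m * \<epsilon>)" if "r \<le> 4 * x" "2 * \<epsilon> \<le> x" for x
      proof -
        have "r powr m * Win 0 (x - \<epsilon>) (x + \<epsilon>) \<le> (4 powr m * x powr m) * Win 0 (x - \<epsilon>) (x + \<epsilon>)"
          using r4[OF that(1)] by (intro mult_right_mono) (auto simp: Win_def)
        also have "\<dots> \<le> 4 powr m * (\<Phi>m * \<epsilon>)"
          using ACm[of \<epsilon> x] that \<epsilon> fm unfolding Win_def mult.assoc by (intro mult_left_mono) auto
        finally show ?thesis .
      qed
      \<comment> \<open>The weighted anti-concentration inequality needs windows with \<open>2 * \<eta>\<close> at most their center;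
        three windows of half-width \<open>\<epsilon>\<close> satisfy this, one of half-width \<open>3 * \<epsilon>\<close> need not.\<close>
      have cover: "Win 0 (r - 3 * \<epsilon>) (r + 3 * \<epsilon>) \<le> Win 0 ((r - 2 * \<epsilon>) - \<epsilon>) ((r - 2 * \<epsilon>) + \<epsilon>) + Win 0 (r - \<epsilon>) (r + \<epsilon>)
          + Win 0 ((r + 2 * \<epsilon>) - \<epsilon>) ((r + 2 * \<epsilon>) + \<epsilon>)"
      proof -
        define S where "S x = {\<omega> \<in> space M. x - \<epsilon> \<le> N 0 \<omega> \<and> N 0 \<omega> \<le> x + \<epsilon>}" for x
        have S: "S x \<in> sets M" for x unfolding S_def by measurable
        have "Win 0 (r - 3 * \<epsilon>) (r + 3 * \<epsilon>) \<le> measure M ((S (r - 2 * \<epsilon>) \<union> S r) \<union> S (r + 2 * \<epsilon>))"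
          unfolding Win_def using S by (intro finite_measure_mono) (auto simp: S_def)
        also have "\<dots> \<le> measure M (S (r - 2 * \<epsilon>)) + measure M (S r) + measure M (S (r + 2 * \<epsilon>))"
          using S by (intro order_trans[OF measure_Un_le] add_right_mono measure_Un_le) auto
        finally show ?thesis by (simp add: Win_def S_def)
      qed
      have W1: "r powr m * Win 0 (r - \<epsilon>) (r + \<epsilon>) \<le> \<Phi>m * \<epsilon>"
        using ACm[of \<epsilon> r] True \<epsilon> by (simp add: Win_def)
      have W3: "r powr m * Win 0 (r - 3 * \<epsilon>) (r + 3 * \<epsilon>) \<le> 4 powr m * (3 * (\<Phi>m * \<epsilon>))"
        using mult_left_mono[OF cover, of "r powr m"] W0[of "r - 2 * \<epsilon>"] W0[of r] W0[of "r + 2 * \<epsilon>"] True \<epsilon>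
        by (simp add: distrib_left)
      define q where "q = 4 powr m * (3 * (\<Phi>m * \<epsilon>)) + \<delta> + 4 powr m * \<delta>"
      have "g k r \<le> r powr m * Win 0 (r - \<epsilon>) (r + \<epsilon>) + rn powr m * D + q / (12 * 4 powr m)"
      proof (rule base)
        show "0 \<le> q" using \<Phi>m \<epsilon> \<delta>0 by (simp add: q_def)
        fix i assume i: "i \<in> {1..n}"
        have "Win (i - 1) (r - 3 * \<epsilon>) (r + 3 * \<epsilon>) \<le> Win 0 (r - 3 * \<epsilon>) (r + 3 * \<epsilon>)
            + \<bar>Pr (i - 1) (r + 3 * \<epsilon>) - Pr 0 (r + 3 * \<epsilon>)\<bar> + \<bar>Ps (i - 1) (r - 3 * \<epsilon>) - Ps 0 (r - 3 * \<epsilon>)\<bar>"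
          unfolding Win_def Pr_def Ps_def using \<epsilon> by (intro prob_window_le mi[OF i]) auto
        from mult_left_mono[OF this, of "r powr m"]
        have "r powr m * Win (i - 1) (r - 3 * \<epsilon>) (r + 3 * \<epsilon>) \<le> r powr m * Win 0 (r - 3 * \<epsilon>) (r + 3 * \<epsilon>)
            + r powr m * \<bar>Pr (i - 1) (r + 3 * \<epsilon>) - Pr 0 (r + 3 * \<epsilon>)\<bar> + r powr m * \<bar>Ps (i - 1) (r - 3 * \<epsilon>) - Ps 0 (r - 3 * \<epsilon>)\<bar>"
          by (simp add: distrib_left)
        moreover have "r powr m * \<bar>Pr (i - 1) (r + 3 * \<epsilon>) - Pr 0 (r + 3 * \<epsilon>)\<bar> \<le> \<delta>"
        proof -
          have "r powr m * \<bar>Pr (i - 1) (r + 3 * \<epsilon>) - Pr 0 (r + 3 * \<epsilon>)\<bar> \<le> g (i - 1) (r + 3 * \<epsilon>)"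
            unfolding g_def using r \<epsilon> m by (intro mult_right_mono powr_mono2) auto
          then show ?thesis using g\<delta>[OF ni[OF i], of "r + 3 * \<epsilon>"] r \<epsilon> by simp
        qed
        moreover have "r powr m * \<bar>Ps (i - 1) (r - 3 * \<epsilon>) - Ps 0 (r - 3 * \<epsilon>)\<bar> \<le> 4 powr m * \<delta>"
        proof -
          have "(r - 3 * \<epsilon>) powr m * \<bar>Ps (i - 1) (r - 3 * \<epsilon>) - Ps 0 (r - 3 * \<epsilon>)\<bar> \<le> \<delta>"
            unfolding Ps_def using mi[OF i] True \<epsilon> g\<delta>[OF ni[OF i]]
            by (intro prob_less_limit_bound) (auto simp: g_def Pr_def)
          then have "4 powr m * ((r - 3 * \<epsilon>) powr m * \<bar>Ps (i - 1) (r - 3 * \<epsilon>) - Ps 0 (r - 3 * \<epsilon>)\<bar>) \<le> 4 powr m * \<delta>"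
            by (rule mult_left_mono) simp
          moreover have "r powr m * \<bar>Ps (i - 1) (r - 3 * \<epsilon>) - Ps 0 (r - 3 * \<epsilon>)\<bar> \<le> 4 powr m * (r - 3 * \<epsilon>) powr m * \<bar>Ps (i - 1) (r - 3 * \<epsilon>) - Ps 0 (r - 3 * \<epsilon>)\<bar>"
            using True by (intro mult_right_mono r4) auto
          ultimately show ?thesis unfolding mult.assoc by linarith
        qed
        ultimately show "r powr m * Win (i - 1) (r - 3 * \<epsilon>) (r + 3 * \<epsilon>) \<le> q"
          using W3 unfolding q_def by linarith
      qed
      also have "q / (12 * 4 powr m) = \<Phi>m * \<epsilon> / 4 + \<delta> / (12 * 4 powr m) + \<delta> / 12"
        using fm by (simp add: q_def add_divide_distrib)
      also have "\<delta> / (12 * 4 powr m) \<le> \<delta> / 12"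
        using fm \<delta>0 by (intro divide_left_mono) auto
      finally have "g k r \<le> r powr m * Win 0 (r - \<epsilon>) (r + \<epsilon>) + rn powr m * D + (\<Phi>m * \<epsilon> / 4 + \<delta> / 12 + \<delta> / 12)" by simp
      moreover have "5 / 4 * \<Phi>m * \<epsilon> = \<Phi>m * \<epsilon> + \<Phi>m * \<epsilon> / 4" by simp
      moreover have "0 \<le> 19 / 12 * (4 * \<epsilon>) powr m * \<Phi>0 * \<epsilon>" using \<Phi>0 \<epsilon> by simp
      ultimately show ?thesis using W1 unfolding B_def by linarith
    next
      case False
      have rm: "r powr m \<le> (4 * \<epsilon>) powr m" using False r m by (intro powr_mono2) auto
      have W1: "r powr m * Win 0 (r - \<epsilon>) (r + \<epsilon>) \<le> (4 * \<epsilon>) powr m * (\<Phi>0 * \<epsilon>)"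
        using AC0[of r \<epsilon>] r \<epsilon> rm by (intro mult_mono) (auto simp: Win_def)
      define q where "q = (4 * \<epsilon>) powr m * (7 * (\<Phi>0 * \<epsilon>)) + \<delta>"
      have q0: "0 \<le> q" using \<Phi>0 \<epsilon> \<delta>0 by (simp add: q_def)
      have "g k r \<le> r powr m * Win 0 (r - \<epsilon>) (r + \<epsilon>) + rn powr m * D + q / (12 * 4 powr m)"
      proof (rule base[OF _ q0])
        fix i assume i: "i \<in> {1..n}"
        note [measurable] = mi[OF i]
        have "Win (i - 1) (r - 3 * \<epsilon>) (r + 3 * \<epsilon>) \<le> Pr (i - 1) (r + 3 * \<epsilon>)"
          unfolding Win_def Pr_def by (intro finite_measure_mono) (blast, measurable)
        also have "\<dots> \<le> Pr 0 (r + 3 * \<epsilon>) + \<bar>Pr (i - 1) (r + 3 * \<epsilon>) - Pr 0 (r + 3 * \<epsilon>)\<bar>" by simp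
        finally have "r powr m * Win (i - 1) (r - 3 * \<epsilon>) (r + 3 * \<epsilon>) \<le> r powr m * Pr 0 (r + 3 * \<epsilon>) + r powr m * \<bar>Pr (i - 1) (r + 3 * \<epsilon>) - Pr 0 (r + 3 * \<epsilon>)\<bar>"
          by (simp add: mult_left_mono flip: distrib_left)
        also have "r powr m * \<bar>Pr (i - 1) (r + 3 * \<epsilon>) - Pr 0 (r + 3 * \<epsilon>)\<bar> \<le> \<delta>"
        proof -
          have "r powr m * \<bar>Pr (i - 1) (r + 3 * \<epsilon>) - Pr 0 (r + 3 * \<epsilon>)\<bar> \<le> g (i - 1) (r + 3 * \<epsilon>)"
            unfolding g_def using r \<epsilon> m by (intro mult_right_mono powr_mono2) auto
          then show ?thesis using g\<delta>[OF ni[OF i], of "r + 3 * \<epsilon>"] r \<epsilon> by simp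
        qed
        also have "r powr m * Pr 0 (r + 3 * \<epsilon>) \<le> (4 * \<epsilon>) powr m * (7 * (\<Phi>0 * \<epsilon>))"
        proof (intro mult_mono rm)
          have "Pr 0 (r + 3 * \<epsilon>) \<le> \<P>(\<omega> in M. 0 - 7 * \<epsilon> \<le> N 0 \<omega> \<and> N 0 \<omega> \<le> 0 + 7 * \<epsilon>)"
          proof -
            have "0 - 7 * \<epsilon> \<le> N 0 \<omega>" for \<omega> using N0[of 0 \<omega>] \<epsilon> by linarith
            then show ?thesis unfolding Pr_def using False by (intro finite_measure_mono) auto
          qed
          also have "\<dots> \<le> \<Phi>0 * (7 * \<epsilon>)" using \<epsilon> by (intro AC0) auto
          finally show "Pr 0 (r + 3 * \<epsilon>) \<le> 7 * (\<Phi>0 * \<epsilon>)" by simp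
        qed (auto simp: P01)
        finally show "r powr m * Win (i - 1) (r - 3 * \<epsilon>) (r + 3 * \<epsilon>) \<le> q" by (simp add: q_def)
      qed
      also have "q / (12 * 4 powr m) \<le> q / 12" using fm q0 by (intro divide_left_mono) auto
      finally have "g k r \<le> 19 / 12 * (4 * \<epsilon>) powr m * \<Phi>0 * \<epsilon> + rn powr m * D + \<delta> / 12"
        using W1 unfolding q_def by (simp add: algebra_simps add_divide_distrib)
      moreover have "0 \<le> 5 / 4 * \<Phi>m * \<epsilon>" using \<Phi>m \<epsilon> by simp
      ultimately show ?thesis unfolding B_def using \<delta>0 by linarith
    qed
  qed
  have B0: "0 \<le> B" using \<Phi>m \<Phi>0 \<epsilon> D by (simp add: B_def)
  have "\<delta> \<le> max t (B + \<delta> / 6)"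
    unfolding \<delta>_def
  proof (rule cSup_least)
    show "G \<noteq> {}" unfolding G_def by blast
    fix y assume "y \<in> G"
    then obtain l x where y: "y = g l x" "l \<le> n" "0 \<le> x" by (auto simp: G_def)
    show "y \<le> max t (B + Sup G / 6)"
    proof (cases "l = 0")
      case True
      then show ?thesis using t0 by (simp add: y g_def le_max_iff_disj)
    next
      case False
      then show ?thesis
        using far[OF y(2), of x] near[of l x] y unfolding \<delta>_def by (cases "rn \<le> x") (auto simp: le_max_iff_disj)
    qed
  qed
  then have "\<delta> \<le> t + 6 / 5 * B" using t0 B0 by (auto simp: max_def split: if_splits)
  then show ?thesis using g\<delta>[of k r] k r unfolding g_def Pr_def B_def by simp
qed


section \<open>The non-uniform bound\<close>

lemma eps_n_cube:
  assumes n: "1 \<le> n" and K: "0 < C0" "0 < L" "1 \<le> p"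
  shows "0 < eps_n C0 C p n L" "eps_n C0 C p n L ^ 3 = 2 * exp (2 * C) * C0 * (log_ep p)\<^sup>2 * L / sqrt (real n)"
proof -
  define K where "K = 2 * exp (2 * C) * C0 * (log_ep p)\<^sup>2 * L"
  have K0: "0 < K" using assms log_ep_ge_1[OF K(3)] by (simp add: K_def)
  have n0: "0 < real n" using n by simp
  show "0 < eps_n C0 C p n L" using K0 n0 by (simp add: eps_n_def K_def[symmetric])
  have "(K powr (1/3)) ^ 3 = K" using K0 by (simp add: powr_power)
  moreover have "(real n powr (1/6)) ^ 3 = sqrt (real n)" using n0 by (simp add: powr_power powr_half_sqrt)
  ultimately show "eps_n C0 C p n L ^ 3 = 2 * exp (2 * C) * C0 * (log_ep p)\<^sup>2 * L / sqrt (real n)"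
    by (simp add: eps_n_def power_divide K_def[symmetric])
qed

theorem theorem3p3:
  fixes M :: "'a measure" and p n :: nat
    and X Y :: "nat \<Rightarrow> 'a \<Rightarrow> nat \<Rightarrow> real"
    and \<Theta> :: "real \<Rightarrow> real" and C0 C m r :: real
  defines "L \<equiv> enn2real (L_n M p n X Y)"
  defines "\<epsilon> \<equiv> eps_n C0 C p n L"
  assumes "prob_space M"
    and "1 \<le> p" and "1 \<le> n"
    and X_meas: "\<And>i. i \<in> {1..n} \<Longrightarrow> X i \<in> measurable M (Rvec p)"
    and X_square_integrable:
      "\<And>i j. i \<in> {1..n} \<Longrightarrow> j < p \<Longrightarrow> integrable M (\<lambda>\<omega>. (X i \<omega> j)\<^sup>2)"
    and X_mean_zero: "\<And>i j. i \<in> {1..n} \<Longrightarrow> j < p \<Longrightarrow> (\<integral>\<omega>. X i \<omega> j \<partial>M) = 0"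
    and Y_gaussian: "\<And>i. i \<in> {1..n} \<Longrightarrow> gaussian_vector M p (Y i) (cov M (X i))"
    and indep: "prob_space.indep_vars M (\<lambda>_. Rvec p) (case_sum X Y) ({1..n} <+> {1..n})"
    and "0 < L_n M p n X Y" and "L_n M p n X Y < \<infinity>"
    and "0 < sigma_min M p (U p n X Y 0)"
    and "anti_concentration_constant 0 (\<Theta> 0)" and "anti_concentration_constant m (\<Theta> m)"
    and "smoothing_constants C0 C"
    and "0 < m" and "0 < r"
  shows "delta M p n X Y m \<le>
      ennreal (2 powr (2 * m\<^sup>2 / 3 + 8 * m / 3 + 1) * \<epsilon> powr (m + 1) * Phi_AC M p n X Y \<Theta> 0)
    + ennreal ((2 powr (2 * m / 3 + 1) + 2) * Phi_AC M p n X Y \<Theta> m * \<epsilon>)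
    + ennreal (2 * C0 * log_ep p * r powr m / \<epsilon>\<^sup>2) * M_n M p n X Y (2 powr (2 * m / 3) * \<epsilon>)
    + ennreal (r powr m) * Lbar_n M p n X Y m / ennreal (L * 2 powr m * exp C)
        * ennreal ((log_ep p / (real n * (2 powr (2 * m + 1) * exp (2 * C) * C0 * L)))
            powr ((m + 1) / 3))
    + tail_sup M p n X Y m r"
proof -
  have n: "1 \<le> n" and p: "1 \<le> p" and m: "0 < m" and r: "0 < r" by fact+
  have sc: "smoothing_constants C0 C" by fact
  interpret prob_space M by fact
  interpret clt_setting M p n X Y
    by unfold_locales (fact p n X_meas X_square_integrable X_mean_zero Y_gaussian indep)+
  have C0: "0 < C0" using sc by (simp add: smoothing_constants_def)
  have lg: "1 \<le> log_ep p" by (rule log_ep_ge_1[OF p])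
  have n0: "0 < real n" using n by simp
  define L3 where "L3 i = third_pseudo_moment M p (X i) (Y i)" for i
  define l3 where "l3 i = enn2real (L3 i)" for i
  have Ln: "L_n M p n X Y = ennreal L" unfolding L_def using \<open>L_n M p n X Y < \<infinity>\<close> by simp
  have L: "0 < L" using \<open>0 < L_n M p n X Y\<close> unfolding Ln by simp
  have L3: "L3 i = ennreal (l3 i)" if i: "i \<in> {1..n}" for i
  proof -
    have "ennreal (1 / real n) * (\<Sum>i=1..n. L3 i) < \<infinity>" using \<open>L_n M p n X Y < \<infinity>\<close> by (simp add: L_n_def L3_def)
    then have "(\<Sum>i=1..n. L3 i) < \<infinity>" using n0 by (auto simp: ennreal_mult_less_top)
    then have "L3 i < \<infinity>" using i by simp
    then show ?thesis by (simp add: l3_def)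
  qed
  have l0: "0 \<le> l3 i" for i by (simp add: l3_def)
  have lsum: "(\<Sum>i=1..n. l3 i) = n * L"
  proof -
    have "ennreal L = ennreal (1 / real n) * (\<Sum>i=1..n. ennreal (l3 i))"
      unfolding Ln[symmetric] L_n_def L3_def[symmetric] by (intro arg_cong2[where f="(*)"] refl sum.cong L3)
    also have "\<dots> = ennreal (1 / real n * (\<Sum>i=1..n. l3 i))"
      using l0 by (subst sum_ennreal, simp) (subst ennreal_mult, auto intro!: sum_nonneg)
    finally have "L = 1 / real n * (\<Sum>i=1..n. l3 i)" using l0 L by (simp add: sum_nonneg)
    then show ?thesis using n0 by (simp add: field_simps)
  qed
  have \<epsilon>: "0 < \<epsilon>" and \<epsilon>3: "\<epsilon> ^ 3 = 2 * exp (2 * C) * C0 * (log_ep p)\<^sup>2 * L / sqrt (real n)"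
    unfolding \<epsilon>_def by (rule eps_n_cube[OF n C0 L p])+
  define e where "e = 2 powr (2 * m / 3) * \<epsilon>"
  have e: "0 < e" using \<epsilon> by (simp add: e_def)
  have \<epsilon>e: "\<epsilon> \<le> e" using \<epsilon> m by (simp add: e_def ge_one_powr_ge_zero)
  have e3: "e ^ 3 = 4 powr m * (2 * exp (2 * C) * C0 * (log_ep p)\<^sup>2 * L) / sqrt (real n)"
  proof -
    have "(2 powr (2 * m / 3)) ^ 3 = 2 powr (2 * m)" by (simp add: powr_power)
    also have "\<dots> = (2 powr 2) powr m" by (simp only: powr_powr)
    also have "\<dots> = 4 powr m" by simp
    finally show ?thesis by (simp add: e_def power_mult_distrib \<epsilon>3)
  qed
  define m2' where "m2' i = (\<integral>\<^sup>+x. ennreal ((linfnorm p x)\<^sup>2) *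
         indicator {x. linfnorm p x \<ge> sqrt (real n) * e / log_ep p} x \<partial>(abs_zeta M p (X i) (Y i)))" for i
  define m2 where "m2 i = enn2real (m2' i)" for i
  define G where "G i = mu_i M p (Y i) powr (m + 1) + sigma_max M p (Y i) powr (m + 1) * ((m + 1) / exp 1) powr ((m + 1) / 2)" for i
  have G0: "0 \<le> G i" for i by (simp add: G_def)
  define Lb where "Lb = (\<Sum>i=1..n. G i * l3 i) / n"
  have Lb: "Lbar_n M p n X Y m = ennreal Lb"
  proof -
    have "Lbar_n M p n X Y m = ennreal (1 / real n) * (\<Sum>i=1..n. ennreal (G i) * ennreal (l3 i))"
      unfolding Lbar_n_def G_def L3_def[symmetric] by (intro arg_cong2[where f="(*)"] refl sum.cong L3)
    also have "\<dots> = ennreal (1 / real n) * ennreal (\<Sum>i=1..n. G i * l3 i)"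
      using G0 l0 by (simp add: ennreal_mult[symmetric] sum_ennreal)
    finally show ?thesis using G0 l0 by (simp add: Lb_def ennreal_mult[symmetric] sum_nonneg)
  qed
  have Lb0: "0 \<le> Lb" using G0 l0 by (auto simp: Lb_def intro!: sum_nonneg divide_nonneg_nonneg)
  note AC = anti_concentration_U0[OF \<open>0 < sigma_min M p (U p n X Y 0)\<close>]
  define \<Phi>0 \<Phi>m where "\<Phi>0 = Phi_AC M p n X Y \<Theta> 0" and "\<Phi>m = Phi_AC M p n X Y \<Theta> m"
  have AC0: "\<P>(\<omega> in M. x - \<eta> \<le> normU 0 \<omega> \<and> normU 0 \<omega> \<le> x + \<eta>) \<le> \<Phi>0 * \<eta>" if "0 \<le> x" "0 \<le> \<eta>" for x \<eta>
    using AC[of 0 \<Theta> x \<eta>] that \<open>anti_concentration_constant 0 (\<Theta> 0)\<close> by (simp add: normU_def \<Phi>0_def rpow_def)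
  have ACm: "x powr m * \<P>(\<omega> in M. x - \<eta> \<le> normU 0 \<omega> \<and> normU 0 \<omega> \<le> x + \<eta>) \<le> \<Phi>m * \<eta>" if "0 \<le> \<eta>" "2 * \<eta> \<le> x" for x \<eta>
    using AC[of m \<Theta> x \<eta>] that m \<open>anti_concentration_constant m (\<Theta> m)\<close> by (simp add: normU_def \<Phi>m_def rpow_def)
  have \<Phi>0: "0 \<le> \<Phi>0" using order_trans[OF measure_nonneg AC0[of 1 1]] by simp
  have \<Phi>m: "0 \<le> \<Phi>m" using order_trans[OF mult_nonneg_nonneg[OF powr_ge_zero measure_nonneg] ACm[of 1 2]] by simp
  define A where "A = C0 * log_ep p / (n * e\<^sup>2)"
  define \<alpha> where "\<alpha> = exp C * C0 * (log_ep p)\<^sup>2 / (6 * (n * sqrt n) * e ^ 3)"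
  have A0: "0 \<le> A" and \<alpha>0: "0 \<le> \<alpha>" using C0 lg e by (auto simp: A_def \<alpha>_def)
  \<comment> \<open>Here the choice of the scale pays off: all other quantities cancel from the weight of the cubic terms.\<close>
  have \<alpha>n: "\<alpha> * n = 1 / (exp C * 12 * 4 powr m * L)"
  proof -
    have "exp (2 * C) = exp C * exp C" by (simp flip: exp_add)
    then show ?thesis unfolding \<alpha>_def e3 using n0 C0 lg L by (simp add: field_simps)
  qed
  define s where "s = sqrt (real n) * e / log_ep p"
  have s: "0 < s" using n0 e lg by (simp add: s_def)
  define T where "T i = \<P>(\<omega> in M. linfnorm p (Y i \<omega>) > (2 * log_ep p - 1) * s)" for i
  have T: "T i \<le> 5 * ((2 / s) powr (m + 1) * G i)" if "i \<in> {1..n}" for i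
    using gaussian_vector_norm_tail[OF prob_space_axioms p Y_gauss[OF that] psd[OF that] cov_sym, of "m + 1" s] m s
    by (simp add: T_def G_def)
  define z where "z = (log_ep p / (real n * (2 powr (2 * m + 1) * exp (2 * C) * C0 * L))) powr ((m + 1) / 3)"
  have z: "(2 / s) powr (m + 1) = 2 powr (m + 1) * z"
  proof -
    have "s ^ 3 = real n * (2 powr (2 * m + 1) * exp (2 * C) * C0 * L) / log_ep p"
    proof -
      have "s ^ 3 = (sqrt (real n)) ^ 3 * e ^ 3 / (log_ep p) ^ 3" by (simp add: s_def power_mult_distrib power_divide)
      also have "(sqrt (real n)) ^ 3 = real n * sqrt (real n)" by (simp add: power3_eq_cube)
      also have "real n * sqrt (real n) * e ^ 3 / (log_ep p) ^ 3 = real n * (4 powr m * 2 * exp (2 * C) * C0 * L) / log_ep p"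
        unfolding e3 using n0 lg by (simp add: power2_eq_square power3_eq_cube)
      also have "4 powr m * 2 = 2 powr (2 * m + 1)"
      proof -
        have "2 powr (2 * m) = (2 powr 2) powr m" by (simp only: powr_powr)
        then show ?thesis by (simp add: powr_add)
      qed
      finally show ?thesis .
    qed
    then have "log_ep p / (real n * (2 powr (2 * m + 1) * exp (2 * C) * C0 * L)) = (1 / s) ^ 3"
      by (simp add: power_one_over)
    then have "z = ((1 / s) powr 3) powr ((m + 1) / 3)" using s by (simp add: z_def)
    also have "\<dots> = (1 / s) powr (3 * ((m + 1) / 3))" by (rule powr_powr)
    also have "3 * ((m + 1) / 3) = m + 1" by simp
    finally show ?thesis by (simp add: powr_mult[symmetric])
  qed
  have z0: "0 \<le> z" by (simp add: z_def)
  show ?thesis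
  proof (cases "M_n M p n X Y e = \<infinity> \<or> tail_sup M p n X Y m r = \<infinity>")
    case True
    have "0 < 2 * C0 * log_ep p * r powr m / \<epsilon>\<^sup>2" using C0 lg r \<epsilon> by simp
    then have "ennreal (2 * C0 * log_ep p * r powr m / \<epsilon>\<^sup>2) * M_n M p n X Y e + tail_sup M p n X Y m r = \<infinity>"
      using True by (auto simp: ennreal_mult_eq_top_iff)
    then show ?thesis unfolding e_def[symmetric] by (metis (no_types, lifting) ennreal_add_eq_top infinity_ennreal_def top_greatest)
  next
    case False
    have m2: "m2' i = ennreal (m2 i)" if i: "i \<in> {1..n}" for i
    proof -
      have "ennreal (1 / real n) * (\<Sum>i=1..n. m2' i) < \<infinity>" using False by (simp add: M_n_def m2'_def less_top)
      then have "(\<Sum>i=1..n. m2' i) < \<infinity>" using n0 by (auto simp: ennreal_mult_less_top)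
      then have "m2' i < \<infinity>" using i by simp
      then show ?thesis by (simp add: m2_def)
    qed
    have m20: "0 \<le> m2 i" for i by (simp add: m2_def)
    define Mn where "Mn = (\<Sum>i=1..n. m2 i) / n"
    have Mn: "M_n M p n X Y e = ennreal Mn"
    proof -
      have "M_n M p n X Y e = ennreal (1 / real n) * (\<Sum>i=1..n. ennreal (m2 i))"
        unfolding M_n_def m2'_def[symmetric] by (intro arg_cong2[where f="(*)"] refl sum.cong m2)
      also have "\<dots> = ennreal (1 / real n) * ennreal (\<Sum>i=1..n. m2 i)"
        using m20 by (simp add: sum_ennreal)
      finally show ?thesis using m20 by (simp add: Mn_def ennreal_mult[symmetric] sum_nonneg)
    qed
    have Mn0: "0 \<le> Mn" using m20 by (auto simp: Mn_def intro!: sum_nonneg divide_nonneg_nonneg)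
    define t where "t = enn2real (tail_sup M p n X Y m r)"
    have t: "tail_sup M p n X Y m r = ennreal t" using False by (simp add: t_def less_top)
    have t0: "0 \<le> t" by (simp add: t_def)
    have tail: "x powr m * \<P>(\<omega> in M. normU k \<omega> \<ge> x) \<le> t" if "r \<le> x" "k \<le> n" for x k
    proof -
      have "ennreal (x powr m * \<P>(\<omega> in M. normU k \<omega> \<ge> x)) \<le>
        ennreal (Max ((\<lambda>k. rpow x m * \<P>(\<omega> in M. linfnorm p (U p n X Y k \<omega>) \<ge> x)) ` {0..n}))"
        using that m by (intro ennreal_leI Max_ge) (auto simp: rpow_def normU_def)
      also have "\<dots> \<le> tail_sup M p n X Y m r"
        unfolding tail_sup_def using that by (intro SUP_upper2[of x]) auto
      finally show ?thesis unfolding t using t0 by simp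
    qed
    define D where "D = (\<Sum>i=1..n. A * m2 i + \<alpha> * l3 i * T i)"
    have D0: "0 \<le> D" unfolding D_def using A0 \<alpha>0 m20 l0
      by (intro sum_nonneg add_nonneg_nonneg mult_nonneg_nonneg) (auto simp: T_def)
    have main: "x powr m * \<bar>\<P>(\<omega> in M. normU k \<omega> \<le> x) - \<P>(\<omega> in M. normU 0 \<omega> \<le> x)\<bar>
       \<le> t + 6 / 5 * (5 / 4 * \<Phi>m * e + 19 / 12 * (4 * e) powr m * \<Phi>0 * e + r powr m * D)"
      if x: "0 \<le> x" and k: "k \<in> {1..n}" for x k
    proof (rule self_improving_bound[where n=n and a="\<lambda>i. \<alpha> * l3 i"])
      show "(\<Sum>i=1..n. \<alpha> * l3 i) \<le> 1 / (12 * 4 powr m)"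
      proof -
        have "(\<Sum>i=1..n. \<alpha> * l3 i) = (\<alpha> * n) * L" unfolding sum_distrib_left[symmetric] lsum by simp
        also have "\<dots> = 1 / (exp C * (12 * 4 powr m))" unfolding \<alpha>n using L by simp
        also have "\<dots> \<le> 1 / (12 * 4 powr m)"
          using sc by (intro divide_left_mono) (auto simp: smoothing_constants_def)
        finally show ?thesis .
      qed
      fix x :: real and k assume x: "0 \<le> x" and k: "k \<in> {1..n}"
      define Q where "Q i = \<P>(\<omega> in M. x - 3 * e \<le> normU (i - 1) \<omega> \<and> normU (i - 1) \<omega> \<le> x + 3 * e)" for i
      have "\<bar>\<P>(\<omega> in M. normU k \<omega> \<le> x) - \<P>(\<omega> in M. normU 0 \<omega> \<le> x)\<bar> \<le>
         \<P>(\<omega> in M. x - e \<le> normU 0 \<omega> \<and> normU 0 \<omega> \<le> x + e) + (\<Sum>i=1..n. A * m2 i + \<alpha> * l3 i * (Q i + T i))"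
        unfolding A_def \<alpha>_def Q_def T_def s_def
        by (rule probability_difference_le[OF sc e x _ _ m20 l0]) (use m2 L3 k in \<open>auto simp: m2'_def L3_def\<close>)
      also have "(\<Sum>i=1..n. A * m2 i + \<alpha> * l3 i * (Q i + T i)) = D + (\<Sum>i=1..n. \<alpha> * l3 i * Q i)"
        unfolding D_def sum.distrib[symmetric] by (intro sum.cong refl) (simp add: distrib_left)
      finally show "\<bar>\<P>(\<omega> in M. normU k \<omega> \<le> x) - \<P>(\<omega> in M. normU 0 \<omega> \<le> x)\<bar> \<le>
         \<P>(\<omega> in M. x - e \<le> normU 0 \<omega> \<and> normU 0 \<omega> \<le> x + e) + D +
         (\<Sum>i=1..n. \<alpha> * l3 i * \<P>(\<omega> in M. x - 3 * e \<le> normU (i - 1) \<omega> \<and> normU (i - 1) \<omega> \<le> x + 3 * e))"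
        unfolding Q_def by linarith
    qed (use normU_meas normU_nonneg m r e tail AC0 ACm \<alpha>0 l0 D0 x k in auto)
    \<comment> \<open>The first four terms of the bound; \<open>6 / 5 * B\<close> is compared with them term by term.\<close>
    define x1 where "x1 = 2 powr (2 * m\<^sup>2 / 3 + 8 * m / 3 + 1) * \<epsilon> powr (m + 1) * \<Phi>0"
    define x2 where "x2 = (2 powr (2 * m / 3 + 1) + 2) * \<Phi>m * \<epsilon>"
    define x3 where "x3 = 2 * C0 * log_ep p * r powr m / \<epsilon>\<^sup>2"
    define x4 where "x4 = r powr m * Lb / (L * 2 powr m * exp C) * z"
    have x1: "6 / 5 * (19 / 12 * (4 * e) powr m * \<Phi>0 * e) \<le> x1"
    proof -
      have "2 * (4 * e) powr m * e = 2 powr (2 * m\<^sup>2 / 3 + 8 * m / 3 + 1) * \<epsilon> powr (m + 1)"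
      proof -
        have 4: "4 * e = 2 powr (2 + 2 * m / 3) * \<epsilon>" by (simp add: e_def powr_add)
        have "(4 * e) powr m = 2 powr (2 * m + 2 * m\<^sup>2 / 3) * \<epsilon> powr m"
        proof -
          have "(2 + 2 * m / 3) * m = 2 * m + 2 * m\<^sup>2 / 3" by (simp add: power2_eq_square algebra_simps)
          then show ?thesis unfolding 4 powr_mult powr_powr by simp
        qed
        then have "2 * (4 * e) powr m * e = (2 powr 1 * 2 powr (2 * m + 2 * m\<^sup>2 / 3) * 2 powr (2 * m / 3)) * (\<epsilon> powr m * \<epsilon> powr 1)"
          using \<epsilon> by (simp add: e_def)
        also have "\<dots> = 2 powr (1 + (2 * m + 2 * m\<^sup>2 / 3) + 2 * m / 3) * \<epsilon> powr (m + 1)" by (simp only: powr_add)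
        also have "1 + (2 * m + 2 * m\<^sup>2 / 3) + 2 * m / 3 = 2 * m\<^sup>2 / 3 + 8 * m / 3 + 1" by simp
        finally show ?thesis .
      qed
      then have "x1 = 2 * ((4 * e) powr m * \<Phi>0 * e)" by (simp add: x1_def mult_ac)
      moreover have "0 \<le> (4 * e) powr m * \<Phi>0 * e" using \<Phi>0 e by simp
      moreover have "6 / 5 * (19 / 12 * (4 * e) powr m * \<Phi>0 * e) = 19 / 10 * ((4 * e) powr m * \<Phi>0 * e)" by simp
      ultimately show ?thesis by linarith
    qed
    have x2: "6 / 5 * (5 / 4 * \<Phi>m * e) \<le> x2"
    proof -
      have "x2 = 2 * (\<Phi>m * e) + 2 * (\<Phi>m * \<epsilon>)" by (simp add: x2_def e_def powr_add algebra_simps)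
      moreover have "0 \<le> \<Phi>m * e" "0 \<le> \<Phi>m * \<epsilon>" using \<Phi>m e \<epsilon> by auto
      moreover have "6 / 5 * (5 / 4 * \<Phi>m * e) = 3 / 2 * (\<Phi>m * e)" by simp
      ultimately show ?thesis by linarith
    qed
    have x34: "6 / 5 * (r powr m * D) \<le> x3 * Mn + x4"
    proof -
      have "D = A * (\<Sum>i=1..n. m2 i) + (\<Sum>i=1..n. \<alpha> * l3 i * T i)"
        by (simp add: D_def sum.distrib sum_distrib_left)
      also have "A * (\<Sum>i=1..n. m2 i) = C0 * log_ep p / e\<^sup>2 * Mn" using n0 by (simp add: A_def Mn_def)
      also have "C0 * log_ep p / e\<^sup>2 * Mn \<le> C0 * log_ep p / \<epsilon>\<^sup>2 * Mn"
        using C0 lg \<epsilon> \<epsilon>e Mn0 by (intro mult_right_mono divide_left_mono power_mono) auto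
      also have "(\<Sum>i=1..n. \<alpha> * l3 i * T i) \<le> (\<Sum>i=1..n. \<alpha> * l3 i * (5 * ((2 / s) powr (m + 1) * G i)))"
        using T \<alpha>0 l0 by (intro sum_mono mult_left_mono) auto
      also have "\<dots> = 5 * (2 / s) powr (m + 1) * (\<alpha> * (\<Sum>i=1..n. G i * l3 i))"
        by (simp add: sum_distrib_left mult_ac)
      also have "(\<Sum>i=1..n. G i * l3 i) = n * Lb" using n0 by (simp add: Lb_def)
      also have "5 * (2 / s) powr (m + 1) * (\<alpha> * (n * Lb)) = 5 * (2 / s) powr (m + 1) * (\<alpha> * n) * Lb" by simp
      also have "\<dots> = 5 / 6 * (Lb / (L * 2 powr m * exp C) * z)"
      proof -
        have "4 powr m = (2 powr m * 2 powr m :: real)" by (simp flip: powr_mult)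
        then show ?thesis unfolding z \<alpha>n using L by (simp add: powr_add field_simps)
      qed
      finally have "D \<le> C0 * log_ep p / \<epsilon>\<^sup>2 * Mn + 5 / 6 * (Lb / (L * 2 powr m * exp C) * z)" by simp
      then have "6 / 5 * (r powr m * D) \<le> 6 / 5 * (r powr m * (C0 * log_ep p / \<epsilon>\<^sup>2 * Mn + 5 / 6 * (Lb / (L * 2 powr m * exp C) * z)))"
        by (intro mult_left_mono) auto
      also have "\<dots> = 3 / 5 * (x3 * Mn) + x4" by (simp add: x3_def x4_def field_simps)
      also have "\<dots> \<le> x3 * Mn + x4"
      proof -
        have "0 \<le> x3 * Mn" using Mn0 C0 lg by (simp add: x3_def)
        then show ?thesis by linarith
      qed
      finally show ?thesis .
    qed
    have nn: "0 \<le> x1" "0 \<le> x2" "0 \<le> x3" "0 \<le> x4"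
      using \<Phi>0 \<Phi>m \<epsilon> C0 lg Lb0 L z0 by (auto simp: x1_def x2_def x3_def x4_def)
    have "delta M p n X Y m \<le> ennreal (x1 + x2 + x3 * Mn + x4 + t)"
      unfolding delta_def
    proof (rule SUP_least)
      fix x :: real assume "x \<in> {0..}"
      then have x: "0 \<le> x" by simp
      have "rpow x m * \<bar>\<P>(\<omega> in M. linfnorm p (U p n X Y k \<omega>) \<le> x) - \<P>(\<omega> in M. linfnorm p (U p n X Y 0 \<omega>) \<le> x)\<bar>
          \<le> x1 + x2 + x3 * Mn + x4 + t" if "k \<in> {1..n}" for k
        using main[OF x that] x1 x2 x34 m unfolding normU_def rpow_def distrib_left by simp
      then show "ennreal (Max ((\<lambda>k. rpow x m * \<bar>\<P>(\<omega> in M. linfnorm p (U p n X Y k \<omega>) \<le> x)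
         - \<P>(\<omega> in M. linfnorm p (U p n X Y 0 \<omega>) \<le> x)\<bar>) ` {1..n})) \<le> ennreal (x1 + x2 + x3 * Mn + x4 + t)"
        using n by (intro ennreal_leI Max.boundedI) auto
    qed
    also have "\<dots> = ennreal x1 + ennreal x2 + ennreal x3 * ennreal Mn + ennreal x4 + ennreal t"
      using nn Mn0 t0 by (simp add: ennreal_mult)
    also have "ennreal x4 = ennreal (r powr m) * ennreal Lb / ennreal (L * 2 powr m * exp C) * ennreal z"
      using Lb0 L z0 by (simp add: x4_def divide_ennreal ennreal_mult flip: ennreal_mult)
    finally show ?thesis
      unfolding e_def[symmetric] Mn Lb t z_def[symmetric] x1_def x2_def x3_def \<Phi>0_def \<Phi>m_def .
  qed
qed

end
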